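(* The Leech lattice $\Lambda\subset\mathbb R^{24}$ and the root lattice $\mathsf E_8\subset\mathbb R^8$ are rigid.
   Context: The Leech lattice $\Lambda$ is the (unique up to isometry) even unimodular lattice in $\mathbb R^{24}$ without vectors of squared length $2$. The root lattice is $\mathsf E_8=\{\boldsymbol x\in\mathbb R^8:\ \boldsymbol x\in\mathbb Z^8\cup(\tfrac12+\mathbb Z)^8,\ \sum_{i=1}^8x_i\in2\mathbb Z\}$. A lattice in $\mathbb R^d$ is $L=A\mathbb Z^d$ with $A\in\mathsf{GL}_d(\mathbb R)$; for each such basis $A$ of $L$ the positive definite quadratic form (PQF) $Q=A^tA$, $Q[\boldsymbol x]=\boldsymbol x^tQ\boldsymbol x$, is said to be associated to $L$. A polytope $P=\operatorname{conv}\{\boldsymbol v_1,\dots,\boldsymbol v_n\}$ with $\boldsymbol v_1,\dots,\boldsymbol v_n\in\mathbb Z^d$ is a Delone polytope of a PQF $Q$ if there are $\boldsymbol c\in\mathbb R^d$ and $r\in\mathbb R$ with $Q[\boldsymbol v_i-\boldsymbol c]=r^2$ for $i=1,\dots,n$ and $Q[\boldsymbol v-\boldsymbol c]>r^2$ for all $\boldsymbol v\in\mathbb Z^d\setminus\{\boldsymbol v_1,\dots,\boldsymbol v_n\}$. The set of all Delone polytopes of $Q$ is its Delone subdivision $\operatorname{Del}(Q)$. The set of all PQFs with a fixed Delone subdivision is a (relatively) open polyhedral cone in the space of real symmetric $d\times d$ matrices, the secondary cone of the subdivision. A PQF $Q$ is rigid if the secondary cone of $\operatorname{Del}(Q)$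 has dimension $1$, i.e. if every PQF $Q'$ with $\operatorname{Del}(Q')=\operatorname{Del}(Q)$ is a positive multiple of $Q$. A lattice is rigid if an associated PQF is rigid. *)

theory Defs
  imports "HOL-Analysis.Analysis"
begin

definition int_vectors :: "(real^'n) set" where
  "int_vectors = {x. \<forall>i. x $ i \<in> \<int>}"

definition is_lattice_basis :: "real^'n^'n \<Rightarrow> (real^'n) set \<Rightarrow> bool" where
  "is_lattice_basis A L \<longleftrightarrow> invertible A \<and> L = (*v) A ` int_vectors"

definition is_lattice :: "(real^'n) set \<Rightarrow> bool" where
  "is_lattice L \<longleftrightarrow> (\<exists>A. is_lattice_basis A L)"

definition qform :: "real^'n^'n \<Rightarrow> real^'n \<Rightarrow> real" where
  "qform Q x = x \<bullet> (Q *v x)"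

definition is_PQF :: "real^'n^'n \<Rightarrow> bool" where
  "is_PQF Q \<longleftrightarrow> transpose Q = Q \<and> (\<forall>x. x \<noteq> 0 \<longrightarrow> 0 < qform Q x)"

definition associated_PQF :: "real^'n^'n \<Rightarrow> (real^'n) set \<Rightarrow> bool" where
  "associated_PQF Q L \<longleftrightarrow> (\<exists>A. is_lattice_basis A L \<and> Q = transpose A ** A)"

text \<open>
  Delone polytopes of every dimension are admitted: nothing forces \<open>V\<close> to span the space
  affinely, so the faces of Delone polytopes are themselves Delone polytopes.
\<close>

definition is_Delone_polytope :: "real^'n^'n \<Rightarrow> (real^'n) set \<Rightarrow> bool" where
  "is_Delone_polytope Q P \<longleftrightarrow>
     (\<exists>V. finite V \<and> V \<noteq> {} \<and> V \<subseteq> int_vectors \<and> P = convex hull V \<and>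
       (\<exists>c r. (\<forall>v\<in>V. qform Q (v - c) = r\<^sup>2) \<and>
              (\<forall>v\<in>int_vectors - V. qform Q (v - c) > r\<^sup>2)))"

definition Del :: "real^'n^'n \<Rightarrow> (real^'n) set set" where
  "Del Q = {P. is_Delone_polytope Q P}"

definition secondary_cone :: "(real^'n) set set \<Rightarrow> (real^'n^'n) set" where
  "secondary_cone D = {Q. is_PQF Q \<and> Del Q = D}"

text \<open>
  The dimension of the cone is the dimension of its linear span in the space of matrices.
\<close>

definition rigid_PQF :: "real^'n^'n \<Rightarrow> bool" where
  "rigid_PQF Q \<longleftrightarrow> is_PQF Q \<and> dim (secondary_cone (Del Q)) = 1"

definition rigid_lattice :: "(real^'n) set \<Rightarrow> bool" where
  "rigid_lattice L \<longleftrightarrow> (\<exists>Q. associated_PQF Q L \<and> rigid_PQF Q)"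

definition even_lattice :: "(real^'n) set \<Rightarrow> bool" where
  "even_lattice L \<longleftrightarrow> is_lattice L \<and> (\<forall>x\<in>L. \<exists>k::int. x \<bullet> x = 2 * of_int k)"

definition unimodular_lattice :: "(real^'n) set \<Rightarrow> bool" where
  "unimodular_lattice L \<longleftrightarrow>
     (\<forall>x\<in>L. \<forall>y\<in>L. x \<bullet> y \<in> \<int>) \<and> (\<exists>A. is_lattice_basis A L \<and> \<bar>det A\<bar> = 1)"

text \<open>
  The Leech lattice is determined only up to isometry, so it is a predicate here; a claim
  about it is to be made for every lattice satisfying the predicate.
\<close>

definition is_Leech_lattice :: "(real^24) set \<Rightarrow> bool" where
  "is_Leech_lattice L \<longleftrightarrow>
     even_lattice L \<and> unimodular_lattice L \<and> (\<forall>x\<in>L. x \<bullet> x \<noteq> 2)"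

definition E8_lattice :: "(real^8) set" where
  "E8_lattice = {x. ((\<forall>i. x $ i \<in> \<int>) \<or> (\<forall>i. x $ i - 1/2 \<in> \<int>)) \<and>
                    (\<exists>k::int. (\<Sum>i\<in>UNIV. x $ i) = 2 * of_int k)}"

text \<open>
  Dimension one is the same as uniqueness up to positive multiples.
\<close>

lemma PQF_nonzero: "is_PQF (Q :: real^'n^'n) \<Longrightarrow> Q \<noteq> 0"
proof
  assume a: "is_PQF Q" "Q = 0"
  have "(1 :: real^'n) \<noteq> 0" by simp
  then have "0 < qform Q 1" using a(1) unfolding is_PQF_def by blast
  then show False using a(2) by (simp add: qform_def)
qed

lemma rigid_PQF_iff:
  fixes Q :: "real^'n^'n"
  assumes Q: "is_PQF Q"
  shows "rigid_PQF Q \<longleftrightarrow>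
    (\<forall>Q'. is_PQF Q' \<and> Del Q' = Del Q \<longrightarrow> (\<exists>t>0. Q' = t *\<^sub>R Q))" (is "_ \<longleftrightarrow> ?R")
proof -
  let ?C = "secondary_cone (Del Q)"
  have QC: "Q \<in> ?C" using Q by (simp add: secondary_cone_def)
  have Q0: "Q \<noteq> 0" using PQF_nonzero[OF Q] .
  have dQ: "dim {Q} = 1" using Q0 by simp
  show ?thesis
  proof
    assume "rigid_PQF Q"
    then have d: "dim ?C = 1" by (simp add: rigid_PQF_def)
    have "span {Q} = span ?C"
      using QC d dQ by (intro dim_eq_span) auto
    show ?R
    proof (intro allI impI)
      fix Q' :: "real^'n^'n"
      assume Q': "is_PQF Q' \<and> Del Q' = Del Q"
      then have "Q' \<in> span ?C" by (intro span_base) (simp add: secondary_cone_def)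
      then have "Q' \<in> span {Q}" using \<open>span {Q} = span ?C\<close> by simp
      then obtain t where t: "Q' = t *\<^sub>R Q" by (auto simp: span_singleton)
      have n: "(1 :: real^'n) \<noteq> 0" by simp
      have "0 < qform Q' 1" "0 < qform Q 1" using Q Q' n unfolding is_PQF_def by blast+
      moreover have "qform Q' 1 = t * qform Q 1"
        unfolding t qform_def by (simp add: scaleR_matrix_vector_assoc[symmetric])
      ultimately have "t > 0" by (simp add: zero_less_mult_iff)
      with t show "\<exists>t>0. Q' = t *\<^sub>R Q" by blast
    qed
  next
    assume R: ?R
    have "?C \<subseteq> span {Q}"
      using R by (fastforce simp: secondary_cone_def span_singleton)
    then have "dim ?C \<le> dim {Q}" by (metis dim_subset dim_span)
    moreover have "dim {Q} \<le> dim ?C" using QC by (intro dim_subset) auto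
    ultimately show "rigid_PQF Q" using Q dQ by (simp add: rigid_PQF_def)
  qed
qed

end

theory Submission
  imports Defs "HOL-Complex_Analysis.Complex_Analysis"
begin

text \<open>
  Below, the norm of a vector means its squared length.

  Both lattices are rigid because they contain a full orthogonal frame inside one class modulo
  \<open>2L\<close>. Let \<open>Q\<close> and \<open>Q'\<close> have the same Delone subdivision and let \<open>z\<close> be a lattice vector. The
  lattice points closest to \<open>z/2\<close> with respect to \<open>Q\<close> are the vertices of a Delone polytope
  symmetric about \<open>z/2\<close>, hence also lie on an ellipsoid for \<open>Q'\<close>. Adding the equations
  of the antipodal pairs \<open>v, z - v\<close> and \<open>0, z\<close> eliminates the centre and shows that \<open>Q'\<close> is constant on
  the shortest vectors of each class modulo \<open>2L\<close> (\<open>same_Delone_minimal_vectors\<close>). In a lattice of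
  minimal norm at least \<open>m\<close> every vector of norm \<open>2m\<close> is shortest in its class. If \<open>d\<close> pairwise orthogonal
  vectors \<open>e\<^sub>i\<close> of norm \<open>2m\<close> lie in one class, then the vectors \<open>(\<plusminus>e\<^sub>i \<plusminus> e\<^sub>j \<plusminus> e\<^sub>k \<plusminus> e\<^sub>l)/2\<close> are lattice vectors
  of norm \<open>2m\<close> too, and those with the same product of signs are congruent. The resulting linear
  equations say that the \<open>e\<^sub>i\<close> are orthogonal and of equal length for \<open>Q'\<close>, so that \<open>Q'\<close> is a multiple
  of \<open>Q\<close> (\<open>rigid_of_frame\<close>). For the \<open>E\<^sub>8\<close> lattice the doubled unit vectors are such a frame.

  For the Leech lattice the frame is found by Conway's count. Vectors of norm 4, 6 and 8 that are
  congruent modulo \<open>2L\<close> are equal, opposite, or orthogonal of norm 8. If no class contained a frame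
  of 48 vectors of norm 8, a class would contain at most 46 of them, and the numbers \<open>N\<^sub>4, N\<^sub>6, N\<^sub>8\<close> of vectors of
  norm 4, 6, 8 would satisfy \<open>1 + N\<^sub>4/2 + N\<^sub>6/2 + N\<^sub>8/46 \<le> 2\<^sup>2\<^sup>4\<close> (\<open>exists_frame\<close>), which the true values
  196560, 16773120, 398034000 violate.

  These values come from the theta series. For a self-dual lattice of dimension 24,
  Poisson summation gives \<open>\<Theta>(1/t) = t\<^sup>1\<^sup>2 \<Theta>(t)\<close> (\<open>lattice_theta_inversion\<close>). A power series in \<open>q = e\<^sup>-\<^sup>2\<^sup>\<pi>\<^sup>t\<close> with
  this symmetry whose first two coefficients vanish is zero (\<open>weight_12_vanishing\<close>); evenness and the absence of
  vectors of norm 2 therefore determine the theta series. It is identified as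
  \<open>E\<^sub>4\<^sup>3 - 720 \<Delta>\<close>, where \<open>E\<^sub>4\<close> and \<open>\<Delta>\<close> are written in Jacobi's theta constants, for which the one-dimensional case
  of Poisson summation supplies the symmetry (\<open>comparison_form_inversion\<close>).
\<close>

no_notation fps_nth (infixl "$" 75)

section \<open>Integral vectors and Gaussian sums\<close>

definition vec_of_ints :: "('n::finite \<Rightarrow> int) \<Rightarrow> real^'n" where
  "vec_of_ints f = (\<chi> i. of_int (f i))"

lemma bij_vec_of_ints: "bij_betw vec_of_ints UNIV (int_vectors :: (real^'n) set)"
proof -
  have "x \<in> range vec_of_ints" if "x \<in> int_vectors" for x :: "real^'n"
  proof
    show "x = vec_of_ints (\<lambda>i. \<lfloor>x $ i\<rfloor>)"
      using that by (auto simp: vec_of_ints_def int_vectors_def vec_eq_iff elim!: Ints_cases)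
  qed simp
  moreover have "inj (vec_of_ints :: _ \<Rightarrow> real^'n)"
    by (auto simp: inj_def vec_of_ints_def vec_eq_iff)
  ultimately show ?thesis
    by (auto simp: bij_betw_def vec_of_ints_def int_vectors_def)
qed

lemma countable_int_vectors: "countable (int_vectors :: (real^'n) set)"
  using bij_betw_imp_surj_on[OF bij_vec_of_ints] by (metis countableI_type countable_image)

lemma int_vectors_add [intro]: "x \<in> int_vectors \<Longrightarrow> y \<in> int_vectors \<Longrightarrow> x + y \<in> int_vectors"
  and int_vectors_diff [intro]: "x \<in> int_vectors \<Longrightarrow> y \<in> int_vectors \<Longrightarrow> x - y \<in> int_vectors"
  and int_vectors_uminus [intro]: "x \<in> int_vectors \<Longrightarrow> - x \<in> int_vectors"
  and int_vectors_0 [simp]: "0 \<in> int_vectors"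
  by (auto simp: int_vectors_def)

lemma int_vectors_axis [simp]: "axis i 1 \<in> int_vectors"
  by (auto simp: int_vectors_def axis_def)

lemma int_vectors_inner:
  "x \<in> int_vectors \<Longrightarrow> y \<in> int_vectors \<Longrightarrow> x \<bullet> y \<in> \<int>"
  by (auto simp: int_vectors_def inner_vec_def)

lemma summable_on_int_gaussian:
  fixes c :: real assumes "c > 0"
  shows "(\<lambda>k::int. exp (- c * (of_int k)\<^sup>2)) summable_on UNIV"
proof -
  have nat: "(\<lambda>k::nat. exp (- c * (of_nat k)\<^sup>2)) summable_on UNIV"
  proof (rule norm_summable_imp_summable_on, rule summable_comparison_test')
    show "summable (\<lambda>k. exp (-c) ^ k)" using assms by (intro summable_geometric) auto
    show "norm (norm (exp (- c * (real k)\<^sup>2))) \<le> exp (- c) ^ k" for k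
    proof -
      have "real k \<le> (real k)\<^sup>2" by (metis of_nat_le_iff of_nat_power power2_nat_le_imp_le power2_eq_square le_square)
      then show ?thesis using assms by (simp flip: exp_of_nat_mult add: mult.commute)
    qed
  qed
  have 1: "(\<lambda>k::int. exp (- c * (of_int k)\<^sup>2)) summable_on range int"
    by (subst summable_on_reindex) (auto simp: o_def nat[simplified])
  have 2: "(\<lambda>k::int. exp (- c * (of_int k)\<^sup>2)) summable_on range (\<lambda>n. - int n)"
    by (subst summable_on_reindex) (auto simp: o_def nat[simplified] inj_def)
  have "(UNIV :: int set) = range int \<union> range (\<lambda>n. - int n)"
    by (auto intro: int_cases2)
  then show ?thesis
    using summable_on_union[OF 1 2] by simp
qed

lemma summable_on_gaussian:
  fixes c :: real assumes "c > 0"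
  shows "(\<lambda>n::real^'n. exp (- c * (norm n)\<^sup>2)) summable_on int_vectors"
proof -
  have "Infinite_Set_Sum.abs_summable_on (\<lambda>g. \<Prod>i\<in>UNIV. exp (- c * (of_int (g i :: int))\<^sup>2)) (PiE (UNIV::'n set) (\<lambda>_. UNIV))"
    by (rule abs_summable_on_prod_PiE)
       (use summable_on_int_gaussian[OF assms] in \<open>auto simp: abs_summable_equivalent[symmetric]\<close>)
  then have "(\<lambda>g. \<Prod>i\<in>UNIV. exp (- c * (of_int (g i :: int))\<^sup>2)) summable_on (UNIV :: ('n \<Rightarrow> int) set)"
    by (simp add: abs_summable_equivalent[symmetric] abs_summable_summable PiE_UNIV_domain)
  also have "(\<lambda>g. \<Prod>i\<in>UNIV. exp (- c * (of_int (g i :: int))\<^sup>2)) = (\<lambda>g::'n \<Rightarrow> int. exp (- c * (norm (vec_of_ints g))\<^sup>2))"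
    by (auto simp: fun_eq_iff vec_of_ints_def norm_vec_def L2_set_def sum_nonneg exp_sum sum_distrib_left)
  finally show ?thesis
    using summable_on_reindex_bij_betw[OF bij_vec_of_ints, of "\<lambda>n. exp (- c * (norm n)\<^sup>2)"] by blast
qed

section \<open>The unit cell and the characters of the torus\<close>

definition unit_cell :: "(real^'n) set" where
  "unit_cell = {y. \<forall>i. 0 \<le> y $ i \<and> y $ i < 1}"

definition int_enum :: "nat \<Rightarrow> real^'n" where
  "int_enum = from_nat_into int_vectors"

lemma infinite_int_vectors: "infinite (int_vectors :: (real^'n) set)"
proof -
  obtain i :: 'n where True by simp
  have "inj (\<lambda>k::nat. of_nat k *\<^sub>R (axis i 1 :: real^'n))"
    by (auto simp: inj_def)
  moreover have "range (\<lambda>k::nat. of_nat k *\<^sub>R (axis i 1 :: real^'n)) \<subseteq> int_vectors"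
    by (auto simp: int_vectors_def axis_def)
  ultimately show ?thesis
    by (metis infinite_UNIV_nat infinite_iff_countable_subset)
qed

lemma bij_int_enum: "bij_betw int_enum UNIV (int_vectors :: (real^'n) set)"
  unfolding int_enum_def
  by (intro bij_betw_from_nat_into countable_int_vectors infinite_int_vectors)

lemma int_enum_in [simp]: "int_enum k \<in> int_vectors"
  using bij_int_enum by (auto simp: bij_betw_def)

lemma int_enum_inj: "int_enum j = int_enum k \<longleftrightarrow> j = k"
  using bij_int_enum by (auto simp: bij_betw_def inj_on_def)

lemma int_enum_surj: "n \<in> int_vectors \<Longrightarrow> \<exists>k. n = int_enum k"
  using bij_int_enum by (auto simp: bij_betw_def)

lemma measurable_unit_cell [measurable]: "(unit_cell :: (real^'n) set) \<in> sets borel"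
proof -
  have "unit_cell = (\<Inter>i. {y::real^'n. 0 \<le> y $ i \<and> y $ i < 1})"
    by (auto simp: unit_cell_def)
  also have "\<dots> \<in> sets borel"
    by (intro sets.countable_INT'' countableI_type) measurable
  finally show ?thesis .
qed

lemma unit_cell_translates: "(\<Union>k. {x. x - int_enum k \<in> unit_cell}) = (UNIV :: (real^'n) set)"
proof -
  have "\<exists>k. x - int_enum k \<in> unit_cell" for x :: "real^'n"
  proof -
    have "(\<chi> i. of_int \<lfloor>x $ i\<rfloor>) \<in> (int_vectors :: (real^'n) set)"
      by (auto simp: int_vectors_def)
    then obtain k where k: "(\<chi> i. of_int \<lfloor>x $ i\<rfloor>) = (int_enum k :: real^'n)"
      using int_enum_surj by blast
    have "x - int_enum k \<in> unit_cell"
      unfolding k[symmetric] by (auto simp: unit_cell_def) linarith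
    then show ?thesis ..
  qed
  then show ?thesis by auto
qed

lemma unit_cell_unique:
  assumes "x - m \<in> unit_cell" "x - n \<in> unit_cell" "m \<in> int_vectors" "n \<in> int_vectors"
  shows "m = (n :: real^'n)"
proof -
  have "m $ i = n $ i" for i
  proof -
    obtain a b :: int where ab: "m $ i = of_int a" "n $ i = of_int b"
      using assms(3,4) by (auto simp: int_vectors_def elim!: Ints_cases) (metis Ints_cases)
    have "0 \<le> x $ i - m $ i" "x $ i - m $ i < 1" "0 \<le> x $ i - n $ i" "x $ i - n $ i < 1"
      using assms(1,2) by (auto simp: unit_cell_def)
    then have "a = b" unfolding ab by linarith
    then show ?thesis unfolding ab by simp
  qed
  then show ?thesis by (simp add: vec_eq_iff)
qed

lemma unit_cell_disjoint:
  "j \<noteq> k \<Longrightarrow> {x. x - int_enum j \<in> unit_cell} \<inter> {x. x - int_enum k \<in> unit_cell} = ({} :: (real^'n) set)"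
  using unit_cell_unique int_enum_in int_enum_inj by blast

lemma measurable_translate_cell [measurable]: "{x. x - a \<in> (unit_cell :: (real^'n) set)} \<in> sets borel"
  by measurable

lemma lborel_integral_translate:
  fixes f :: "'a::euclidean_space \<Rightarrow> 'b::{banach,second_countable_topology}"
  assumes [measurable]: "f \<in> borel_measurable borel"
  shows "(LINT x|lborel. f (x + c)) = (LINT x|lborel. f x)"
proof -
  have "(LINT x|lborel. f x) = (LINT x|distr lborel borel ((+) c). f x)"
    by (simp only: lborel_distr_plus)
  also have "\<dots> = (LINT x|lborel. f (c + x))"
    by (rule integral_distr) measurable
  finally show ?thesis by (simp add: add.commute)
qed

lemma lborel_nn_integral_translate:
  fixes f :: "'a::euclidean_space \<Rightarrow> ennreal"
  assumes [measurable]: "f \<in> borel_measurable borel"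
  shows "(\<integral>\<^sup>+x. f (x + c) \<partial>lborel) = (\<integral>\<^sup>+x. f x \<partial>lborel)"
proof -
  have "(\<integral>\<^sup>+x. f x \<partial>lborel) = (\<integral>\<^sup>+x. f x \<partial>distr lborel borel ((+) c))"
    by (simp only: lborel_distr_plus)
  also have "\<dots> = (\<integral>\<^sup>+x. f (c + x) \<partial>lborel)"
    by (rule nn_integral_distr) measurable
  finally show ?thesis by (simp add: add.commute)
qed

text \<open>
  Integer translates of the half-open cell tile the space; a function on the space can thus be
  integrated over the cell after summing over translates. This is what turns Fourier
  coefficients of a periodisation into values of the Fourier transform.
\<close>

lemma lborel_integral_unfold:
  fixes h :: "real^'n \<Rightarrow> 'b::{banach,second_countable_topology}"
  assumes h: "integrable lborel h"
  shows "(LINT x|lborel. h x) = (\<Sum>k. LINT y:unit_cell|lborel. h (y + int_enum k))"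
proof -
  let ?A = "\<lambda>k. {x. x - int_enum k \<in> (unit_cell :: (real^'n) set)}"
  have [measurable]: "h \<in> borel_measurable borel" using h by auto
  have "(LINT x|lborel. h x) = (LINT x:(\<Union>k. ?A k)|lborel. h x)"
    unfolding unit_cell_translates by (simp add: set_lebesgue_integral_def)
  also have "\<dots> = (\<Sum>k. LINT x:?A k|lborel. h x)"
    by (rule lebesgue_integral_countable_add)
       (use unit_cell_disjoint h in \<open>auto simp: unit_cell_translates set_integrable_def\<close>)
  also have "\<dots> = (\<Sum>k. LINT y:unit_cell|lborel. h (y + int_enum k))"
  proof (rule suminf_cong)
    fix k
    have "(LINT x:?A k|lborel. h x) = (LINT y|lborel. indicator (?A k) (y + int_enum k) *\<^sub>R h (y + int_enum k))"
      unfolding set_lebesgue_integral_def by (rule lborel_integral_translate[symmetric]) measurable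
    then show "(LINT x:?A k|lborel. h x) = (LINT y:unit_cell|lborel. h (y + int_enum k))"
      by (simp add: set_lebesgue_integral_def indicator_def)
  qed
  finally show ?thesis .
qed

lemma lborel_nn_integral_unfold:
  fixes h :: "real^'n \<Rightarrow> ennreal"
  assumes [measurable]: "h \<in> borel_measurable borel"
  shows "(\<integral>\<^sup>+x. h x \<partial>lborel) = (\<Sum>k. \<integral>\<^sup>+y\<in>unit_cell. h (y + int_enum k) \<partial>lborel)"
proof -
  let ?A = "\<lambda>k. {x. x - int_enum k \<in> (unit_cell :: (real^'n) set)}"
  have "(\<integral>\<^sup>+x. h x \<partial>lborel) = (\<integral>\<^sup>+x\<in>(\<Union>k. ?A k). h x \<partial>lborel)"
    unfolding unit_cell_translates by simp
  also have "\<dots> = (\<Sum>k. \<integral>\<^sup>+x\<in>?A k. h x \<partial>lborel)"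
    by (rule nn_integral_disjoint_family)
       (use unit_cell_disjoint in \<open>auto simp: disjoint_family_on_def\<close>)
  also have "\<dots> = (\<Sum>k. \<integral>\<^sup>+y\<in>unit_cell. h (y + int_enum k) \<partial>lborel)"
  proof (rule suminf_cong)
    fix k
    have "(\<integral>\<^sup>+x\<in>?A k. h x \<partial>lborel) = (\<integral>\<^sup>+y. h (y + int_enum k) * indicator (?A k) (y + int_enum k) \<partial>lborel)"
      by (rule lborel_nn_integral_translate[symmetric]) measurable
    then show "(\<integral>\<^sup>+x\<in>?A k. h x \<partial>lborel) = (\<integral>\<^sup>+y\<in>unit_cell. h (y + int_enum k) \<partial>lborel)"
      by (simp add: indicator_def)
  qed
  finally show ?thesis .
qed

lemma unit_cell_between: "box 0 1 \<subseteq> (unit_cell :: (real^'n) set)" "unit_cell \<subseteq> cbox 0 (1 :: real^'n)"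
  by (auto simp: unit_cell_def mem_box_cart less_imp_le)

lemma emeasure_unit_cell: "emeasure lborel (unit_cell :: (real^'n) set) = 1"
proof -
  have *: "(\<Prod>b\<in>Basis. ((1::real^'n) - 0) \<bullet> b) = 1"
    by (rule prod.neutral) (auto simp: Basis_vec_def inner_axis)
  have le: "\<And>b. b \<in> Basis \<Longrightarrow> (0::real^'n) \<bullet> b \<le> 1 \<bullet> b"
    by (auto simp: Basis_vec_def inner_axis)
  have "emeasure lborel (box 0 1 :: (real^'n) set) = 1" "emeasure lborel (cbox 0 1 :: (real^'n) set) = 1"
    using le * by simp_all
  moreover have "emeasure lborel (box 0 1 :: (real^'n) set) \<le> emeasure lborel (unit_cell :: (real^'n) set)"
    "emeasure lborel (unit_cell :: (real^'n) set) \<le> emeasure lborel (cbox 0 1 :: (real^'n) set)"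
    using unit_cell_between by (auto intro!: emeasure_mono)
  ultimately show ?thesis by (metis order_antisym)
qed

lemma set_integrable_cell_bounded:
  fixes f :: "real^'n \<Rightarrow> 'b::{banach,second_countable_topology}"
  assumes [measurable]: "f \<in> borel_measurable borel" and "\<And>y. y \<in> unit_cell \<Longrightarrow> norm (f y) \<le> B"
  shows "set_integrable lborel unit_cell f"
  unfolding set_integrable_def
proof (rule integrableI_bounded_set[where A = unit_cell and B = B])
  show "emeasure lborel (unit_cell :: (real^'n) set) < \<infinity>" by (simp add: emeasure_unit_cell)
qed (use assms in \<open>auto simp: indicator_def\<close>)

definition char_fun :: "real^'n \<Rightarrow> real^'n \<Rightarrow> complex" where
  "char_fun w y = cis (2 * pi * (w \<bullet> y))"

lemma continuous_on_char_fun [continuous_intros]: "continuous_on S (char_fun w)"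
  unfolding char_fun_def cis_conv_exp by (intro continuous_intros)

lemma measurable_char_fun [measurable]: "char_fun w \<in> borel_measurable borel"
  by (intro borel_measurable_continuous_onI continuous_intros)

lemma norm_char_fun [simp]: "norm (char_fun w y) = 1"
  by (simp add: char_fun_def)

lemma char_fun_add: "char_fun w (x + y) = char_fun w x * char_fun w y"
  by (simp add: char_fun_def inner_add_right ring_distribs cis_mult)

lemma char_fun_add_left: "char_fun (v + w) y = char_fun v y * char_fun w y"
  by (simp add: char_fun_def inner_add_left ring_distribs cis_mult)

lemma char_fun_int: "w \<in> int_vectors \<Longrightarrow> n \<in> int_vectors \<Longrightarrow> char_fun w n = 1"
  unfolding char_fun_def using int_vectors_inner[of w n]
  by (metis cis_multiple_2pi)

lemma char_fun_periodic: "w \<in> int_vectors \<Longrightarrow> n \<in> int_vectors \<Longrightarrow> char_fun w (y + n) = char_fun w y"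
  by (simp add: char_fun_add char_fun_int)

text \<open>
  Cutting the shifted cell along the integer translates of the cell and
  reassembling the pieces inside the cell does not change the values of a periodic function.
\<close>

lemma cell_integral_shift:
  fixes \<psi> :: "real^'n \<Rightarrow> 'b::{banach,second_countable_topology}"
  assumes [measurable]: "\<psi> \<in> borel_measurable borel" and B: "\<And>y. norm (\<psi> y) \<le> B"
    and per: "\<And>y n. n \<in> int_vectors \<Longrightarrow> \<psi> (y + n) = \<psi> y"
  shows "(LINT y:unit_cell|lborel. \<psi> (y + s)) = (LINT y:unit_cell|lborel. \<psi> y)"
proof -
  let ?C = "unit_cell :: (real^'n) set"
  let ?S = "{x. x - s \<in> ?C}"
  have int: "set_integrable lborel ?C \<psi>"
    using B by (intro set_integrable_cell_bounded) auto
  have "integrable lborel (\<lambda>y. indicator ?S y *\<^sub>R \<psi> y)"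
  proof (rule integrableI_bounded_set[where A = ?S and B = B])
    have "emeasure lborel ?S = (\<integral>\<^sup>+y. indicator ?S y \<partial>lborel)" by simp
    also have "\<dots> = (\<integral>\<^sup>+y. indicator ?S (y + s) \<partial>lborel)"
      by (rule lborel_nn_integral_translate[symmetric]) measurable
    also have "\<dots> = (\<integral>\<^sup>+y. indicator ?C y \<partial>lborel)" by (simp add: indicator_def)
    also have "\<dots> = 1" by (simp add: emeasure_unit_cell)
    finally show "emeasure lborel ?S < \<infinity>" by simp
  qed (use B in \<open>auto simp: indicator_def intro: order_trans[OF norm_ge_zero]\<close>)
  have "(LINT y:?C|lborel. \<psi> (y + s)) = (LINT y|lborel. indicator ?S (y + s) *\<^sub>R \<psi> (y + s))"
    by (simp add: set_lebesgue_integral_def indicator_def)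
  also have "\<dots> = (LINT y|lborel. indicator ?S y *\<^sub>R \<psi> y)"
    by (rule lborel_integral_translate) measurable
  also have "\<dots> = (\<Sum>k. LINT y:?C|lborel. indicator ?S (y + int_enum k) *\<^sub>R \<psi> (y + int_enum k))"
    by (rule lborel_integral_unfold) fact
  also have "\<dots> = (\<Sum>k. LINT y:(?C \<inter> {y. y - (s - int_enum k) \<in> ?C})|lborel. \<psi> y)"
    by (intro suminf_cong)
       (auto simp: set_lebesgue_integral_def indicator_def per algebra_simps intro!: Bochner_Integration.integral_cong)
  also have "\<dots> = (LINT y:(\<Union>k. ?C \<inter> {y. y - (s - int_enum k) \<in> ?C})|lborel. \<psi> y)"
  proof (rule lebesgue_integral_countable_add[symmetric])
    show "(?C \<inter> {y. y - (s - int_enum j) \<in> ?C}) \<inter> (?C \<inter> {y. y - (s - int_enum k) \<in> ?C}) = {}" if "j \<noteq> k" for j k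
    proof -
      have "False" if "y - (s - int_enum j) \<in> ?C" "y - (s - int_enum k) \<in> ?C" for y
        using unit_cell_unique[of "y - s" "- int_enum j" "- int_enum k"] that \<open>j \<noteq> k\<close>
        by (auto simp: algebra_simps int_enum_inj int_vectors_uminus)
      then show ?thesis by auto
    qed
    show "set_integrable lborel (\<Union>k. ?C \<inter> {y. y - (s - int_enum k) \<in> ?C}) \<psi>"
      by (rule set_integrable_subset[OF int]) auto
  qed measurable
  also have "(\<Union>k. ?C \<inter> {y. y - (s - int_enum k) \<in> ?C}) = ?C"
  proof -
    have "\<exists>k. y - (s - int_enum k) \<in> ?C" for y
    proof -
      obtain k where k: "(y - s) - int_enum k \<in> ?C"
        using unit_cell_translates by (metis (mono_tags, lifting) UNIV_I UN_E mem_Collect_eq)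
      obtain j where "- int_enum k = (int_enum j :: real^'n)"
        using int_enum_surj[OF int_vectors_uminus[OF int_enum_in]] by metis
      then have "y - (s - int_enum j) \<in> ?C" using k by (metis diff_diff_eq2 diff_minus_eq_add add_diff_eq add_uminus_conv_diff diff_add_eq)
      then show ?thesis ..
    qed
    then show ?thesis by auto
  qed
  finally show ?thesis .
qed

text \<open>
  Shifting by half a period along \<open>w\<close> changes the sign of the character, while the shift leaves
  the integral unchanged.
\<close>

lemma integral_char_fun:
  fixes w :: "real^'n"
  assumes w: "w \<in> int_vectors"
  shows "(LINT y:unit_cell|lborel. char_fun w y) = (if w = 0 then 1 else 0)"
proof (cases "w = 0")
  case True
  then show ?thesis
    by (simp add: char_fun_def set_lebesgue_integral_def measure_def emeasure_unit_cell)
next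
  case False
  define s where "s = (1 / (2 * (w \<bullet> w))) *\<^sub>R w"
  have "char_fun w s = -1" using False by (simp add: char_fun_def s_def)
  then have "(LINT y:unit_cell|lborel. char_fun w (y + s)) = - (LINT y:unit_cell|lborel. char_fun w y)"
    by (simp add: char_fun_add set_lebesgue_integral_def)
  moreover have "(LINT y:unit_cell|lborel. char_fun w (y + s)) = (LINT y:unit_cell|lborel. char_fun w y)"
    by (rule cell_integral_shift[where B = 1]) (auto simp: char_fun_periodic w)
  ultimately show ?thesis using False by simp
qed

section \<open>Uniqueness of Fourier coefficients\<close>

text \<open>
  A continuous periodic function is a continuous function on the torus \<open>{z. \<forall>i. |z\<^sub>i| = 1}\<close>, a compact
  subset of \<open>\<complex>\<^sup>n\<close>; the Stone--Weierstrass theorem applies there, and polynomials in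
  the real and imaginary parts of the \<open>z\<^sub>i\<close> are trigonometric polynomials.
\<close>

lemma periodic_trig_approx:
  fixes h :: "real^'n \<Rightarrow> real"
  assumes cont: "continuous_on UNIV h"
    and per: "\<And>y n. n \<in> int_vectors \<Longrightarrow> h (y + n) = h y" and "e > 0"
  obtains g :: "complex^'n \<Rightarrow> real" where "real_polynomial_function g"
    "\<And>y. \<bar>h y - g (\<chi> i. cis (2 * pi * y $ i))\<bar> < e"
proof -
  define E :: "real^'n \<Rightarrow> complex^'n" where "E = (\<lambda>y. \<chi> i. cis (2 * pi * y $ i))"
  define S :: "(complex^'n) set" where "S = {z. \<forall>i. norm (z $ i) = 1}"
  define ar :: "complex^'n \<Rightarrow> real^'n" where "ar = (\<lambda>z. \<chi> i. Arg (z $ i) / (2 * pi))"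
  have ES: "E y \<in> S" for y by (simp add: E_def S_def)
  have cis_Arg_norm1: "cis (Arg w) = w" if "norm w = 1" for w
  proof -
    have "w \<noteq> 0" using that by auto
    then show ?thesis using that cis_Arg[of w] by (simp add: sgn_div_norm)
  qed
  have E_ar: "E (ar z) = z" if "z \<in> S" for z
  proof -
    have "cis (Arg (z $ i)) = z $ i" for i
      using that by (intro cis_Arg_norm1) (simp add: S_def)
    then show ?thesis by (simp add: E_def ar_def vec_eq_iff)
  qed
  have h_E: "h y = h y'" if "E y = E y'" for y y'
  proof -
    have "y $ i - y' $ i \<in> \<int>" for i
    proof -
      have "cis (2 * pi * y $ i) = cis (2 * pi * y' $ i)" using that by (auto simp: E_def vec_eq_iff)
      then have "sin (2 * pi * y $ i) = sin (2 * pi * y' $ i) \<and> cos (2 * pi * y $ i) = cos (2 * pi * y' $ i)"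
        by (simp add: cis.simps complex_eq_iff)
      then obtain n :: int where "2 * pi * y $ i = 2 * pi * y' $ i + 2 * pi * n"
        unfolding sin_cos_eq_iff by (metis mult.assoc)
      then have "2 * pi * (y $ i - y' $ i - n) = 0" by (simp add: algebra_simps)
      then have "y $ i - y' $ i = of_int n" by simp
      then show ?thesis by simp
    qed
    then have "h (y' + (y - y')) = h y'" by (intro per) (auto simp: int_vectors_def)
    then show ?thesis by simp
  qed
  have "compact S"
  proof (rule compact_eq_bounded_closed[THEN iffD2], safe)
    have "norm z \<le> (\<Sum>i\<in>(UNIV::'n set). 1)" if "z \<in> S" for z
      using that L2_set_le_sum[of UNIV "\<lambda>i. norm (z $ i)"] by (simp add: S_def norm_vec_def)
    then show "bounded S" unfolding bounded_iff by blast
    have "S = (\<Inter>i. {z. norm (z $ i) = 1})" by (auto simp: S_def)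
    also have "closed \<dots>" by (intro closed_INT ballI closed_Collect_eq continuous_intros)
    finally show "closed S" .
  qed
  have "continuous_on S (h \<circ> ar)"
    unfolding continuous_on_eq_continuous_within
  proof
    fix z0 assume z0: "z0 \<in> S"
    \<comment> \<open>near \<open>z0\<close> a continuous choice of arguments replaces the principal one\<close>
    define b :: "complex^'n \<Rightarrow> real^'n" where "b = (\<lambda>z. ar z0 + (\<chi> i. Arg (z $ i / z0 $ i) / (2 * pi)))"
    have nz: "z0 $ i \<noteq> 0" for i
      using z0 by (metis (mono_tags, lifting) S_def mem_Collect_eq norm_zero zero_neq_one)
    have "isCont b z0"
    proof -
      have "isCont (\<lambda>z. Arg (z $ i / z0 $ i)) z0" for i
        by (rule isCont_o2[where g = Arg])
           (use nz in \<open>auto intro!: continuous_intros continuous_at_Arg\<close>)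
      then show ?thesis
        unfolding b_def isCont_def by (intro tendsto_intros) (use nz in auto)
    qed
    then have "isCont (h \<circ> b) z0"
      using cont by (intro continuous_at_compose) (auto simp: continuous_on_eq_continuous_at)
    then have 1: "continuous (at z0 within S) (h \<circ> b)" by (rule continuous_at_imp_continuous_at_within)
    have 2: "(h \<circ> b) z = (h \<circ> ar) z" if "z \<in> S" for z
    proof -
      have "E (b z) $ i = z $ i" for i
      proof -
        have "E (b z) $ i = cis (Arg (z0 $ i)) * cis (Arg (z $ i / z0 $ i))"
          by (simp add: E_def b_def ar_def ring_distribs cis_mult)
        also have "\<dots> = z $ i"
        proof -
          have "norm (z0 $ i) = 1" "norm (z $ i / z0 $ i) = 1"
            using that z0 by (auto simp: S_def norm_divide)
          then show ?thesis unfolding cis_Arg_norm1[OF \<open>norm (z0 $ i) = 1\<close>]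
            cis_Arg_norm1[OF \<open>norm (z $ i / z0 $ i) = 1\<close>] using nz by simp
        qed
        finally show ?thesis .
      qed
      then have "E (b z) = z" unfolding vec_eq_iff by blast
      then have "E (b z) = E (ar z)" using E_ar[OF that] by (rule trans[OF _ sym])
      then show ?thesis unfolding o_def by (rule h_E)
    qed
    show "continuous (at z0 within S) (h \<circ> ar)"
      by (rule continuous_transform_within[OF 1 zero_less_one z0]) (use 2 in auto)
  qed
  from Stone_Weierstrass_real_polynomial_function[OF \<open>compact S\<close> this \<open>e > 0\<close>]
  obtain g where g: "real_polynomial_function g" "\<And>z. z \<in> S \<Longrightarrow> \<bar>(h \<circ> ar) z - g z\<bar> < e" by blast
  have "\<bar>h y - g (E y)\<bar> < e" for y
    using g(2)[OF ES[of y]] unfolding o_def h_E[OF E_ar[OF ES]] .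
  then show thesis using that g(1) by (simp add: E_def)
qed

text \<open>
  The functions with vanishing Fourier coefficients. Multiplying by a trigonometric polynomial
  shifts and combines coefficients and stays inside this set, so trigonometric polynomials need no normal
  form.
\<close>

definition fourier_null :: "(real^'n \<Rightarrow> complex) \<Rightarrow> bool" where
  "fourier_null k \<longleftrightarrow> k \<in> borel_measurable borel \<and> (\<exists>B. \<forall>y\<in>unit_cell. norm (k y) \<le> B) \<and>
     (\<forall>w\<in>int_vectors. (LINT y:unit_cell|lborel. k y * char_fun w y) = 0)"

lemma fourier_null_integrable:
  assumes "fourier_null k"
  shows "set_integrable lborel unit_cell (\<lambda>y. k y * char_fun w y)"
proof -
  obtain B where "\<forall>y\<in>unit_cell. norm (k y) \<le> B" and [measurable]: "k \<in> borel_measurable borel"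
    using assms by (auto simp: fourier_null_def)
  then show ?thesis
    by (intro set_integrable_cell_bounded[where B = B]) (auto simp: norm_mult)
qed

lemma fourier_null_add:
  assumes "fourier_null k" "fourier_null l"
  shows "fourier_null (\<lambda>y. k y + l y)"
proof -
  obtain B B' where B: "\<forall>y\<in>unit_cell. norm (k y) \<le> B" "\<forall>y\<in>unit_cell. norm (l y) \<le> B'"
    and [measurable]: "k \<in> borel_measurable borel" "l \<in> borel_measurable borel"
    using assms by (auto simp: fourier_null_def)
  have "\<forall>y\<in>unit_cell. norm (k y + l y) \<le> B + B'" using B norm_triangle_mono by blast
  moreover have "(LINT y:unit_cell|lborel. (k y + l y) * char_fun w y) = 0" if "w \<in> int_vectors" for w
    using assms that
    by (simp add: fourier_null_def ring_distribs set_integral_add fourier_null_integrable)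
  ultimately show ?thesis unfolding fourier_null_def by auto
qed

lemma fourier_null_cmult:
  assumes "fourier_null k" shows "fourier_null (\<lambda>y. c * k y)"
proof -
  obtain B where B: "\<forall>y\<in>unit_cell. norm (k y) \<le> B"
    and [measurable]: "k \<in> borel_measurable borel"
    using assms by (auto simp: fourier_null_def)
  have "\<forall>y\<in>unit_cell. norm (c * k y) \<le> norm c * B" using B by (auto simp: norm_mult intro: mult_left_mono)
  moreover have "(LINT y:unit_cell|lborel. c * k y * char_fun w y) = 0" if "w \<in> int_vectors" for w
    using assms that by (simp add: fourier_null_def mult.assoc)
  ultimately show ?thesis unfolding fourier_null_def by auto
qed

lemma fourier_null_char:
  assumes "fourier_null k" "v \<in> int_vectors" shows "fourier_null (\<lambda>y. char_fun v y * k y)"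
proof -
  obtain B where B: "\<forall>y\<in>unit_cell. norm (k y) \<le> B"
    and [measurable]: "k \<in> borel_measurable borel"
    using assms by (auto simp: fourier_null_def)
  have "(LINT y:unit_cell|lborel. char_fun v y * k y * char_fun w y) = 0" if "w \<in> int_vectors" for w
  proof -
    have "(LINT y:unit_cell|lborel. k y * char_fun (v + w) y) = 0"
      using assms that int_vectors_add by (auto simp: fourier_null_def)
    then show ?thesis by (simp add: char_fun_add_left mult_ac)
  qed
  then show ?thesis using B unfolding fourier_null_def by (auto simp: norm_mult)
qed

lemma fourier_null_sum:
  assumes "finite I" "\<And>i. i \<in> I \<Longrightarrow> fourier_null (k i)"
  shows "fourier_null (\<lambda>y. \<Sum>i\<in>I. k i y)"
  using assms
proof (induction I rule: finite_induct)
  case empty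
  then show ?case by (auto simp: fourier_null_def intro: exI[of _ 0])
qed (auto intro: fourier_null_add)

lemma fourier_null_mult_trig:
  assumes g: "real_polynomial_function (g :: complex^'n \<Rightarrow> real)"
  shows "fourier_null k \<Longrightarrow> fourier_null (\<lambda>y. of_real (g (\<chi> i. cis (2 * pi * y $ i))) * k y)"
  using g
proof (induction g arbitrary: k)
  case (linear g)
  interpret g: bounded_linear g by fact
  have alg: "((c1 + c2) / 2 * a + (c1 - c2) / (2 * \<i>) * b) * d =
      a / 2 * (c1 * d) + a / 2 * (c2 * d) + (b / (2 * \<i>) * (c1 * d) + - b / (2 * \<i>) * (c2 * d))"
    for c1 c2 a b d :: complex
    unfolding divide_inverse by algebra
  have char_axis: "char_fun (axis i 1) y = cis (2 * pi * y $ i)"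
    "char_fun (- axis i 1) y = cis (- (2 * pi * y $ i))" for i and y :: "real^'n"
    by (simp_all add: char_fun_def inner_axis')
  have eq: "complex_of_real (g (\<chi> i. cis (2 * pi * y $ i))) * k y =
     (\<Sum>i\<in>UNIV. of_real (g (axis i 1)) / 2 * (char_fun (axis i 1) y * k y)
        + of_real (g (axis i 1)) / 2 * (char_fun (- axis i 1) y * k y)
        + (of_real (g (axis i \<i>)) / (2 * \<i>) * (char_fun (axis i 1) y * k y)
        + - of_real (g (axis i \<i>)) / (2 * \<i>) * (char_fun (- axis i 1) y * k y)))" (is "_ = ?R y") for y
  proof -
    have vec: "(\<chi> i. cis (2 * pi * y $ i)) = (\<Sum>i\<in>UNIV. cos (2 * pi * y $ i) *\<^sub>R axis i 1 + sin (2 * pi * y $ i) *\<^sub>R axis i \<i>)"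
    proof (rule vec_eq_iff[THEN iffD2], rule allI)
      fix j :: 'n
      have "(\<Sum>i\<in>UNIV. cos (2 * pi * y $ i) *\<^sub>R axis i 1 + sin (2 * pi * y $ i) *\<^sub>R axis i \<i>) $ j =
        (\<Sum>i\<in>UNIV. if i = j then cis (2 * pi * y $ i) else 0)"
        unfolding sum_component by (rule sum.cong) (auto simp: axis_def complex_eq_iff)
      then show "(\<chi> i. cis (2 * pi * y $ i)) $ j =
        (\<Sum>i\<in>UNIV. cos (2 * pi * y $ i) *\<^sub>R axis i 1 + sin (2 * pi * y $ i) *\<^sub>R axis i \<i>) $ j" by simp
    qed
    have geq: "g (\<chi> i. cis (2 * pi * y $ i)) = (\<Sum>i\<in>UNIV. cos (2 * pi * y $ i) * g (axis i 1) + sin (2 * pi * y $ i) * g (axis i \<i>))"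
      unfolding vec by (simp only: g.sum g.add g.scaleR real_scaleR_def)
    have cs: "complex_of_real (cos x) = (cis x + cis (- x)) / 2"
      "complex_of_real (sin x) = (cis x - cis (- x)) / (2 * \<i>)" for x
      by (simp_all add: complex_eq_iff Re_divide Im_divide power2_eq_square)
    have "complex_of_real (g (\<chi> i. cis (2 * pi * y $ i))) =
       (\<Sum>i\<in>UNIV. (cis (2 * pi * y $ i) + cis (- (2 * pi * y $ i))) / 2 * of_real (g (axis i 1))
          + (cis (2 * pi * y $ i) - cis (- (2 * pi * y $ i))) / (2 * \<i>) * of_real (g (axis i \<i>)))"
      unfolding geq of_real_sum of_real_add of_real_mult cs ..
    then have "complex_of_real (g (\<chi> i. cis (2 * pi * y $ i))) * k y =
       (\<Sum>i\<in>UNIV. ((cis (2 * pi * y $ i) + cis (- (2 * pi * y $ i))) / 2 * of_real (g (axis i 1))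
          + (cis (2 * pi * y $ i) - cis (- (2 * pi * y $ i))) / (2 * \<i>) * of_real (g (axis i \<i>))) * k y)"
      by (simp only: sum_distrib_right)
    also have "\<dots> = ?R y"
      unfolding char_axis by (rule sum.cong[OF refl]) (rule alg)
    finally show ?thesis .
  qed
  show ?case unfolding eq
    by (intro fourier_null_sum fourier_null_add fourier_null_cmult fourier_null_char linear int_vectors_uminus) auto
next
  case (const c)
  then show ?case by (intro fourier_null_cmult) auto
next
  case (add f g)
  show ?case
    using fourier_null_add[OF add.IH(1)[OF add.prems] add.IH(2)[OF add.prems]] by (simp add: ring_distribs)
next
  case (mult f g)
  show ?case
    using mult.IH(1)[OF mult.IH(2)[OF mult.prems]] by (simp add: mult.assoc)
qed

text \<open>
  If \<open>p\<close> is a trigonometric polynomial within \<open>e\<close> of \<open>h\<close>, then \<open>\<integral>h\<^sup>2 = \<integral>h(h - p) \<le> e sup|h|\<close>. Hence \<open>h\<close>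
  vanishes almost everywhere, and by continuity everywhere.
\<close>

theorem fourier_uniqueness:
  fixes h :: "real^'n \<Rightarrow> real"
  assumes cont: "continuous_on UNIV h"
    and per: "\<And>y n. n \<in> int_vectors \<Longrightarrow> h (y + n) = h y"
    and null: "\<And>w. w \<in> int_vectors \<Longrightarrow> (LINT y:unit_cell|lborel. of_real (h y) * char_fun w y) = 0"
  shows "h y = 0"
proof -
  have [measurable]: "h \<in> borel_measurable borel" using cont by (rule borel_measurable_continuous_onI)
  have "bounded (h ` cbox 0 1)"
    by (intro compact_imp_bounded compact_continuous_image continuous_on_subset[OF cont]) auto
  then obtain B where B: "\<And>y. y \<in> unit_cell \<Longrightarrow> \<bar>h y\<bar> \<le> B"
    using unit_cell_between(2) unfolding bounded_iff by (metis image_eqI real_norm_def subsetD)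
  have fn: "fourier_null (\<lambda>y. of_real (h y))"
    unfolding fourier_null_def using null B by auto
  have int2: "set_integrable lborel unit_cell (\<lambda>y. h y * h y)"
  proof (rule set_integrable_cell_bounded)
    show "norm (h y * h y) \<le> B * B" if "y \<in> unit_cell" for y
      using B[OF that] mult_mono[of "\<bar>h y\<bar>" B "\<bar>h y\<bar>" B] by (simp add: abs_mult)
  qed measurable
  have le: "(LINT y:unit_cell|lborel. h y * h y) \<le> e * B" if e0: "e > 0" for e
  proof -
    obtain g :: "complex^'n \<Rightarrow> real" where g: "real_polynomial_function g"
      "\<And>y. \<bar>h y - g (\<chi> i. cis (2 * pi * y $ i))\<bar> < e"
      by (rule periodic_trig_approx[OF cont _ e0]) (simp_all add: per)
    define p where "p = (\<lambda>y::real^'n. g (\<chi> i. cis (2 * pi * y $ i)))"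
    have fp: "fourier_null (\<lambda>y. of_real (p y) * of_real (h y))"
      unfolding p_def by (rule fourier_null_mult_trig[OF g(1) fn])
    then have "(LINT y:unit_cell|lborel. complex_of_real (p y * h y)) = 0"
      unfolding fourier_null_def by (auto simp: char_fun_def dest!: bspec[of int_vectors _ 0])
    then have p0: "(LINT y:unit_cell|lborel. p y * h y) = 0"
      by (simp only: set_integral_complex_of_real of_real_eq_0_iff)
    have intp: "set_integrable lborel unit_cell (\<lambda>y. p y * h y)"
    proof -
      have "complex_integrable lborel (\<lambda>y. complex_of_real (indicator unit_cell y *\<^sub>R (p y * h y)))"
        using fourier_null_integrable[OF fp, of 0]
        by (simp add: char_fun_def set_integrable_def scaleR_conv_of_real)
      then show ?thesis unfolding set_integrable_def complex_of_real_integrable_eq .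
    qed
    have "(LINT y:unit_cell|lborel. h y * h y) = (LINT y:unit_cell|lborel. h y * h y - p y * h y)"
      using int2 intp p0 by (simp add: set_integral_diff)
    also have "\<dots> \<le> (LINT y:(unit_cell :: (real^'n) set)|lborel. e * B)"
    proof (rule set_integral_mono)
      show "set_integrable lborel unit_cell (\<lambda>y. h y * h y - p y * h y)"
        using int2 intp by auto
      show "set_integrable lborel (unit_cell :: (real^'n) set) (\<lambda>_. e * B)"
        by (rule set_integrable_cell_bounded) auto
      fix y :: "real^'n" assume y: "y \<in> unit_cell"
      have "h y * h y - p y * h y \<le> \<bar>h y - p y\<bar> * \<bar>h y\<bar>" by (metis abs_ge_self abs_mult left_diff_distrib)
      also have "\<dots> \<le> e * B" using g(2)[of y] B[OF y] unfolding p_def by (intro mult_mono) auto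
      finally show "h y * h y - p y * h y \<le> e * B" .
    qed
    also have "\<dots> = e * B" by (simp add: set_lebesgue_integral_def measure_def emeasure_unit_cell)
    finally show ?thesis .
  qed
  have "(LINT y:unit_cell|lborel. h y * h y) \<le> 0"
  proof (rule field_le_epsilon)
    fix e :: real assume "e > 0"
    then show "(LINT y:unit_cell|lborel. h y * h y) \<le> 0 + e"
    proof -
      have "e / (\<bar>B\<bar> + 1) * B \<le> e / (\<bar>B\<bar> + 1) * (\<bar>B\<bar> + 1)"
        using \<open>e > 0\<close> by (intro mult_left_mono) auto
      also have "\<dots> = e" by (simp add: field_simps)
      finally show ?thesis using le[of "e / (\<bar>B\<bar> + 1)"] \<open>e > 0\<close> by simp
    qed
  qed
  moreover have "(LINT y:unit_cell|lborel. h y * h y) \<ge> 0"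
    by (auto simp: set_lebesgue_integral_def intro!: integral_nonneg_AE)
  ultimately have "(LINT y:unit_cell|lborel. h y * h y) = 0" by (rule order_antisym)
  then have "(LINT y|lborel. indicator unit_cell y *\<^sub>R (h y * h y)) = 0"
    by (simp add: set_lebesgue_integral_def)
  then have "AE y in lborel. indicator unit_cell y *\<^sub>R (h y * h y) = (0::real)"
    using int2 by (subst (asm) integral_nonneg_eq_0_iff_AE) (auto simp: set_integrable_def)
  then have ae: "AE y in lborel. y \<notin> unit_cell \<or> h y = 0" by eventually_elim (auto simp: indicator_def split: if_splits)
  define U where "U = {y \<in> box 0 1. h y \<noteq> 0}"
  have "open U"
  proof -
    have "U = box 0 1 \<inter> h -` (- {0})" by (auto simp: U_def)
    moreover have "open (- {0::real})" by (rule open_Compl) simp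
    ultimately show ?thesis
      using continuous_open_preimage[OF continuous_on_subset[OF cont subset_UNIV] open_box] by simp
  qed
  moreover have "negligible U"
  proof -
    have "{y. \<not> (y \<notin> unit_cell \<or> h y = 0)} \<in> null_sets lborel" using ae by (subst (asm) AE_iff_null) auto
    then have "U \<in> null_sets lborel"
      by (rule null_sets_subset) (use \<open>open U\<close> unit_cell_between(1) in \<open>auto simp: U_def\<close>)
    then show ?thesis by (auto simp: negligible_iff_null_sets intro: null_sets_completionI)
  qed
  ultimately have "U = {}" using open_not_negligible by blast
  then have z: "h y = 0" if "y \<in> box 0 1" for y using that by (auto simp: U_def)
  have "h y = 0" if "y \<in> closure (box 0 1)" for y
    by (rule continuous_constant_on_closure[OF continuous_on_subset[OF cont] z that]) auto
  moreover have ne: "box 0 (1::real^'n) \<noteq> {}" by (auto simp: box_ne_empty Basis_vec_def inner_axis)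
  ultimately have zc: "h y = 0" if "y \<in> cbox 0 1" for y using that by (simp add: closure_box)
  obtain k where "y - int_enum k \<in> unit_cell"
    using unit_cell_translates by (metis (mono_tags, lifting) UNIV_I UN_E mem_Collect_eq)
  then have "h (y - int_enum k) = 0" using zc unit_cell_between(2) by blast
  then show ?thesis using per[of "int_enum k" "y - int_enum k"] by simp
qed

section \<open>Poisson summation\<close>

lemma summable_enum_iff:
  fixes f :: "real^'n \<Rightarrow> real"
  assumes "\<And>n. f n \<ge> 0"
  shows "summable (\<lambda>k. f (int_enum k)) \<longleftrightarrow> f summable_on int_vectors"
  using summable_on_reindex_bij_betw[OF bij_int_enum, of f]
    summable_on_UNIV_nonneg_real_iff[of "\<lambda>k. f (int_enum k)"] assms by simp

lemma summable_enum_gaussian: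
  "c > 0 \<Longrightarrow> summable (\<lambda>k. exp (- c * (norm (int_enum k :: real^'n))\<^sup>2))"
  using summable_on_gaussian[of c, where 'n = 'n]
  by (subst summable_enum_iff[where f = "\<lambda>n. exp (- c * (norm n)\<^sup>2)"]) auto

lemma suminf_enum:
  fixes f :: "real^'n \<Rightarrow> real"
  assumes "f summable_on int_vectors"
  shows "(\<Sum>k. f (int_enum k)) = infsum f int_vectors"
proof -
  have "((\<lambda>k. f (int_enum k)) has_sum infsum f int_vectors) UNIV"
    using has_sum_reindex_bij_betw[OF bij_int_enum, of f] has_sum_infsum[OF assms] by simp
  then show ?thesis by (metis has_sum_imp_sums sums_unique)
qed

text \<open>
  By the parallelogram law, translating a Gaussian by a bounded amount costs only a constant and
  half the exponent, which gives summable majorants that are uniform on bounded sets.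
\<close>

lemma gaussian_shift_le:
  fixes y n :: "'a::real_inner"
  assumes "c \<ge> 0"
  shows "exp (- c * (norm (y + n))\<^sup>2) \<le> exp (c * (norm y)\<^sup>2) * exp (- (c / 2) * (norm n)\<^sup>2)"
proof -
  have "(norm n)\<^sup>2 + (norm (n + 2 *\<^sub>R y))\<^sup>2 = 2 * (norm (y + n))\<^sup>2 + 2 * (norm y)\<^sup>2"
    unfolding power2_norm_eq_inner by (simp add: inner_simps inner_commute algebra_simps)
  then have "(norm n)\<^sup>2 \<le> 2 * (norm (y + n))\<^sup>2 + 2 * (norm y)\<^sup>2"
    by (metis le_add_same_cancel1 zero_le_power2)
  then have "c / 2 * (norm n)\<^sup>2 \<le> c / 2 * (2 * (norm (y + n))\<^sup>2 + 2 * (norm y)\<^sup>2)"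
    using assms by (intro mult_left_mono) auto
  then show ?thesis by (simp add: mult_exp_exp algebra_simps)
qed

lemma norm_unit_cell: "y \<in> unit_cell \<Longrightarrow> (norm y)\<^sup>2 \<le> real CARD('n)" for y :: "real^'n"
proof -
  assume y: "y \<in> unit_cell"
  have "(norm y)\<^sup>2 = (\<Sum>i\<in>UNIV. (y $ i)\<^sup>2)"
    by (simp add: norm_vec_def L2_set_def sum_nonneg)
  also have "\<dots> \<le> (\<Sum>i\<in>(UNIV::'n set). 1)"
    using y by (intro sum_mono) (auto simp: unit_cell_def abs_square_le_1 less_imp_le)
  finally show ?thesis by simp
qed

lemma continuous_on_locally_uniform_suminf:
  fixes f :: "nat \<Rightarrow> 'a::real_normed_vector \<Rightarrow> 'b::banach"
  assumes cont: "\<And>k. continuous_on UNIV (f k)"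
    and bd: "\<And>R. \<exists>M. summable M \<and> (\<forall>k y. norm y \<le> R \<longrightarrow> norm (f k y) \<le> M k)"
  shows "continuous_on UNIV (\<lambda>y. \<Sum>k. f k y)"
proof -
  have "continuous_on (ball 0 R) (\<lambda>y. \<Sum>k. f k y)" for R
  proof -
    obtain M where M: "summable M" "\<And>k y. norm y \<le> R \<Longrightarrow> norm (f k y) \<le> M k" using bd by blast
    have "uniform_limit (ball 0 R) (\<lambda>n y. \<Sum>i<n. f i y) (\<lambda>y. \<Sum>k. f k y) sequentially"
      by (rule Weierstrass_m_test[OF _ M(1)]) (use M(2) in \<open>auto simp: less_imp_le\<close>)
    moreover have "\<forall>\<^sub>F n in sequentially. continuous_on (ball 0 R) (\<lambda>y. \<Sum>i<n. f i y)"
      by (intro always_eventually allI continuous_on_sum continuous_on_subset[OF cont]) auto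
    ultimately show ?thesis by (intro uniform_limit_theorem) auto
  qed
  then have "isCont (\<lambda>y. \<Sum>k. f k y) y" for y
    by (rule continuous_on_interior[of "ball 0 (norm y + 1)"]) auto
  then show ?thesis by (simp add: continuous_on_eq_continuous_at)
qed

lemma cell_integral_suminf:
  fixes f :: "nat \<Rightarrow> real^'n \<Rightarrow> complex"
  assumes [measurable]: "\<And>k. f k \<in> borel_measurable borel"
    and M: "summable M" and bd: "\<And>k y. y \<in> unit_cell \<Longrightarrow> norm (f k y) \<le> M k"
  shows "(LINT y:unit_cell|lborel. (\<Sum>k. f k y)) = (\<Sum>k. LINT y:unit_cell|lborel. f k y)"
proof -
  let ?g = "\<lambda>k y. indicator unit_cell y *\<^sub>R f k y"
  have 0: "0 \<in> (unit_cell :: (real^'n) set)" by (simp add: unit_cell_def)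
  have M0: "0 \<le> M k" for k using bd[OF 0, of k] norm_ge_zero order_trans by blast
  have gM: "norm (?g k y) \<le> M k" for k y using bd[of y k] M0[of k] by (simp add: indicator_def)
  have int: "integrable lborel (?g k)" for k
    using set_integrable_cell_bounded[OF assms(1) bd] by (simp add: set_integrable_def)
  have sm: "summable (\<lambda>k. \<integral>y. norm (?g k y) \<partial>lborel)"
  proof (rule summable_comparison_test'[OF M])
    fix k
    have "(\<integral>y. norm (?g k y) \<partial>lborel) \<le> (\<integral>y. M k * indicator (unit_cell :: (real^'n) set) y \<partial>lborel)"
    proof (rule integral_mono)
      show "integrable lborel (\<lambda>y. M k * indicator (unit_cell :: (real^'n) set) y)"
        by (intro integrable_mult_right integrable_real_indicator) (auto simp: emeasure_unit_cell)
      show "integrable lborel (\<lambda>y. norm (?g k y))" by (rule integrable_norm[OF int])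
    qed (use bd in \<open>auto simp: indicator_def\<close>)
    also have "\<dots> = M k" by (simp add: measure_def emeasure_unit_cell)
    finally show "norm (\<integral>y. norm (?g k y) \<partial>lborel) \<le> M k" by simp
  qed
  have "(LINT y:unit_cell|lborel. (\<Sum>k. f k y)) = (\<integral>y. (\<Sum>k. ?g k y) \<partial>lborel)"
    unfolding set_lebesgue_integral_def
    by (intro Bochner_Integration.integral_cong) (auto simp: indicator_def)
  also have "\<dots> = (\<Sum>k. \<integral>y. ?g k y \<partial>lborel)"
  proof (rule integral_suminf[OF int _ sm], rule AE_I2, rule summable_comparison_test'[OF M, of 0])
    show "norm (norm (?g k y)) \<le> M k" for k y unfolding real_norm_def abs_norm_cancel by (rule gM)
  qed
  finally show ?thesis by (simp add: set_lebesgue_integral_def)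
qed

lemma integrable_gaussian_bound:
  fixes \<phi> :: "real^'n \<Rightarrow> 'b::{banach,second_countable_topology}"
  assumes [measurable]: "\<phi> \<in> borel_measurable borel" and "c > 0"
    and bd: "\<And>y. norm (\<phi> y) \<le> K * exp (- c * (norm y)\<^sup>2)"
  shows "integrable lborel \<phi>"
proof (rule integrableI_bounded)
  have K: "K \<ge> 0" using bd[of 0] by simp (meson norm_ge_zero order_trans)
  define M where "M = (\<lambda>k. K * (exp (c * CARD('n)) * exp (- (c / 2) * (norm (int_enum k :: real^'n))\<^sup>2)))"
  have M0: "M k \<ge> 0" for k using K by (simp add: M_def)
  have sM: "summable M" unfolding M_def using \<open>c > 0\<close>
    by (intro summable_mult summable_enum_gaussian) simp
  have le: "norm (\<phi> (y + int_enum k)) \<le> M k" if "y \<in> unit_cell" for y k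
  proof -
    have "norm (\<phi> (y + int_enum k)) \<le> K * exp (- c * (norm (y + int_enum k))\<^sup>2)" by (rule bd)
    also have "\<dots> \<le> K * (exp (c * (norm y)\<^sup>2) * exp (- (c / 2) * (norm (int_enum k :: real^'n))\<^sup>2))"
      using K \<open>c > 0\<close> by (intro mult_left_mono gaussian_shift_le) auto
    also have "\<dots> \<le> M k" unfolding M_def
      using K \<open>c > 0\<close> norm_unit_cell[OF that] by (intro mult_left_mono mult_right_mono) auto
    finally show ?thesis .
  qed
  have "(\<integral>\<^sup>+ y. ennreal (norm (\<phi> y)) \<partial>lborel) = (\<Sum>k. \<integral>\<^sup>+y\<in>unit_cell. ennreal (norm (\<phi> (y + int_enum k))) \<partial>lborel)"
    by (rule lborel_nn_integral_unfold) measurable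
  also have "\<dots> \<le> (\<Sum>k. ennreal (M k))"
  proof (rule suminf_le)
    fix k
    have "(\<integral>\<^sup>+y\<in>unit_cell. ennreal (norm (\<phi> (y + int_enum k))) \<partial>lborel) \<le> (\<integral>\<^sup>+y. ennreal (M k) * indicator (unit_cell :: (real^'n) set) y \<partial>lborel)"
      by (rule nn_integral_mono) (use le M0 in \<open>auto simp: indicator_def intro!: ennreal_leI\<close>)
    also have "\<dots> = ennreal (M k)" by (simp add: nn_integral_cmult_indicator emeasure_unit_cell)
    finally show "(\<integral>\<^sup>+y\<in>unit_cell. ennreal (norm (\<phi> (y + int_enum k))) \<partial>lborel) \<le> ennreal (M k)" .
  qed auto
  also have "\<dots> < \<infinity>" using sM M0 by (simp add: suminf_ennreal_eq[OF _ summable_sums] less_top)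
  finally show "(\<integral>\<^sup>+ y. ennreal (norm (\<phi> y)) \<partial>lborel) < \<infinity>" .
qed measurable

text \<open>
  The periodisation of \<open>\<phi>\<close> and the cosine series with coefficients \<open>a\<close> are continuous
  and periodic with the same Fourier coefficients, hence equal; the claim is their value at 0.
\<close>

theorem poisson_summation:
  fixes \<phi> a :: "real^'n \<Rightarrow> real"
  assumes cont: "continuous_on UNIV \<phi>" and c: "c > 0" "c' > 0"
    and bd: "\<And>y. \<bar>\<phi> y\<bar> \<le> K * exp (- c * (norm y)\<^sup>2)"
    and bda: "\<And>w. \<bar>a w\<bar> \<le> K' * exp (- c' * (norm w)\<^sup>2)"
    and even: "\<And>w. a (- w) = a w"
    and transform: "\<And>w. w \<in> int_vectors \<Longrightarrow> (LINT y|lborel. of_real (\<phi> y) * char_fun w y) = of_real (a w)"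
  shows "(\<Sum>k. \<phi> (int_enum k)) = (\<Sum>k. a (int_enum k))"
proof -
  define F where "F = (\<lambda>y. \<Sum>k. \<phi> (y + int_enum k))"
  define G where "G = (\<lambda>y::real^'n. \<Sum>k. a (int_enum k) * cos (2 * pi * (int_enum k \<bullet> y)))"
  have [measurable]: "\<phi> \<in> borel_measurable borel" by (rule borel_measurable_continuous_onI[OF cont])
  have K: "K \<ge> 0" "K' \<ge> 0" using bd[of 0] bda[of 0] by auto
  define M where "M = (\<lambda>R k. K * (exp (c * R) * exp (- (c / 2) * (norm (int_enum k :: real^'n))\<^sup>2)))"
  have sM: "summable (M R)" for R unfolding M_def using c
    by (intro summable_mult summable_enum_gaussian) simp
  have le: "\<bar>\<phi> (y + int_enum k)\<bar> \<le> M R k" if "(norm y)\<^sup>2 \<le> R" for R y k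
  proof -
    have "\<bar>\<phi> (y + int_enum k)\<bar> \<le> K * exp (- c * (norm (y + int_enum k))\<^sup>2)" by (rule bd)
    also have "\<dots> \<le> K * (exp (c * (norm y)\<^sup>2) * exp (- (c / 2) * (norm (int_enum k :: real^'n))\<^sup>2))"
      using K c by (intro mult_left_mono gaussian_shift_le) auto
    also have "\<dots> \<le> M R k" unfolding M_def
      using K c that by (intro mult_left_mono mult_right_mono) auto
    finally show ?thesis .
  qed
  define N where "N = (\<lambda>k. K' * exp (- c' * (norm (int_enum k :: real^'n))\<^sup>2))"
  have sN: "summable N" unfolding N_def using c by (intro summable_mult summable_enum_gaussian)
  have leN: "\<bar>a (int_enum k) * cos x\<bar> \<le> N k" for k x
  proof -
    have "\<bar>a (int_enum k) * cos x\<bar> \<le> \<bar>a (int_enum k)\<bar> * 1"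
      unfolding abs_mult by (intro mult_left_mono) auto
    then show ?thesis using bda[of "int_enum k"] by (simp add: N_def)
  qed
  have sF: "summable (\<lambda>k. \<phi> (y + int_enum k))" for y
    using summable_comparison_test'[OF sM, of 0 "\<lambda>k. \<phi> (y + int_enum k)" "(norm y)\<^sup>2"] le by auto
  have sG: "summable (\<lambda>k. a (int_enum k) * cos (2 * pi * (int_enum k \<bullet> y)))" for y
    by (rule summable_comparison_test'[OF sN, of 0]) (use leN in auto)
  have contF: "continuous_on UNIV F" unfolding F_def
  proof (rule continuous_on_locally_uniform_suminf)
    show "continuous_on UNIV (\<lambda>y. \<phi> (y + int_enum k))" for k
      by (intro continuous_on_compose2[OF cont] continuous_intros) auto
    show "\<exists>M. summable M \<and> (\<forall>k y. norm y \<le> R \<longrightarrow> norm (\<phi> (y + int_enum k)) \<le> M k)" for R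
      using sM[of "R\<^sup>2"] le[of _ "R\<^sup>2"] by (metis norm_ge_zero power_mono real_norm_def)
  qed
  have contG: "continuous_on UNIV G" unfolding G_def
    by (rule continuous_on_locally_uniform_suminf) (use sN leN in \<open>auto intro!: continuous_intros\<close>)
  have perF: "F (y + n) = F y" if n: "n \<in> int_vectors" for y n
  proof -
    have eq: "F z = infsum (\<lambda>m. \<phi> (z + m)) int_vectors" for z
    proof -
      have "(\<lambda>k. \<phi> (z + int_enum k)) summable_on UNIV"
        using summable_comparison_test'[OF sM, of 0 "\<lambda>k. norm (\<phi> (z + int_enum k))" "(norm z)\<^sup>2"] le
        by (intro norm_summable_imp_summable_on) auto
      then have "(\<lambda>m. \<phi> (z + m)) summable_on int_vectors"
        using summable_on_reindex_bij_betw[OF bij_int_enum, of "\<lambda>m. \<phi> (z + m)"] by blast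
      then show ?thesis unfolding F_def by (rule suminf_enum)
    qed
    have "bij_betw (\<lambda>m. n + m) int_vectors int_vectors"
      by (rule bij_betw_byWitness[where f' = "\<lambda>m. m - n"]) (use n in auto)
    then show ?thesis
      unfolding eq using infsum_reindex_bij_betw[of "\<lambda>m. n + m" int_vectors int_vectors "\<lambda>m. \<phi> (y + m)"]
      by (simp add: add.assoc)
  qed
  have perG: "G (y + n) = G y" if n: "n \<in> int_vectors" for y n
  proof -
    have "cos (2 * pi * (int_enum k \<bullet> (y + n))) = cos (2 * pi * (int_enum k \<bullet> y))" for k
      using char_fun_periodic[OF int_enum_in n, of k y] by (simp add: char_fun_def complex_eq_iff)
    then show ?thesis by (simp add: G_def)
  qed
  have coefF: "(LINT y:unit_cell|lborel. of_real (F y) * char_fun w y) = of_real (a w)"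
    if w: "w \<in> int_vectors" for w
  proof -
    have "(LINT y:unit_cell|lborel. of_real (F y) * char_fun w y) =
       (LINT y:unit_cell|lborel. (\<Sum>k. of_real (\<phi> (y + int_enum k)) * char_fun w y))"
      by (simp add: F_def suminf_of_real sF suminf_mult2 summable_of_real)
    also have "\<dots> = (\<Sum>k. LINT y:unit_cell|lborel. of_real (\<phi> (y + int_enum k)) * char_fun w y)"
    proof (rule cell_integral_suminf[OF _ sM[of "real CARD('n)"]])
      show "norm (of_real (\<phi> (y + int_enum k)) * char_fun w y) \<le> M (real CARD('n)) k" if "y \<in> unit_cell" for k y
        using le[OF norm_unit_cell[OF that], of k] by (simp add: norm_mult)
    qed measurable
    also have "\<dots> = (\<Sum>k. LINT y:unit_cell|lborel. of_real (\<phi> (y + int_enum k)) * char_fun w (y + int_enum k))"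
      by (simp add: char_fun_periodic w)
    also have "\<dots> = (LINT y|lborel. of_real (\<phi> y) * char_fun w y)"
    proof (rule lborel_integral_unfold[symmetric])
      show "integrable lborel (\<lambda>y. complex_of_real (\<phi> y) * char_fun w y)"
        by (rule integrable_gaussian_bound[OF _ c(1)]) (use bd in \<open>auto simp: norm_mult\<close>)
    qed
    finally show ?thesis using transform[OF w] by simp
  qed
  have coefG: "(LINT y:unit_cell|lborel. of_real (G y) * char_fun w y) = of_real (a w)"
    if w: "w \<in> int_vectors" for w
  proof -
    obtain i where i: "w = int_enum i" using int_enum_surj[OF w] ..
    obtain j where j: "- w = int_enum j" using int_enum_surj[OF int_vectors_uminus[OF w]] ..
    note ij = i j
    have "(LINT y:unit_cell|lborel. of_real (G y) * char_fun w y) =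
       (LINT y:unit_cell|lborel. (\<Sum>k. of_real (a (int_enum k) * cos (2 * pi * (int_enum k \<bullet> y))) * char_fun w y))"
      by (simp only: G_def suminf_of_real[OF sG] suminf_mult2[OF summable_of_real[OF sG]])
    also have "\<dots> = (\<Sum>k. LINT y:unit_cell|lborel. of_real (a (int_enum k) * cos (2 * pi * (int_enum k \<bullet> y))) * char_fun w y)"
    proof (rule cell_integral_suminf[OF _ sN])
      show "norm (of_real (a (int_enum k) * cos (2 * pi * (int_enum k \<bullet> y))) * char_fun w y) \<le> N k" for k y
        using leN[of k] by (simp only: norm_mult norm_char_fun norm_of_real mult_1_right)
    qed measurable
    also have "\<dots> = (\<Sum>k. (if k = j then of_real (a (int_enum k)) / 2 else 0) + (if k = i then of_real (a (int_enum k)) / 2 else 0))"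
    proof (rule suminf_cong)
      fix k :: nat
      let ?v = "int_enum k :: real^'n"
      have in_int: "?v + w \<in> int_vectors" "- ?v + w \<in> int_vectors"
        using w by (auto intro!: int_vectors_add int_vectors_uminus)
      have "of_real (a ?v * cos (2 * pi * (?v \<bullet> y))) * char_fun w y =
        of_real (a ?v) / 2 * char_fun (?v + w) y + of_real (a ?v) / 2 * char_fun (- ?v + w) y" for y
      proof -
        have cs: "complex_of_real (cos (2 * pi * (?v \<bullet> y))) = (char_fun ?v y + char_fun (- ?v) y) / 2"
          by (simp add: complex_eq_iff char_fun_def)
        show ?thesis
          unfolding char_fun_add_left of_real_mult cs divide_inverse by algebra
      qed
      then have "(LINT y:unit_cell|lborel. of_real (a ?v * cos (2 * pi * (?v \<bullet> y))) * char_fun w y) =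
        of_real (a ?v) / 2 * (LINT y:unit_cell|lborel. char_fun (?v + w) y)
        + of_real (a ?v) / 2 * (LINT y:unit_cell|lborel. char_fun (- ?v + w) y)"
        by (simp only:) (subst set_integral_add; auto intro!: set_integrable_cell_bounded[where B = 1] set_integrable_mult_right)
      also have "\<dots> = of_real (a ?v) / 2 * (if ?v + w = 0 then 1 else 0) + of_real (a ?v) / 2 * (if - ?v + w = 0 then 1 else 0)"
        by (simp only: integral_char_fun[OF in_int(1)] integral_char_fun[OF in_int(2)])
      also have "(?v + w = 0) = (k = j)" by (metis ij(2) int_enum_inj eq_neg_iff_add_eq_0)
      also have "(- ?v + w = 0) = (k = i)" by (metis ij(1) int_enum_inj add.commute eq_iff_diff_eq_0 add_uminus_conv_diff)
      finally show "(LINT y:unit_cell|lborel. of_real (a ?v * cos (2 * pi * (?v \<bullet> y))) * char_fun w y) =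
        (if k = j then of_real (a ?v) / 2 else 0) + (if k = i then of_real (a ?v) / 2 else 0)" by auto
    qed
    also have "\<dots> = of_real (a (int_enum j)) / 2 + of_real (a (int_enum i)) / 2"
      by (intro sums_unique[symmetric] sums_add sums_single)
    also have "\<dots> = of_real (a w)" using even[of w] by (simp flip: ij)
    finally show ?thesis .
  qed
  have [measurable]: "F \<in> borel_measurable borel" "G \<in> borel_measurable borel"
    using contF contG by (auto intro: borel_measurable_continuous_onI)
  have bounded_cell: "set_integrable lborel unit_cell (\<lambda>y. complex_of_real (H y) * char_fun w y)"
    if H: "continuous_on UNIV H" for H :: "real^'n \<Rightarrow> real" and w
  proof -
    have "bounded (H ` cbox 0 1)"
      by (intro compact_imp_bounded compact_continuous_image continuous_on_subset[OF H]) auto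
    then obtain B where B: "\<And>y. y \<in> unit_cell \<Longrightarrow> \<bar>H y\<bar> \<le> B"
      using unit_cell_between(2) unfolding bounded_iff by (metis image_eqI real_norm_def subsetD)
    have [measurable]: "H \<in> borel_measurable borel" by (rule borel_measurable_continuous_onI[OF H])
    show ?thesis by (rule set_integrable_cell_bounded[where B = B]) (use B in \<open>auto simp: norm_mult\<close>)
  qed
  have "F 0 - G 0 = 0"
  proof (rule fourier_uniqueness[where h = "\<lambda>y. F y - G y"])
    show "continuous_on UNIV (\<lambda>y. F y - G y)" by (intro continuous_intros contF contG)
    show "F (y + n) - G (y + n) = F y - G y" if "n \<in> int_vectors" for y n
      using that perF perG by simp
    show "(LINT y:unit_cell|lborel. of_real (F y - G y) * char_fun w y) = 0" if "w \<in> int_vectors" for w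
      using coefF[OF that] coefG[OF that]
      by (simp add: left_diff_distrib set_integral_diff bounded_cell contF contG)
  qed
  then show ?thesis by (simp add: F_def G_def)
qed

section \<open>The inversion formula for theta functions of lattices\<close>

text \<open>
  Expanding the exponential and integrating term by term, with the two integrable functions
  \<open>\<phi> e\<^bsup>\<plusminus>|s|l\<^esup>\<close> as majorants, represents the transform by an everywhere convergent power series.
\<close>

lemma holomorphic_laplace_transform:
  fixes \<phi> l :: "'a \<Rightarrow> real"
  assumes [measurable]: "\<phi> \<in> borel_measurable M" "l \<in> borel_measurable M"
    and nonneg: "\<And>y. \<phi> y \<ge> 0"
    and int: "\<And>s. integrable M (\<lambda>y. \<phi> y * exp (s * l y))"
  shows "(\<lambda>s. LINT y|M. of_real (\<phi> y) * exp (s * of_real (l y))) holomorphic_on (UNIV :: complex set)"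
proof -
  define m where "m = (\<lambda>k. (LINT y|M. complex_of_real (\<phi> y * l y ^ k / fact k)))"
  have sums: "(\<lambda>k. m k * s ^ k) sums (LINT y|M. of_real (\<phi> y) * exp (s * of_real (l y)))" for s :: complex
  proof -
    let ?f = "\<lambda>k y. complex_of_real (\<phi> y * l y ^ k / fact k) * s ^ k"
    let ?D = "\<lambda>y. \<phi> y * exp (norm s * l y) + \<phi> y * exp (- norm s * l y)"
    have exp_sums: "(\<lambda>k. norm (?f k y)) sums (\<phi> y * exp (norm s * \<bar>l y\<bar>))" for y
    proof -
      have "norm (?f k y) = \<phi> y * ((norm s * \<bar>l y\<bar>) ^ k /\<^sub>R fact k)" for k
      proof -
        have "\<bar>\<phi> y * l y ^ k / fact k\<bar> = \<phi> y * \<bar>l y\<bar> ^ k / fact k"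
          using nonneg[of y] by (simp add: abs_mult power_abs)
        then show ?thesis
          unfolding norm_mult norm_of_real norm_power by (simp add: power_mult_distrib divide_inverse mult_ac)
      qed
      moreover have "(\<lambda>k. \<phi> y * ((norm s * \<bar>l y\<bar>) ^ k /\<^sub>R fact k)) sums (\<phi> y * exp (norm s * \<bar>l y\<bar>))"
        by (intro sums_mult exp_converges)
      ultimately show ?thesis by (simp only:)
    qed
    have D: "\<phi> y * exp (norm s * \<bar>l y\<bar>) \<le> ?D y" for y
      using nonneg[of y] by (cases "l y \<ge> 0") (auto simp: abs_if)
    have intD: "integrable M ?D" using int[of "norm s"] int[of "- norm s"] by (intro Bochner_Integration.integrable_add)
    have intf: "integrable M (?f k)" for k
    proof (rule Bochner_Integration.integrable_bound[OF intD])
      show "AE y in M. norm (?f k y) \<le> norm (?D y)"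
      proof (rule AE_I2)
        fix y
        have "norm (?f k y) \<le> \<phi> y * exp (norm s * \<bar>l y\<bar>)"
          using sum_le_suminf[OF sums_summable[OF exp_sums], of "{k}"] sums_unique[OF exp_sums] by simp
        also have "\<dots> \<le> ?D y" by (rule D)
        also have "\<dots> \<le> norm (?D y)" by simp
        finally show "norm (?f k y) \<le> norm (?D y)" .
      qed
    qed measurable
    have sumint: "summable (\<lambda>k. LINT y|M. norm (?f k y))"
    proof (rule summableI_nonneg_bounded)
      fix n
      have "(\<Sum>k<n. LINT y|M. norm (?f k y)) = (LINT y|M. (\<Sum>k<n. norm (?f k y)))"
        using intf by (intro Bochner_Integration.integral_sum[symmetric]) (rule integrable_norm)
      also have "\<dots> \<le> (LINT y|M. ?D y)"
      proof (rule integral_mono)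
        show "integrable M (\<lambda>y. \<Sum>k<n. norm (?f k y))"
          using intf by (intro Bochner_Integration.integrable_sum) (rule integrable_norm)
        show "(\<Sum>k<n. norm (?f k y)) \<le> ?D y" for y
          using sum_le_suminf[OF sums_summable[OF exp_sums[of y]], of "{..<n}"] sums_unique[OF exp_sums[of y]] D[of y]
          by simp
      qed (rule intD)
      finally show "(\<Sum>k<n. LINT y|M. norm (?f k y)) \<le> (LINT y|M. ?D y)" .
    qed simp
    have eq: "(\<Sum>k. ?f k y) = of_real (\<phi> y) * exp (s * of_real (l y))" for y
    proof -
      have "(\<lambda>k. of_real (\<phi> y) * ((s * of_real (l y)) ^ k /\<^sub>R fact k)) sums (of_real (\<phi> y) * exp (s * of_real (l y)))"
        by (intro sums_mult exp_converges)
      also have "(\<lambda>k. of_real (\<phi> y) * ((s * of_real (l y)) ^ k /\<^sub>R fact k)) = (\<lambda>k. ?f k y)"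
        by (simp add: power_mult_distrib scaleR_conv_of_real divide_inverse mult_ac)
      finally show ?thesis by (rule sums_unique[symmetric])
    qed
    have "(\<lambda>k. LINT y|M. ?f k y) sums (LINT y|M. (\<Sum>k. ?f k y))"
      by (rule sums_integral[OF intf _ sumint]) (use exp_sums in \<open>auto simp: sums_iff\<close>)
    then show ?thesis unfolding eq m_def by simp
  qed
  have "(\<lambda>s. LINT y|M. of_real (\<phi> y) * exp (s * of_real (l y))) holomorphic_on ball (0::complex) R" for R
    by (rule power_series_holomorphic[where a = m]) (use sums in simp)
  then have "(\<lambda>s. LINT y|M. of_real (\<phi> y) * exp (s * of_real (l y))) holomorphic_on (\<Union>R. ball (0::complex) R)"
    by (intro holomorphic_on_UN_open) auto
  moreover have "(\<Union>R. ball (0::complex) R) = UNIV"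
    by (auto intro: gt_ex)
  ultimately show ?thesis by simp
qed

lemma entire_eq_of_real_eq:
  fixes f g :: "complex \<Rightarrow> complex"
  assumes "f holomorphic_on UNIV" "g holomorphic_on UNIV" "\<And>x. f (of_real x) = g (of_real x)"
  shows "f z = g z"
proof -
  have lim: "0 islimpt range complex_of_real"
    unfolding islimpt_approachable
  proof safe
    fix e :: real assume "e > 0"
    then have "complex_of_real (e / 2) \<noteq> 0 \<and> dist (complex_of_real (e / 2)) 0 < e"
      by (simp add: norm_divide)
    then show "\<exists>x'\<in>range complex_of_real. x' \<noteq> 0 \<and> dist x' 0 < e" by blast
  qed
  have "f z - g z = 0"
  proof (rule analytic_continuation[of "\<lambda>z. f z - g z" UNIV "range complex_of_real" 0])
    show "(\<lambda>z. f z - g z) holomorphic_on UNIV" by (intro holomorphic_on_diff assms)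
    show "f z - g z = 0" if "z \<in> range complex_of_real" for z using that assms(3) by auto
  qed (use lim connected_UNIV in simp_all)
  then show ?thesis by simp
qed

text \<open>
  The value is \<open>t\<^bsup>-n/2\<^esup> / |det A|\<close>, but only the dependence on \<open>t\<close> is established directly; for a self-dual lattice
  the remaining constant follows from the inversion formula itself at \<open>t = 1\<close>.
\<close>

definition gaussian_mass :: "real^'n^'n \<Rightarrow> real \<Rightarrow> real" where
  "gaussian_mass A t = (LINT y|lborel. exp (- pi * t * (norm (A *v y))\<^sup>2))"

lemma
  fixes A :: "real^'n^'n"
  assumes "invertible A"
  shows matrix_inv_right: "A ** matrix_inv A = mat 1" and matrix_inv_left: "matrix_inv A ** A = mat 1"
proof -
  have "A ** matrix_inv A = mat 1 \<and> matrix_inv A ** A = mat 1"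
    unfolding matrix_inv_def by (rule someI_ex) (use assms in \<open>simp add: invertible_def\<close>)
  then show "A ** matrix_inv A = mat 1" "matrix_inv A ** A = mat 1" by auto
qed

lemma invertible_bounded_below:
  fixes A :: "real^'n^'n"
  assumes "invertible A"
  obtains k where "k > 0" "\<And>y. k * norm y \<le> norm (A *v y)"
proof -
  have "inj ((*v) A)" by (rule inj_matrix_vector_mult[OF assms])
  then obtain k where "k > 0" "\<And>y. k * norm y \<le> norm (A *v y)"
    using linear_inj_bounded_below_pos[OF matrix_vector_mul_linear] by metis
  then show thesis by (rule that)
qed

lemma gaussian_bound:
  fixes A :: "real^'n^'n"
  assumes "invertible A" "t > 0"
  obtains c where "c > 0" "\<And>y. exp (- pi * t * (norm (A *v y))\<^sup>2) \<le> exp (- c * (norm y)\<^sup>2)"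
proof -
  obtain k where k: "k > 0" "\<And>y. k * norm y \<le> norm (A *v y)" using invertible_bounded_below[OF assms(1)] by blast
  have "exp (- pi * t * (norm (A *v y))\<^sup>2) \<le> exp (- (pi * t * k\<^sup>2) * (norm y)\<^sup>2)" for y
  proof -
    have "(k * norm y)\<^sup>2 \<le> (norm (A *v y))\<^sup>2" using k by (intro power_mono) auto
    then have "pi * t * (k * norm y)\<^sup>2 \<le> pi * t * (norm (A *v y))\<^sup>2"
      using assms(2) by (intro mult_left_mono) auto
    then show ?thesis by (simp add: power_mult_distrib mult_ac)
  qed
  then show thesis using that[of "pi * t * k\<^sup>2"] k assms(2) by auto
qed

lemma gaussian_measurable [measurable]: "(\<lambda>y::real^'n. exp (- pi * t * (norm (A *v y))\<^sup>2)) \<in> borel_measurable borel"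
  by (intro borel_measurable_continuous_onI continuous_intros)

lemma integrable_gaussian:
  fixes A :: "real^'n^'n"
  assumes "invertible A" "t > 0"
  shows "integrable lborel (\<lambda>y. exp (- pi * t * (norm (A *v y))\<^sup>2))"
proof -
  obtain c where "c > 0" "\<And>y. exp (- pi * t * (norm (A *v y))\<^sup>2) \<le> exp (- c * (norm y)\<^sup>2)"
    using gaussian_bound[OF assms] by blast
  then show ?thesis by (intro integrable_gaussian_bound[OF gaussian_measurable, of c _ _ 1]) auto
qed

text \<open>
  Completing the square and translation invariance of Lebesgue measure.
\<close>

lemma gaussian_laplace:
  fixes A :: "real^'n^'n"
  assumes A: "invertible A" and t: "t > 0" and u: "\<And>y. u \<bullet> (A *v y) = w \<bullet> y"
  shows "integrable lborel (\<lambda>y. exp (- pi * t * (norm (A *v y))\<^sup>2) * exp (s * (2 * pi * t * (w \<bullet> y))))"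
    and "(LINT y|lborel. exp (- pi * t * (norm (A *v y))\<^sup>2) * exp (s * (2 * pi * t * (w \<bullet> y))))
       = gaussian_mass A t * exp (pi * t * (norm u)\<^sup>2 * s\<^sup>2)"
proof -
  define v where "v = matrix_inv A *v u"
  have Av: "A *v v = u" using A by (simp add: v_def matrix_vector_mul_assoc matrix_inv_right)
  let ?g = "\<lambda>y. exp (- pi * t * (norm (A *v y))\<^sup>2)"
  have eq: "?g y * exp (s * (2 * pi * t * (w \<bullet> y))) = exp (pi * t * (norm u)\<^sup>2 * s\<^sup>2) * ?g (y + (- s) *\<^sub>R v)" for y
  proof -
    have "A *v (y + (- s) *\<^sub>R v) = A *v y - s *\<^sub>R u"
      by (simp add: matrix_vector_mult_diff_distrib matrix_vector_mult_scaleR Av)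
    then have "(norm (A *v (y + (- s) *\<^sub>R v)))\<^sup>2 = (norm (A *v y))\<^sup>2 - 2 * s * (u \<bullet> (A *v y)) + s\<^sup>2 * (norm u)\<^sup>2"
      by (simp only: power2_norm_eq_inner inner_diff_left inner_diff_right inner_scaleR_left inner_scaleR_right
            inner_commute[of "A *v y" u]) (simp add: power2_eq_square algebra_simps)
    then have norm_eq: "(norm (A *v (y + (- s) *\<^sub>R v)))\<^sup>2 = (norm (A *v y))\<^sup>2 - 2 * s * (w \<bullet> y) + s\<^sup>2 * (norm u)\<^sup>2"
      unfolding u .
    show ?thesis
      unfolding norm_eq exp_add[symmetric] by (rule arg_cong[of _ _ exp]) (simp add: algebra_simps)
  qed
  have intg: "integrable lborel ?g" by (rule integrable_gaussian[OF A t])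
  have "integrable (distr lborel borel ((+) ((- s) *\<^sub>R v))) ?g"
    using intg by (simp only: lborel_distr_plus)
  moreover have "integrable (distr lborel borel ((+) ((- s) *\<^sub>R v))) ?g \<longleftrightarrow> integrable lborel (\<lambda>y. ?g ((- s) *\<^sub>R v + y))"
    by (rule integrable_distr_eq[OF _ gaussian_measurable]) measurable
  ultimately have "integrable lborel (\<lambda>y. ?g ((- s) *\<^sub>R v + y))" by blast
  then have int_shift: "integrable lborel (\<lambda>y. ?g (y + (- s) *\<^sub>R v))"
    by (simp only: add.commute)
  show "integrable lborel (\<lambda>y. ?g y * exp (s * (2 * pi * t * (w \<bullet> y))))"
    unfolding eq by (rule integrable_mult_right[OF int_shift])
  have "(LINT y|lborel. ?g (y + (- s) *\<^sub>R v)) = gaussian_mass A t"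
    unfolding gaussian_mass_def by (rule lborel_integral_translate[OF gaussian_measurable])
  then show "(LINT y|lborel. ?g y * exp (s * (2 * pi * t * (w \<bullet> y)))) = gaussian_mass A t * exp (pi * t * (norm u)\<^sup>2 * s\<^sup>2)"
    unfolding eq integral_mult_right_zero by (simp only: mult.commute)
qed

text \<open>
  The formula of \<open>gaussian_laplace\<close> holds for real \<open>s\<close> and both sides are entire; the Fourier transform
  is its value at \<open>s = \<i>/t\<close>.
\<close>

lemma gaussian_fourier:
  fixes A :: "real^'n^'n"
  assumes A: "invertible A" and t: "t > 0" and u: "\<And>y. u \<bullet> (A *v y) = w \<bullet> y"
  shows "(LINT y|lborel. of_real (exp (- pi * t * (norm (A *v y))\<^sup>2)) * char_fun w y)
       = of_real (gaussian_mass A t * exp (- pi / t * (norm u)\<^sup>2))"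
proof -
  let ?g = "\<lambda>y. exp (- pi * t * (norm (A *v y))\<^sup>2)"
  let ?l = "\<lambda>y. 2 * pi * t * (w \<bullet> y)"
  let ?H = "\<lambda>s. LINT y|lborel. complex_of_real (?g y) * exp (s * of_real (?l y))"
  let ?E = "\<lambda>s. of_real (gaussian_mass A t) * exp (of_real (pi * t * (norm u)\<^sup>2) * s\<^sup>2)"
  have "?H (\<i> / of_real t) = ?E (\<i> / of_real t)"
  proof (rule entire_eq_of_real_eq[of ?H ?E])
    show "?H holomorphic_on UNIV"
    proof (rule holomorphic_laplace_transform)
      show "integrable lborel (\<lambda>y. ?g y * exp (s * ?l y))" for s by (rule gaussian_laplace(1)[OF assms])
      show "?l \<in> borel_measurable lborel"
        unfolding measurable_lborel2 by (intro borel_measurable_continuous_onI continuous_intros)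
      show "?g \<in> borel_measurable lborel"
        unfolding measurable_lborel2 by (rule gaussian_measurable)
    qed simp_all
    show "?E holomorphic_on UNIV" by (intro holomorphic_intros)
    fix s :: real
    have "?H (of_real s) = (LINT y|lborel. complex_of_real (?g y * exp (s * ?l y)))"
      by (simp only: of_real_mult exp_of_real[symmetric])
    also have "\<dots> = of_real (LINT y|lborel. ?g y * exp (s * ?l y))" by (rule integral_complex_of_real)
    also have "\<dots> = ?E (of_real s)" unfolding gaussian_laplace(2)[OF assms] by (simp flip: exp_of_real)
    finally show "?H (of_real s) = ?E (of_real s)" .
  qed
  moreover have "?H (\<i> / of_real t) = (LINT y|lborel. of_real (?g y) * char_fun w y)"
    using t by (simp add: char_fun_def cis_conv_exp mult_ac)
  moreover have "?E (\<i> / of_real t) = of_real (gaussian_mass A t * exp (- pi / t * (norm u)\<^sup>2))"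
  proof -
    have "of_real (pi * t * (norm u)\<^sup>2) * (\<i> / complex_of_real t)\<^sup>2 = of_real (- pi / t * (norm u)\<^sup>2)"
      using t by (simp add: power_divide field_simps power2_eq_square)
    then show ?thesis unfolding exp_of_real[symmetric] of_real_mult[of "gaussian_mass A t"] by (simp only:)
  qed
  ultimately show ?thesis by simp
qed

lemma gaussian_mass_scaling:
  fixes A :: "real^'n^'n"
  assumes t: "t > 0"
  shows "sqrt t ^ CARD('n) * gaussian_mass A t = gaussian_mass A 1"
proof -
  have "gaussian_mass A 1 = (LINT y|density (distr lborel borel (\<lambda>x. 0 + sqrt t *\<^sub>R x)) (\<lambda>_. ennreal (\<bar>sqrt t\<bar> ^ DIM(real^'n))). exp (- pi * 1 * (norm (A *v y))\<^sup>2))"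
    unfolding gaussian_mass_def using t
    by (intro arg_cong[where f = "\<lambda>M. LINT y|M. exp (- pi * 1 * (norm (A *v y))\<^sup>2)"] lborel_affine) simp
  also have "\<dots> = (LINT y|distr lborel borel (\<lambda>x. 0 + sqrt t *\<^sub>R x). \<bar>sqrt t\<bar> ^ DIM(real^'n) *\<^sub>R exp (- pi * 1 * (norm (A *v y))\<^sup>2))"
    using t gaussian_measurable[of 1 A] by (intro integral_density) simp_all
  also have "\<dots> = (LINT y|lborel. \<bar>sqrt t\<bar> ^ DIM(real^'n) *\<^sub>R exp (- pi * 1 * (norm (A *v (0 + sqrt t *\<^sub>R y)))\<^sup>2))"
    using gaussian_measurable[of 1 A] by (intro integral_distr) simp_all
  also have "\<dots> = (LINT y|lborel. sqrt t ^ CARD('n) * exp (- pi * t * (norm (A *v y))\<^sup>2))"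
    using t by (simp add: matrix_vector_mult_scaleR power_mult_distrib mult.assoc)
  also have "\<dots> = sqrt t ^ CARD('n) * gaussian_mass A t" by (simp add: gaussian_mass_def)
  finally show ?thesis by simp
qed

lemma invertible_transpose_inv:
  fixes A :: "real^'n^'n"
  assumes A: "invertible A"
  shows "invertible (transpose (matrix_inv A))"
    and "(transpose (matrix_inv A) *v w) \<bullet> (A *v y) = w \<bullet> y"
proof -
  have "matrix_inv A ** A = mat 1" "A ** matrix_inv A = mat 1"
    using A by (simp_all add: matrix_inv_left matrix_inv_right)
  then show "invertible (transpose (matrix_inv A))"
    unfolding invertible_def by (metis matrix_transpose_mul transpose_mat)
  show "(transpose (matrix_inv A) *v w) \<bullet> (A *v y) = w \<bullet> y"
    using A by (simp add: dot_lmul_matrix matrix_vector_mul_assoc matrix_inv_left)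
qed

text \<open>
  In coordinates with respect to the columns of \<open>A\<close>, the dual lattice has the basis \<open>A\<^bsup>-T\<^esup>\<close>.
\<close>

lemma gaussian_poisson:
  fixes A :: "real^'n^'n"
  assumes A: "invertible A" and t: "t > 0"
  shows "(\<Sum>k. exp (- pi * t * (norm (A *v int_enum k))\<^sup>2)) =
    gaussian_mass A t * (\<Sum>k. exp (- pi * (1 / t) * (norm (transpose (matrix_inv A) *v int_enum k))\<^sup>2))"
proof -
  let ?B = "transpose (matrix_inv A)"
  obtain c where c: "c > 0" "\<And>y. exp (- pi * t * (norm (A *v y))\<^sup>2) \<le> exp (- c * (norm y)\<^sup>2)"
    using gaussian_bound[OF assms] by blast
  obtain c' where c': "c' > 0" "\<And>y. exp (- pi * (1 / t) * (norm (?B *v y))\<^sup>2) \<le> exp (- c' * (norm y)\<^sup>2)"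
    using gaussian_bound[OF invertible_transpose_inv(1)[OF A], of "1 / t"] t by auto
  have sumB: "summable (\<lambda>k. exp (- pi * (1 / t) * (norm (?B *v int_enum k))\<^sup>2))"
    by (rule summable_comparison_test'[OF summable_enum_gaussian[OF c'(1)], of 0]) (use c'(2) in auto)
  have "(\<Sum>k. exp (- pi * t * (norm (A *v int_enum k))\<^sup>2)) =
     (\<Sum>k. gaussian_mass A t * exp (- pi * (1 / t) * (norm (?B *v int_enum k))\<^sup>2))"
  proof (rule poisson_summation[where \<phi> = "\<lambda>y. exp (- pi * t * (norm (A *v y))\<^sup>2)" and c = c and c' = c' and K = 1
      and a = "\<lambda>w. gaussian_mass A t * exp (- pi * (1 / t) * (norm (?B *v w))\<^sup>2)" and K' = "\<bar>gaussian_mass A t\<bar>"])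
    show "(LINT y|lborel. of_real (exp (- pi * t * (norm (A *v y))\<^sup>2)) * char_fun w y) =
      of_real (gaussian_mass A t * exp (- pi * (1 / t) * (norm (?B *v w))\<^sup>2))" for w
      using gaussian_fourier[OF A t invertible_transpose_inv(2)[OF A], of w] by simp
    show "\<bar>gaussian_mass A t * exp (- pi * (1 / t) * (norm (?B *v w))\<^sup>2)\<bar> \<le> \<bar>gaussian_mass A t\<bar> * exp (- c' * (norm w)\<^sup>2)" for w
      using c'(2)[of w] by (simp only: abs_mult abs_exp_cancel mult_left_mono abs_ge_zero)
    show "continuous_on UNIV (\<lambda>y. exp (- pi * t * (norm (A *v y))\<^sup>2))" by (intro continuous_intros)
    show "gaussian_mass A t * exp (- pi * (1 / t) * (norm (?B *v (- w)))\<^sup>2) = gaussian_mass A t * exp (- pi * (1 / t) * (norm (?B *v w))\<^sup>2)" for w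
      by (simp add: vec.neg del: transpose_matrix_vector)
  qed (use c c' in auto)
  then show ?thesis by (simp only: suminf_mult[OF sumB])
qed

definition lattice_theta :: "(real^'n) set \<Rightarrow> real \<Rightarrow> real" where
  "lattice_theta L t = (\<Sum>\<^sub>\<infinity>x\<in>L. exp (- pi * t * (norm x)\<^sup>2))"

lemma
  fixes A :: "real^'n^'n"
  assumes A: "invertible A" and L: "L = (*v) A ` int_vectors" and t: "t > 0"
  shows lattice_theta_summable: "(\<lambda>x. exp (- pi * t * (norm x)\<^sup>2)) summable_on L"
    and lattice_theta_enum: "lattice_theta L t = (\<Sum>k. exp (- pi * t * (norm (A *v int_enum k))\<^sup>2))"
    and lattice_theta_enum_summable: "summable (\<lambda>k. exp (- pi * t * (norm (A *v int_enum k))\<^sup>2))"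
proof -
  let ?f = "\<lambda>n. exp (- pi * t * (norm (A *v n))\<^sup>2)"
  obtain c where c: "c > 0" "\<And>y. ?f y \<le> exp (- c * (norm y)\<^sup>2)"
    using gaussian_bound[OF A t] by blast
  have bij: "bij_betw ((*v) A) int_vectors L"
    unfolding L using inj_matrix_vector_mult[OF A] by (simp add: bij_betw_def inj_on_subset[OF _ subset_UNIV])
  show s: "summable (\<lambda>k. ?f (int_enum k))"
    by (rule summable_comparison_test'[OF summable_enum_gaussian[OF c(1)], of 0]) (use c(2) in auto)
  then have 1: "?f summable_on int_vectors"
    using summable_enum_iff[of ?f] by simp
  then show "(\<lambda>x. exp (- pi * t * (norm x)\<^sup>2)) summable_on L"
    using summable_on_reindex_bij_betw[OF bij, of "\<lambda>x. exp (- pi * t * (norm x)\<^sup>2)"] by simp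
  show "lattice_theta L t = (\<Sum>k. ?f (int_enum k))"
    unfolding suminf_enum[OF 1] lattice_theta_def
    using infsum_reindex_bij_betw[OF bij, of "\<lambda>x. exp (- pi * t * (norm x)\<^sup>2)"] by simp
qed

theorem lattice_theta_inversion:
  fixes A :: "real^'n^'n"
  assumes A: "invertible A" and L: "L = (*v) A ` int_vectors"
    and self_dual: "L = (*v) (transpose (matrix_inv A)) ` int_vectors" and t: "t > 0"
  shows "lattice_theta L (1 / t) = sqrt t ^ CARD('n) * lattice_theta L t"
proof -
  note B = invertible_transpose_inv(1)[OF A]
  have P: "lattice_theta L s = gaussian_mass A s * lattice_theta L (1 / s)" if "s > 0" for s
  proof -
    have "lattice_theta L s = (\<Sum>k. exp (- pi * s * (norm (A *v int_enum k))\<^sup>2))"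
      by (rule lattice_theta_enum[OF A L that])
    also have "\<dots> = gaussian_mass A s * (\<Sum>k. exp (- pi * (1 / s) * (norm (transpose (matrix_inv A) *v int_enum k))\<^sup>2))"
      by (rule gaussian_poisson[OF A that])
    also have "(\<Sum>k. exp (- pi * (1 / s) * (norm (transpose (matrix_inv A) *v int_enum k))\<^sup>2)) = lattice_theta L (1 / s)"
      using that by (intro lattice_theta_enum[OF B self_dual, symmetric]) auto
    finally show ?thesis .
  qed
  have "lattice_theta L 1 > 0"
    unfolding lattice_theta_enum[OF A L zero_less_one]
    by (intro suminf_pos lattice_theta_enum_summable[OF A L]) auto
  moreover have "lattice_theta L 1 = gaussian_mass A 1 * lattice_theta L 1"
    using P[OF zero_less_one] unfolding div_by_1 .
  ultimately have "gaussian_mass A 1 = 1" unfolding mult_cancel_right1 by linarith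
  then have "sqrt t ^ CARD('n) * gaussian_mass A t = 1" unfolding gaussian_mass_scaling[OF t] .
  then show ?thesis unfolding P[OF t] by (simp only: mult.assoc[symmetric] mult_1_left)
qed

section \<open>Forms of weight 12 vanishing to second order\<close>

text \<open>
  From \<open>x \<le> e\<^bsup>x - 1\<^esup>\<close> at \<open>x = 2y\<close>, since \<open>2\<pi> > 6\<close>. Here the weight 12 meets the order of vanishing 2.
\<close>

lemma exp_growth_bound:
  fixes y :: real
  assumes "y \<ge> 1"
  shows "(2 * y) ^ 6 < exp (4 * pi * y - 2 * pi)"
proof -
  have "2 * y \<le> exp (2 * y - 1)" using exp_ge_add_one_self[of "2 * y - 1"] by simp
  then have "(2 * y) ^ 6 \<le> exp (2 * y - 1) ^ 6" using assms by (intro power_mono) auto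
  also have "\<dots> = exp (6 * (2 * y - 1))" by (simp flip: exp_of_nat_mult)
  also have "\<dots> < exp (2 * pi * (2 * y - 1))"
    using assms pi_gt3 by (intro exp_less_mono mult_strict_right_mono) auto
  also have "2 * pi * (2 * y - 1) = 4 * pi * y - 2 * pi" by (simp add: algebra_simps)
  finally show ?thesis .
qed

text \<open>
  By analytic continuation \<open>f(z) = \<Sum> c\<^sub>n q\<^sup>n\<close>, \<open>q = e\<^bsup>2\<pi>iz\<^esup>\<close>, satisfies \<open>f(-1/z) = z\<^sup>1\<^sup>2 f(z)\<close>, so \<open>|f(z)| (Im z)\<^sup>6\<close> is
  invariant under \<open>z \<mapsto> -1/z\<close>. Let \<open>B\<close> be the maximum of \<open>|k|\<close>, \<open>k = f/q\<^sup>2\<close>, over the disc \<open>|q| \<le> e\<^sup>-\<^sup>\<pi>\<close>. It is attained on the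
  circle, at a point \<open>z\<close> with \<open>Im z = 1/2\<close> and \<open>|Re z| \<le> 1/2\<close>. Then \<open>w = -1/z\<close> has
  \<open>y = Im w \<ge> 1\<close>, and the invariance gives \<open>B e\<^bsup>-2\<pi>\<^esup> / (2y)\<^sup>6 \<le> B e\<^bsup>-4\<pi>y\<^esup>\<close>, which is absurd for \<open>B > 0\<close>.
\<close>

theorem weight_12_vanishing:
  fixes c :: "nat \<Rightarrow> real"
  assumes c01: "c 0 = 0" "c 1 = 0"
    and summable: "\<And>r. 0 < r \<Longrightarrow> r < 1 \<Longrightarrow> summable (\<lambda>n. c n * r ^ n)"
    and inversion: "\<And>t. t > 0 \<Longrightarrow>
      (\<Sum>n. c n * exp (- 2 * pi / t) ^ n) = t ^ 12 * (\<Sum>n. c n * exp (- 2 * pi * t) ^ n)"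
  shows "c n = 0"
proof -
  define K :: "complex fps" where "K = Abs_fps (\<lambda>n. of_real (c (n + 2)))"
  define k where "k = eval_fps K"
  define e where "e = (\<lambda>z. exp (2 * of_real pi * \<i> * z))"
  define f where "f = (\<lambda>z. e z ^ 2 * k (e z))"
  have norm_e: "norm (e z) = exp (- 2 * pi * Im z)" for z by (simp add: e_def)
  have summable_shift: "summable (\<lambda>n. c (n + 2) * r ^ n)" if r: "0 < r" "r < 1" for r
  proof -
    have "summable (\<lambda>n. c (n + 2) * r ^ (n + 2))"
      using summable[OF r] by (subst summable_iff_shift[of "\<lambda>n. c n * r ^ n"])
    then have "summable (\<lambda>n. r ^ 2 * (c (n + 2) * r ^ n))" by (simp only: power_add mult_ac)
    then show ?thesis using r by (subst (asm) summable_cmult_iff) auto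
  qed
  have rad: "fps_conv_radius K \<ge> 1" unfolding fps_conv_radius_def
  proof (rule conv_radius_geI_ex')
    fix r :: real assume r: "0 < r" "ereal r < 1"
    then have "summable (\<lambda>n. c (n + 2) * r ^ n)" by (intro summable_shift) auto
    then have "summable (\<lambda>n. complex_of_real (c (n + 2) * r ^ n))" by (rule summable_of_real)
    then show "summable (\<lambda>n. fps_nth K n * of_real r ^ n)" by (simp add: K_def)
  qed
  have holk: "k holomorphic_on ball 0 1" unfolding k_def
  proof (rule holomorphic_on_eval_fps)
    show "ball 0 1 \<subseteq> eball 0 (fps_conv_radius K)"
      by (rule ball_eball_mono) (use rad in \<open>simp add: one_ereal_def\<close>)
  qed
  have hole: "e holomorphic_on S" for S unfolding e_def by (intro holomorphic_intros)
  have e_ball: "e z \<in> ball 0 1" if "Im z > 0" for z using that by (simp add: norm_e)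
  have holf: "f holomorphic_on {z. Im z > 0}"
    unfolding f_def
    by (intro holomorphic_intros hole holomorphic_on_compose_gen[OF hole holk, unfolded o_def])
       (use e_ball in auto)
  have f_axis: "f (\<i> * of_real t) = of_real (\<Sum>n. c n * exp (- 2 * pi * t) ^ n)" if "t > 0" for t
  proof -
    let ?r = "exp (- 2 * pi * t)"
    have "e (\<i> * of_real t) = exp (of_real (- 2 * pi * t))"
      unfolding e_def by (rule arg_cong[of _ _ exp]) (simp add: algebra_simps)
    then have er: "e (\<i> * of_real t) = of_real ?r" by (simp only: exp_of_real)
    have r: "0 < ?r" "?r < 1" using that by auto
    note s = summable_shift[OF r]
    have "(\<Sum>n. c n * ?r ^ n) = (\<Sum>n. c (n + 2) * ?r ^ (n + 2))"
      using suminf_split_initial_segment[OF summable[OF r], of 2] c01 by (simp add: numeral_2_eq_2)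
    also have "\<dots> = (\<Sum>n. ?r ^ 2 * (c (n + 2) * ?r ^ n))" by (simp only: power_add mult_ac)
    also have "\<dots> = ?r ^ 2 * (\<Sum>n. c (n + 2) * ?r ^ n)" by (rule suminf_mult[OF s])
    finally have "of_real (\<Sum>n. c n * ?r ^ n) = complex_of_real ?r ^ 2 * of_real (\<Sum>n. c (n + 2) * ?r ^ n)"
      by (simp only: of_real_mult of_real_power)
    also have "complex_of_real (\<Sum>n. c (n + 2) * ?r ^ n) = k (of_real ?r)"
      unfolding suminf_of_real[OF s] by (simp add: k_def eval_fps_def K_def)
    finally show ?thesis unfolding f_def er by simp
  qed
  have f_inv: "f (- 1 / z) = z ^ 12 * f z" if "Im z > 0" for z
  proof -
    let ?H = "{z. Im z > 0}"
    have inv_H: "Im (- 1 / z) > 0" if "Im z > 0" for z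
      using that by (auto simp: Im_divide power2_eq_square intro!: divide_pos_pos add_nonneg_pos)
    have "f (- 1 / z) - z ^ 12 * f z = 0"
    proof (rule analytic_continuation[of "\<lambda>z. f (- 1 / z) - z ^ 12 * f z" ?H "(\<lambda>t. \<i> * of_real t) ` {0<..}" \<i>])
      have "(\<lambda>z. - 1 / z) holomorphic_on ?H" by (intro holomorphic_intros) auto
      then have "(f \<circ> (\<lambda>z. - 1 / z)) holomorphic_on ?H"
        by (rule holomorphic_on_compose_gen[OF _ holf]) (use inv_H in blast)
      then have "(\<lambda>z. f (- 1 / z)) holomorphic_on ?H" unfolding o_def .
      then show "(\<lambda>z. f (- 1 / z) - z ^ 12 * f z) holomorphic_on ?H"
        by (intro holomorphic_intros holf)
      show "open ?H" by (rule open_halfspace_Im_gt)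
      show "connected ?H" by (intro convex_connected convex_halfspace_Im_gt)
      show "(\<lambda>t. \<i> * of_real t) ` {0<..} \<subseteq> ?H" by auto
      show "\<i> islimpt (\<lambda>t. \<i> * of_real t) ` {0<..}"
        unfolding islimpt_approachable
      proof (intro allI impI)
        fix d :: real assume d: "d > 0"
        have "\<i> * of_real (1 + d / 2) \<in> (\<lambda>t. \<i> * of_real t) ` {0<..}" using d by (intro imageI) simp
        moreover have "\<i> * of_real (1 + d / 2) \<noteq> \<i>" using d by (simp add: complex_eq_iff)
        moreover have "dist (\<i> * of_real (1 + d / 2)) \<i> < d" using d by (simp add: dist_norm algebra_simps norm_mult norm_divide)
        ultimately show "\<exists>x'\<in>(\<lambda>t. \<i> * of_real t) ` {0<..}. x' \<noteq> \<i> \<and> dist x' \<i> < d" by blast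
      qed
      show "f (- 1 / z) - z ^ 12 * f z = 0" if zU: "z \<in> (\<lambda>t. \<i> * of_real t) ` {0<..}" for z
      proof -
        obtain t where t: "t > 0" "z = \<i> * of_real t" using zU by auto
        have "- 1 / z = \<i> * of_real (1 / t)" using t by (simp add: field_simps)
        then have "f (- 1 / z) = of_real (\<Sum>n. c n * exp (- 2 * pi / t) ^ n)" using f_axis[of "1 / t"] t by simp
        also have "\<dots> = of_real t ^ 12 * f z" unfolding inversion[OF t(1)] t(2) f_axis[OF t(1)] by simp
        also have "of_real t ^ 12 = z ^ 12" unfolding t(2) power_mult_distrib by (simp add: eval_nat_numeral)
        finally show ?thesis by simp
      qed
    qed (use that in auto)
    then show ?thesis by simp
  qed
  define R where "R = exp (- pi)"
  have R: "0 < R" "R < 1" by (auto simp: R_def)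
  have contk: "continuous_on (cball 0 R) k"
    using R by (intro holomorphic_on_imp_continuous_on holomorphic_on_subset[OF holk]) auto
  obtain q1 where q1: "norm q1 = R" "\<And>q. norm q = R \<Longrightarrow> norm (k q) \<le> norm (k q1)"
  proof -
    have "\<exists>x\<in>sphere 0 R. \<forall>y\<in>sphere 0 R. norm (k y) \<le> norm (k x)"
      using R by (intro continuous_attains_sup continuous_intros continuous_on_subset[OF contk]) auto
    then show thesis using that by auto
  qed
  have max: "norm (k q) \<le> norm (k q1)" if "norm q \<le> R" for q
  proof (rule maximum_modulus_frontier[of k "cball 0 R"])
    show "k holomorphic_on interior (cball 0 R)"
      using R by (intro holomorphic_on_subset[OF holk]) auto
    show "continuous_on (closure (cball 0 R)) k" using contk by simp
  qed (use that R q1(2) in auto)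
  have "k q1 = 0"
  proof (rule ccontr)
    assume nz: "k q1 \<noteq> 0"
    have q1nz: "q1 \<noteq> 0" using q1 R by auto
    define z where "z = Ln q1 / (2 * of_real pi * \<i>)"
    have ez: "e z = q1" using q1nz by (simp add: e_def z_def)
    have z_alt: "z = Complex (Im (Ln q1) / (2 * pi)) (- Re (Ln q1) / (2 * pi))"
      unfolding z_def by (simp add: complex_eq_iff Re_divide Im_divide power2_eq_square field_simps)
    have Imz: "Im z = 1 / 2" using q1nz q1(1) by (simp add: z_alt R_def)
    have Rez: "\<bar>Re z\<bar> \<le> 1 / 2"
      using mpi_less_Im_Ln[OF q1nz] Im_Ln_le_pi[OF q1nz] by (simp add: z_alt abs_le_iff field_simps)
    define w where "w = - 1 / z"
    define y where "y = Im w"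
    have nz2: "(norm z)\<^sup>2 = 1 / (2 * y)" "(norm z)\<^sup>2 \<le> 1 / 2"
    proof -
      have n: "(norm z)\<^sup>2 = (Re z)\<^sup>2 + (Im z)\<^sup>2" by (rule cmod_power2)
      have "\<bar>Re z\<bar>\<^sup>2 \<le> (1 / 2)\<^sup>2" using Rez by (intro power_mono) auto
      then show "(norm z)\<^sup>2 \<le> 1 / 2" unfolding n Imz by (simp add: power2_eq_square)
      have "y = Im z / (norm z)\<^sup>2" unfolding n by (simp add: y_def w_def Im_divide)
      then have "y = (1 / 2) / (norm z)\<^sup>2" unfolding Imz .
      then show "(norm z)\<^sup>2 = 1 / (2 * y)" by simp
    qed
    have zpos: "(norm z)\<^sup>2 > 0" using Imz by auto
    have y1: "y \<ge> 1"
    proof -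
      have y: "y > 0" using zpos nz2(1) by (simp add: zero_less_divide_iff)
      then have "1 = y * (2 * (norm z)\<^sup>2)" using nz2(1) by simp
      also have "\<dots> \<le> y * 1" using y nz2(2) by (intro mult_left_mono) auto
      finally show ?thesis by simp
    qed
    have "norm (f w) = norm z ^ 12 * norm (f z)"
      using f_inv[of z] Imz by (simp add: w_def norm_mult norm_power)
    also have "norm z ^ 12 = ((norm z)\<^sup>2) ^ 6" by (simp flip: power_mult)
    also have "\<dots> = 1 / (2 * y) ^ 6" unfolding nz2(1) by (simp add: power_divide)
    also have "norm (f z) = exp (- 2 * pi) * norm (k q1)"
      by (simp add: f_def ez norm_mult norm_power q1(1) R_def flip: exp_of_nat_mult)
    finally have fw: "norm (f w) = exp (- 2 * pi) * norm (k q1) / (2 * y) ^ 6" by simp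
    have "norm (f w) = exp (- 4 * pi * y) * norm (k (e w))"
      by (simp add: f_def norm_mult norm_power norm_e y_def flip: exp_of_nat_mult)
    also have "norm (k (e w)) \<le> norm (k q1)"
    proof (rule max)
      have "pi * 1 \<le> pi * (2 * y)" using y1 by (intro mult_left_mono) auto
      then show "norm (e w) \<le> R" unfolding norm_e R_def y_def[symmetric] by simp
    qed
    finally have "exp (- 2 * pi) * norm (k q1) / (2 * y) ^ 6 \<le> exp (- 4 * pi * y) * norm (k q1)"
      unfolding fw by simp
    then have "exp (- 2 * pi) / (2 * y) ^ 6 \<le> exp (- 4 * pi * y)" using nz by (simp add: divide_simps split: if_splits)
    then have "exp (- 2 * pi) \<le> exp (- 4 * pi * y) * (2 * y) ^ 6" using y1 by (simp add: pos_divide_le_eq)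
    then have "exp (4 * pi * y) * exp (- 2 * pi) \<le> exp (4 * pi * y) * (exp (- 4 * pi * y) * (2 * y) ^ 6)"
      by (intro mult_left_mono) auto
    also have "\<dots> = (2 * y) ^ 6" by (simp add: mult.assoc[symmetric] flip: exp_add)
    finally have "exp (4 * pi * y - 2 * pi) \<le> (2 * y) ^ 6" by (simp flip: exp_add)
    then show False using exp_growth_bound[OF y1] by simp
  qed
  then have "eval_fps K q = eval_fps 0 q" if "norm q \<le> R" for q using max[OF that] by (simp add: k_def)
  then have "eventually (\<lambda>q. eval_fps K q = eval_fps 0 q) (nhds 0)"
    using R by (intro eventually_nhds_in_open[THEN eventually_mono, of "ball 0 R"]) auto
  then have "K = 0" by (intro eval_fps_eqD) (use rad in \<open>auto intro: less_le_trans[of 0 1]\<close>)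
  then have "c (m + 2) = 0" for m
  proof -
    have "fps_nth K m = 0" using \<open>K = 0\<close> by simp
    then show ?thesis by (simp add: K_def)
  qed
  then show ?thesis
    using c01 by (cases n rule: nat.exhaust[case_names 0 Suc]) (metis, metis One_nat_def add_2_eq_Suc' not0_implies_Suc)
qed

section \<open>Jacobi theta constants\<close>

text \<open>In this part and the next, \<open>$\<close> denotes the coefficients of power series.\<close>

no_notation vec_nth (infixl "$" 90)
notation fps_nth (infixl "$" 75)

text \<open>
  With \<open>p = e\<^bsup>-\<pi>t\<^esup>\<close> the theta constants are \<open>\<theta>\<^sub>3 = square_theta(p)\<close>, \<open>\<theta>\<^sub>4 = square_theta(-p)\<close> and
  \<open>\<theta>\<^sub>2 = 2 p\<^bsup>1/4\<^esup> pronic_theta(p)\<close>; the eighth power of \<open>\<theta>\<^sub>2\<close> is again a power series in \<open>p\<close>.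
\<close>

definition square_theta :: "real fps" where
  "square_theta = Abs_fps (\<lambda>n. if n = 0 then 1 else if n \<in> range (\<lambda>k. k\<^sup>2) then 2 else 0)"

definition square_theta_alt :: "real fps" where
  "square_theta_alt = Abs_fps (\<lambda>n. (- 1) ^ n * square_theta $ n)"

definition pronic_theta :: "real fps" where
  "pronic_theta = Abs_fps (\<lambda>n. if n \<in> range (\<lambda>k. k * (k + 1)) then 1 else 0)"

lemma conv_radius_ge_1:
  fixes f :: "real fps"
  assumes "\<And>n. \<bar>f $ n\<bar> \<le> 2"
  shows "fps_conv_radius f \<ge> 1"
  unfolding fps_conv_radius_def
proof (rule conv_radius_geI_ex')
  fix r :: real assume r: "0 < r" "ereal r < 1"
  show "summable (\<lambda>n. f $ n * of_real r ^ n)"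
  proof (rule summable_comparison_test'[of "\<lambda>n. 2 * r ^ n" 0])
    show "summable (\<lambda>n. 2 * r ^ n)" using r by (intro summable_mult summable_geometric) auto
    show "norm (f $ n * of_real r ^ n) \<le> 2 * r ^ n" for n
      using assms[of n] r by (simp add: abs_mult power_abs mult_right_mono)
  qed
qed

lemma radius_thetas:
  "fps_conv_radius square_theta \<ge> 1" "fps_conv_radius square_theta_alt \<ge> 1" "fps_conv_radius pronic_theta \<ge> 1"
  by (rule conv_radius_ge_1; simp add: square_theta_def square_theta_alt_def pronic_theta_def abs_mult power_abs)+

lemma eval_thetas_sums:
  fixes r :: real
  assumes "\<bar>r\<bar> < 1"
  shows "(\<lambda>k. (if k = 0 then 1 else 2) * r ^ k\<^sup>2) sums eval_fps square_theta r"
    and "(\<lambda>k. r ^ (k * (k + 1))) sums eval_fps pronic_theta r"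
proof -
  have *: "(\<lambda>n. f $ n * r ^ n) sums eval_fps f r" if "fps_conv_radius f \<ge> 1" for f :: "real fps"
  proof (rule sums_eval_fps)
    have "ereal (norm r) < 1" using assms by (simp add: one_ereal_def)
    then show "ereal (norm r) < fps_conv_radius f" using that by (rule less_le_trans)
  qed
  have "strict_mono (\<lambda>k::nat. k\<^sup>2)" by (intro strict_monoI) (simp add: power_strict_mono)
  then have "(\<lambda>k. square_theta $ k\<^sup>2 * r ^ k\<^sup>2) sums eval_fps square_theta r"
    using *[OF radius_thetas(1)]
    by (subst sums_mono_reindex) (auto simp: square_theta_def)
  also have "(\<lambda>k. square_theta $ k\<^sup>2 * r ^ k\<^sup>2) = (\<lambda>k. (if k = 0 then 1 else 2) * r ^ k\<^sup>2)"
    by (auto simp: square_theta_def fun_eq_iff)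
  finally show "(\<lambda>k. (if k = 0 then 1 else 2) * r ^ k\<^sup>2) sums eval_fps square_theta r" .
  have "strict_mono (\<lambda>k::nat. k * (k + 1))" by (intro strict_mono_Suc_iff[THEN iffD2]) auto
  then have "(\<lambda>k. pronic_theta $ (k * (k + 1)) * r ^ (k * (k + 1))) sums eval_fps pronic_theta r"
    using *[OF radius_thetas(3)]
    by (subst sums_mono_reindex) (auto simp: pronic_theta_def)
  then show "(\<lambda>k. r ^ (k * (k + 1))) sums eval_fps pronic_theta r"
    by (simp add: pronic_theta_def)
qed

text \<open>
  Split \<open>\<Sum> r\<^bsup>k\<^sup>2\<^esup>\<close> into even and odd \<open>k\<close> and use \<open>(2j + 1)\<^sup>2 = 4 j (j + 1) + 1\<close>.
  The behaviour of all three theta constants under \<open>t \<mapsto> 1/t\<close> follows from that of \<open>\<theta>\<^sub>3\<close> by this identity.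
\<close>

lemma eval_square_theta_split:
  fixes r :: real
  assumes "\<bar>r\<bar> < 1"
  shows "eval_fps square_theta r = eval_fps square_theta (r ^ 4) + 2 * r * eval_fps pronic_theta (r ^ 4)"
proof -
  have r4: "\<bar>r ^ 4\<bar> < 1"
  proof -
    have "\<bar>r\<bar> ^ 4 < 1 ^ 4" using assms by (intro power_strict_mono) auto
    then show ?thesis by (simp add: power_abs)
  qed
  let ?b = "\<lambda>k::nat. if k = 0 then 1 else 2 :: real"
  have "(\<lambda>k. 2 * r * (r ^ 4) ^ (k * (k + 1))) sums (2 * r * eval_fps pronic_theta (r ^ 4))"
    by (intro sums_mult eval_thetas_sums r4)
  from sums_if[OF this eval_thetas_sums(1)[OF r4]]
  have "(\<lambda>k. if even k then ?b (k div 2) * (r ^ 4) ^ (k div 2)\<^sup>2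
     else 2 * r * (r ^ 4) ^ ((k - 1) div 2 * ((k - 1) div 2 + 1))) sums
     (eval_fps square_theta (r ^ 4) + 2 * r * eval_fps pronic_theta (r ^ 4))" by (simp only: add.commute)
  also have "(\<lambda>k. if even k then ?b (k div 2) * (r ^ 4) ^ (k div 2)\<^sup>2
     else 2 * r * (r ^ 4) ^ ((k - 1) div 2 * ((k - 1) div 2 + 1))) = (\<lambda>k. ?b k * r ^ k\<^sup>2)"
  proof
    fix k :: nat
    show "(if even k then ?b (k div 2) * (r ^ 4) ^ (k div 2)\<^sup>2
     else 2 * r * (r ^ 4) ^ ((k - 1) div 2 * ((k - 1) div 2 + 1))) = ?b k * r ^ k\<^sup>2"
    proof (cases "even k")
      case True
      then obtain j where "k = 2 * j" by blast
      then show ?thesis by (simp add: power_mult_distrib flip: power_mult)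
    next
      case False
      then obtain j where j: "k = 2 * j + 1" by (rule oddE)
      have "k\<^sup>2 = Suc (4 * (j * (j + 1)))" by (simp add: j power2_eq_square)
      then have "r ^ k\<^sup>2 = r * (r ^ 4) ^ (j * (j + 1))" by (simp only: power_Suc power_mult)
      then show ?thesis using False by (simp add: j)
    qed
  qed
  finally show ?thesis using eval_thetas_sums(1)[OF assms] by (rule sums_unique2[symmetric])
qed

lemma eval_square_theta_alt: "eval_fps square_theta_alt r = eval_fps square_theta (- r)"
  unfolding eval_fps_def square_theta_alt_def by (intro suminf_cong) (simp add: power_minus[of r])

lemma lattice_theta_integers:
  assumes t: "t > 0"
  shows "lattice_theta (int_vectors :: (real^1) set) t = eval_fps square_theta (exp (- pi * t))"
proof -
  let ?r = "exp (- pi * t)"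
  let ?h = "\<lambda>k::int. exp (- (pi * t) * (of_int k)\<^sup>2)"
  have r: "\<bar>?r\<bar> < 1" using t by simp
  have sum: "?h summable_on UNIV" using summable_on_int_gaussian[of "pi * t"] t by simp
  have bij: "bij_betw (\<lambda>k::int. vec_of_ints (\<lambda>_::1. k)) UNIV (int_vectors :: (real^1) set)"
  proof -
    have "bij_betw (\<lambda>k::int. (\<lambda>_::1. k)) UNIV UNIV"
      by (rule bij_betw_byWitness[where f' = "\<lambda>f. f 1"]) (auto simp: fun_eq_iff)
    from bij_betw_trans[OF this bij_vec_of_ints] show ?thesis by (simp add: o_def)
  qed
  have "lattice_theta (int_vectors :: (real^1) set) t = infsum ?h UNIV"
    unfolding lattice_theta_def using infsum_reindex_bij_betw[OF bij, of "\<lambda>x. exp (- pi * t * (norm x)\<^sup>2)"]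
    by (simp add: norm_vec_def L2_set_def vec_of_ints_def)
  also have "\<dots> = infsum ?h (range int) + infsum ?h (range (\<lambda>n. - int n) - {0})"
  proof -
    have "range int \<union> (range (\<lambda>n. - int n) - {0}) = (UNIV :: int set)"
      by (auto simp: image_iff) (metis int_cases2 of_nat_eq_0_iff neg_equal_0_iff_equal)
    moreover have "range int \<inter> (range (\<lambda>n. - int n) - {0}) = {}" by auto
    ultimately show ?thesis
      using infsum_Un_disjoint[of ?h "range int" "range (\<lambda>n. - int n) - {0}"]
        summable_on_subset_banach[OF sum] by auto
  qed
  also have "infsum ?h (range (\<lambda>n. - int n) - {0}) = infsum ?h (range (\<lambda>n. - int n)) - ?h 0"
    using infsum_Diff[of ?h "range (\<lambda>n. - int n)" "{0}"] summable_on_subset_banach[OF sum] by (simp add: image_iff)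
  also have "infsum ?h (range int) = infsum (\<lambda>n. ?h (int n)) UNIV"
    by (subst infsum_reindex) (auto simp: o_def)
  also have "infsum ?h (range (\<lambda>n. - int n)) = infsum (\<lambda>n. ?h (int n)) UNIV"
    by (subst infsum_reindex) (auto simp: o_def inj_def)
  finally have 1: "lattice_theta (int_vectors :: (real^1) set) t = 2 * infsum (\<lambda>n. ?h (int n)) UNIV - 1" by simp
  have "(\<lambda>n. ?h (int n)) summable_on UNIV"
  proof -
    have "?h summable_on range int" by (rule summable_on_subset_banach[OF sum]) simp
    then show ?thesis by (subst (asm) summable_on_reindex) (auto simp: o_def)
  qed
  then have "(\<lambda>n. ?h (int n)) sums infsum (\<lambda>n. ?h (int n)) UNIV"
    by (intro has_sum_imp_sums has_sum_infsum)
  then have "(\<lambda>n. 2 * ?h (int n) - (if n = 0 then 1 else 0)) sums (2 * infsum (\<lambda>n. ?h (int n)) UNIV - 1)"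
    by (intro sums_diff sums_mult sums_single)
  also have "(\<lambda>n. 2 * ?h (int n) - (if n = 0 then 1 else 0)) = (\<lambda>n. (if n = 0 then 1 else 2) * ?r ^ n\<^sup>2)"
    by (auto simp: fun_eq_iff mult_ac simp flip: exp_of_nat_mult)
  finally show ?thesis using eval_thetas_sums(1)[OF r] unfolding 1 by (rule sums_unique2)
qed

lemma square_theta_inversion:
  assumes t: "t > 0"
  shows "eval_fps square_theta (exp (- pi / t)) = sqrt t * eval_fps square_theta (exp (- pi * t))"
proof -
  have mat1: "invertible (mat 1 :: real^1^1)" "(*v) (mat 1 :: real^1^1) = id"
    by (auto simp: fun_eq_iff invertible_def intro!: exI[of _ "mat 1"])
  have "matrix_inv (mat 1 :: real^1^1) = mat 1" using matrix_inv_left[OF mat1(1)] by simp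
  then have "lattice_theta (int_vectors :: (real^1) set) (1 / t) = sqrt t ^ CARD(1) * lattice_theta (int_vectors :: (real^1) set) t"
    by (intro lattice_theta_inversion[OF mat1(1) _ _ t]) (simp_all only: mat1(2) transpose_mat image_id id_apply)
  then show ?thesis using t by (simp add: lattice_theta_integers)
qed

section \<open>A form of weight 12 with known coefficients\<close>

text \<open>
  The coefficients up to \<open>p\<^sup>8 = q\<^sup>4\<close>, that is, up to vectors of norm 8.
\<close>

definition starts :: "real fps \<Rightarrow> real \<Rightarrow> real \<Rightarrow> real \<Rightarrow> real \<Rightarrow> real \<Rightarrow> real \<Rightarrow> real \<Rightarrow> real \<Rightarrow> real \<Rightarrow> bool" where
  "starts f a0 a1 a2 a3 a4 a5 a6 a7 a8 \<longleftrightarrow>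
     f $ 0 = a0 \<and> f $ 1 = a1 \<and> f $ 2 = a2 \<and> f $ 3 = a3 \<and> f $ 4 = a4 \<and> f $ 5 = a5 \<and> f $ 6 = a6 \<and> f $ 7 = a7 \<and> f $ 8 = a8"

lemma starts_mult:
  assumes "starts f a0 a1 a2 a3 a4 a5 a6 a7 a8" "starts g b0 b1 b2 b3 b4 b5 b6 b7 b8"
  shows "starts (f * g)
    (a0 * b0)
    (a0 * b1 + a1 * b0)
    (a0 * b2 + a1 * b1 + a2 * b0)
    (a0 * b3 + a1 * b2 + a2 * b1 + a3 * b0)
    (a0 * b4 + a1 * b3 + a2 * b2 + a3 * b1 + a4 * b0)
    (a0 * b5 + a1 * b4 + a2 * b3 + a3 * b2 + a4 * b1 + a5 * b0)
    (a0 * b6 + a1 * b5 + a2 * b4 + a3 * b3 + a4 * b2 + a5 * b1 + a6 * b0)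
    (a0 * b7 + a1 * b6 + a2 * b5 + a3 * b4 + a4 * b3 + a5 * b2 + a6 * b1 + a7 * b0)
    (a0 * b8 + a1 * b7 + a2 * b6 + a3 * b5 + a4 * b4 + a5 * b3 + a6 * b2 + a7 * b1 + a8 * b0)"
proof -
  have "{0..1::nat} = {0, 1}" by auto
  moreover
  have "{0..2::nat} = {0, 1, 2}" by auto
  moreover
  have "{0..3::nat} = {0, 1, 2, 3}" by auto
  moreover
  have "{0..4::nat} = {0, 1, 2, 3, 4}" by auto
  moreover
  have "{0..5::nat} = {0, 1, 2, 3, 4, 5}" by auto
  moreover
  have "{0..6::nat} = {0, 1, 2, 3, 4, 5, 6}" by auto
  moreover
  have "{0..7::nat} = {0, 1, 2, 3, 4, 5, 6, 7}" by auto
  moreover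
  have "{0..8::nat} = {0, 1, 2, 3, 4, 5, 6, 7, 8}" by auto
  ultimately show ?thesis
    using assms unfolding starts_def fps_mult_nth by simp
qed

lemma starts_add:
  assumes "starts f a0 a1 a2 a3 a4 a5 a6 a7 a8" "starts g b0 b1 b2 b3 b4 b5 b6 b7 b8"
  shows "starts (f + g) (a0 + b0) (a1 + b1) (a2 + b2) (a3 + b3) (a4 + b4) (a5 + b5) (a6 + b6) (a7 + b7) (a8 + b8)"
  using assms by (simp add: starts_def)

lemma starts_diff:
  assumes "starts f a0 a1 a2 a3 a4 a5 a6 a7 a8" "starts g b0 b1 b2 b3 b4 b5 b6 b7 b8"
  shows "starts (f - g) (a0 - b0) (a1 - b1) (a2 - b2) (a3 - b3) (a4 - b4) (a5 - b5) (a6 - b6) (a7 - b7) (a8 - b8)"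
  using assms by (simp add: starts_def)

lemma starts_cmult:
  assumes "starts f a0 a1 a2 a3 a4 a5 a6 a7 a8"
  shows "starts (fps_const c * f) (c * a0) (c * a1) (c * a2) (c * a3) (c * a4) (c * a5) (c * a6) (c * a7) (c * a8)"
  using assms by (simp add: starts_def)

text \<open>
  \<open>E\<^sub>4 = (\<theta>\<^sub>2\<^sup>8 + \<theta>\<^sub>3\<^sup>8 + \<theta>\<^sub>4\<^sup>8)/2\<close>, the theta series of \<open>E\<^sub>8\<close>.
\<close>

definition eisenstein4 :: "real fps" where
  "eisenstein4 = fps_const (1 / 2) *
     (fps_const 256 * (fps_X\<^sup>2 * pronic_theta ^ 8) + square_theta ^ 8 + square_theta_alt ^ 8)"

text \<open>
  \<open>E\<^sub>4\<^sup>3 - 720 \<Delta>\<close> with \<open>\<Delta> = (\<theta>\<^sub>2 \<theta>\<^sub>3 \<theta>\<^sub>4)\<^sup>8 / 256\<close>. The factor 720 removes the coefficient of \<open>q\<close>.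
\<close>

definition comparison_form :: "real fps" where
  "comparison_form = eisenstein4 ^ 3 -
     fps_const 720 * (fps_X\<^sup>2 * pronic_theta ^ 8 * square_theta ^ 8 * square_theta_alt ^ 8)"

lemma starts_comparison_form: "starts comparison_form 1 0 0 0 196560 0 16773120 0 398034000"
proof -
  have pow8: "f ^ 8 = (f * f) * (f * f) * ((f * f) * (f * f))" for f :: "real fps"
    by (simp add: eval_nat_numeral mult.assoc)
  have sq_iff: "n \<in> range (\<lambda>k. k\<^sup>2) \<longleftrightarrow> (\<exists>k\<in>{0..3}. n = k\<^sup>2)" if "n < 9" for n :: nat
  proof -
    have "k \<le> 3" if "n = k\<^sup>2" for k
    proof (rule ccontr)
      assume "\<not> k \<le> 3"
      then have "4\<^sup>2 \<le> k\<^sup>2" by (intro power_mono) auto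
      with \<open>n < 9\<close> that show False by simp
    qed
    then show ?thesis by auto
  qed
  have pr_iff: "n \<in> range (\<lambda>k. k * (k + 1)) \<longleftrightarrow> (\<exists>k\<in>{0..3}. n = k * (k + 1))" if "n < 9" for n :: nat
  proof -
    have "k \<le> 3" if "n = k * (k + 1)" for k
    proof (rule ccontr)
      assume "\<not> k \<le> 3"
      then have "4 * 5 \<le> k * (k + 1)" by (intro mult_mono) auto
      with \<open>n < 9\<close> that show False by simp
    qed
    then show ?thesis by auto
  qed
  have pronic: "pronic_theta $ n = (if \<exists>k\<in>{0..3}. n = k * (k + 1) then 1 else 0)" if "n < 9" for n
    unfolding pronic_theta_def fps_nth_Abs_fps pr_iff[OF that] ..
  have set3: "{0..3::nat} = {0, 1, 2, 3}" by auto
  have p1: "starts square_theta 1 2 0 0 2 0 0 0 0"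
    unfolding starts_def square_theta_def fps_nth_Abs_fps by (simp add: sq_iff set3)
  then have m1: "starts square_theta_alt 1 (-2) 0 0 2 0 0 0 0"
    by (simp add: starts_def square_theta_alt_def)
  have x1: "starts pronic_theta 1 0 1 0 0 0 1 0 0"
    using pronic by (simp add: starts_def set3)
  note p2 = starts_mult[OF p1 p1, simplified]
  note p4 = starts_mult[OF p2 p2, simplified]
  note p8 = starts_mult[OF p4 p4, simplified, folded pow8]
  note m2 = starts_mult[OF m1 m1, simplified]
  note m4 = starts_mult[OF m2 m2, simplified]
  note m8 = starts_mult[OF m4 m4, simplified, folded pow8]
  note x2 = starts_mult[OF x1 x1, simplified]
  note x4 = starts_mult[OF x2 x2, simplified]
  note x8 = starts_mult[OF x4 x4, simplified, folded pow8]
  have X: "starts (fps_X\<^sup>2) 0 0 1 0 0 0 0 0 0" by (simp add: starts_def fps_X_power_iff)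
  note a = starts_mult[OF X x8, simplified]
  have E: "starts eisenstein4 1 0 240 0 2160 0 6720 0 17520"
    unfolding eisenstein4_def
    using starts_cmult[OF starts_add[OF starts_add[OF starts_cmult[OF a] p8] m8], of "1 / 2" 256] by simp
  have "starts (eisenstein4 ^ 3) 1 0 720 0 179280 0 16954560 0 396974160"
    using starts_mult[OF starts_mult[OF E E] E] by (simp add: power3_eq_cube)
  from starts_diff[OF this starts_cmult[OF starts_mult[OF starts_mult[OF a p8] m8], of 720]]
  show ?thesis unfolding comparison_form_def by simp
qed

lemma
  fixes f g :: "real fps"
  assumes "fps_conv_radius f \<ge> 1"
  shows conv_radius_1_mult: "fps_conv_radius g \<ge> 1 \<Longrightarrow> fps_conv_radius (f * g) \<ge> 1"
    and conv_radius_1_add: "fps_conv_radius g \<ge> 1 \<Longrightarrow> fps_conv_radius (f + g) \<ge> 1"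
    and conv_radius_1_diff: "fps_conv_radius g \<ge> 1 \<Longrightarrow> fps_conv_radius (f - g) \<ge> 1"
    and conv_radius_1_power: "fps_conv_radius (f ^ n) \<ge> 1"
  using assms fps_conv_radius_mult[of f g] fps_conv_radius_add[of f g] fps_conv_radius_diff[of f g]
    fps_conv_radius_power[of f n]
  by (auto simp: min_def split: if_splits intro: order_trans)

lemmas conv_radius_1_intros =
  conv_radius_1_mult conv_radius_1_add conv_radius_1_diff conv_radius_1_power radius_thetas

lemma radius_comparison_form: "fps_conv_radius comparison_form \<ge> 1"
  unfolding comparison_form_def eisenstein4_def
  by (intro conv_radius_1_intros) simp_all

lemma eval_comparison_form:
  fixes r :: real
  assumes "\<bar>r\<bar> < 1"
  shows "eval_fps comparison_form r =
    ((256 * (r\<^sup>2 * eval_fps pronic_theta r ^ 8) + eval_fps square_theta r ^ 8 + eval_fps square_theta (- r) ^ 8) / 2) ^ 3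
    - 720 * (r\<^sup>2 * eval_fps pronic_theta r ^ 8 * eval_fps square_theta r ^ 8 * eval_fps square_theta (- r) ^ 8)"
proof -
  have rad: "ereal (norm r) < fps_conv_radius f" if "fps_conv_radius f \<ge> 1" for f :: "real fps"
  proof -
    have "ereal (norm r) < 1" using assms by (simp add: one_ereal_def)
    then show ?thesis using that by (rule less_le_trans)
  qed
  have ev: "eval_fps (f * g) r = eval_fps f r * eval_fps g r"
    "eval_fps (f + g) r = eval_fps f r + eval_fps g r"
    "eval_fps (f - g) r = eval_fps f r - eval_fps g r"
    if "fps_conv_radius f \<ge> 1" "fps_conv_radius g \<ge> 1" for f g
    using that by (auto intro!: eval_fps_mult eval_fps_add eval_fps_diff rad)
  have evp: "eval_fps (f ^ n) r = eval_fps f r ^ n" if "fps_conv_radius f \<ge> 1" for f n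
    using that by (intro eval_fps_power rad)
  have radX: "fps_conv_radius (fps_X ^ n :: real fps) \<ge> 1" "fps_conv_radius (fps_const c :: real fps) \<ge> 1" for n c
    by simp_all
  have evX: "eval_fps (fps_X ^ n) r = r ^ n" "eval_fps (fps_const c) r = c" for n c
    by simp_all
  show ?thesis
    unfolding comparison_form_def eisenstein4_def
    by (simp only: ev evp evX conv_radius_1_intros radX eval_square_theta_alt) simp
qed

text \<open>
  Replacing \<open>p\<close> by \<open>-p\<close> exchanges \<open>\<theta>\<^sub>3\<close> and \<open>\<theta>\<^sub>4\<close> and fixes \<open>\<theta>\<^sub>2\<^sup>8\<close>, so that only even powers of
  \<open>p\<close>, hence integral powers of \<open>q = p\<^sup>2\<close>, occur.
\<close>

lemma comparison_form_odd: "odd n \<Longrightarrow> comparison_form $ n = 0"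
proof -
  assume n: "odd n"
  define M :: "real fps" where "M = fps_const (- 1) * fps_X"
  have flip: "(f oo M) $ n = (- 1) ^ n * f $ n" for f n unfolding M_def by (rule fps_nth_compose_linear)
  have m0: "M $ 0 = 0" by (simp add: M_def)
  have 1: "square_theta oo M = square_theta_alt"
    by (simp add: fps_eq_iff flip square_theta_alt_def del: fps_const_neg)
  have 2: "square_theta_alt oo M = square_theta"
    by (simp add: fps_eq_iff flip square_theta_alt_def del: fps_const_neg flip: mult.assoc power_mult_distrib)
  have 3: "pronic_theta oo M = pronic_theta"
    by (auto simp: fps_eq_iff flip pronic_theta_def simp del: fps_const_neg)
  have "fps_X\<^sup>2 oo M = fps_X\<^sup>2"
    by (simp add: fps_eq_iff flip fps_X_power_iff del: fps_const_neg)
  then have 4: "(fps_X oo M)\<^sup>2 = fps_X\<^sup>2" by (simp only: fps_compose_power[OF m0])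
  have "comparison_form oo M = comparison_form"
    unfolding comparison_form_def eisenstein4_def
    by (simp only: fps_compose_mult_distrib[OF m0] fps_compose_power[OF m0, symmetric] fps_compose_add_distrib
        fps_compose_sub_distrib fps_const_compose 1 2 3 4)
       (simp only: mult_ac add_ac)
  then have "(- 1) ^ n * comparison_form $ n = comparison_form $ n" using flip[of comparison_form n] by simp
  then show ?thesis using n by simp
qed

lemma comparison_form_sums:
  fixes t :: real
  assumes t: "t > 0"
  shows "(\<lambda>n. comparison_form $ (2 * n) * exp (- 2 * pi * t) ^ n) sums eval_fps comparison_form (exp (- pi * t))"
proof -
  let ?r = "exp (- pi * t)"
  have r: "?r < 1" using t by simp
  then have "ereal (norm ?r) < 1" by (simp add: one_ereal_def)
  then have "(\<lambda>n. comparison_form $ n * ?r ^ n) sums eval_fps comparison_form ?r"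
    by (intro sums_eval_fps less_le_trans[OF _ radius_comparison_form])
  moreover have "strict_mono (\<lambda>n::nat. 2 * n)" by (intro strict_monoI) simp
  moreover have "comparison_form $ n * ?r ^ n = 0" if "n \<notin> range (\<lambda>n. 2 * n)" for n
  proof -
    have "odd n" using that by auto
    then show ?thesis by (simp add: comparison_form_odd)
  qed
  ultimately have "(\<lambda>n. comparison_form $ (2 * n) * ?r ^ (2 * n)) sums eval_fps comparison_form ?r"
    by (subst sums_mono_reindex)
  moreover have "?r ^ (2 * n) = exp (- 2 * pi * t) ^ n" for n
    by (simp add: power_mult flip: exp_of_nat_mult)
  ultimately show ?thesis by simp
qed

text \<open>
  Inversion multiplies the theta constants by \<open>\<surd>t\<close>, fixes \<open>\<theta>\<^sub>3\<close> and exchanges \<open>\<theta>\<^sub>2\<close> and \<open>\<theta>\<^sub>4\<close>.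
\<close>

lemma comparison_form_inversion:
  fixes t :: real
  assumes t: "t > 0"
  shows "eval_fps comparison_form (exp (- pi / t)) = t ^ 12 * eval_fps comparison_form (exp (- pi * t))"
proof -
  define \<psi> where "\<psi> = (\<lambda>t. eval_fps square_theta (exp (- pi * t)))"
  define th2 where "th2 = (\<lambda>t. \<psi> (t / 4) - \<psi> t)"
  define th4 where "th4 = (\<lambda>t. eval_fps square_theta (- exp (- pi * t)))"
  have inv: "\<psi> (1 / t) = sqrt t * \<psi> t" if "t > 0" for t
    using square_theta_inversion[OF that] by (simp add: \<psi>_def)
  have eval: "eval_fps comparison_form (exp (- pi * t)) =
      ((th2 t ^ 8 + \<psi> t ^ 8 + th4 t ^ 8) / 2) ^ 3 - 720 / 256 * (th2 t ^ 8 * \<psi> t ^ 8 * th4 t ^ 8)" if "t > 0" for t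
  proof -
    let ?s = "exp (- pi * (t / 4))"
    have s: "\<bar>?s\<bar> < 1" using that by simp
    have s4: "?s ^ 4 = exp (- pi * t)" by (simp flip: exp_of_nat_mult)
    have s8: "?s ^ 8 = exp (- pi * t) ^ 2" by (simp flip: exp_of_nat_mult)
    have "th2 t = 2 * ?s * eval_fps pronic_theta (exp (- pi * t))"
      using eval_square_theta_split[OF s] unfolding s4 by (simp add: th2_def \<psi>_def)
    then have "th2 t ^ 8 = 256 * (exp (- pi * t) ^ 2 * eval_fps pronic_theta (exp (- pi * t)) ^ 8)"
      unfolding s8[symmetric] by (simp only: power_mult_distrib) simp
    then have "exp (- pi * t) ^ 2 * eval_fps pronic_theta (exp (- pi * t)) ^ 8 = th2 t ^ 8 / 256" by simp
    moreover have "\<bar>exp (- pi * t)\<bar> < 1" using that by simp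
    ultimately show ?thesis by (subst eval_comparison_form) (simp_all only: \<psi>_def th4_def, simp)
  qed
  have th4: "th4 t = 2 * \<psi> (4 * t) - \<psi> t" if "t > 0" for t
  proof -
    let ?p = "exp (- pi * t)"
    have p: "\<bar>?p\<bar> < 1" "\<bar>- ?p\<bar> < 1" using that by simp_all
    have p4: "?p ^ 4 = exp (- pi * (4 * t))" "(- ?p) ^ 4 = exp (- pi * (4 * t))" by (simp_all flip: exp_of_nat_mult)
    show ?thesis
      using eval_square_theta_split[OF p(1)] eval_square_theta_split[OF p(2)] unfolding p4 by (simp add: th4_def \<psi>_def)
  qed
  have th2_inv: "th2 (1 / t) = sqrt t * th4 t" if "t > 0" for t
    using inv[of "4 * t"] inv[of t] that unfolding th2_def th4[OF that] by (simp add: real_sqrt_mult algebra_simps)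
  have th4_inv: "th4 (1 / t) = sqrt t * th2 t" if "t > 0" for t
    using th2_inv[of "1 / t"] that by (simp add: real_sqrt_divide)
  have st: "sqrt t ^ 8 = t ^ 4"
  proof -
    have "sqrt t ^ 8 = (sqrt t ^ 2) ^ 4" by (simp flip: power_mult)
    then show ?thesis using t by simp
  qed
  have "eval_fps comparison_form (exp (- pi * (1 / t))) =
    ((t ^ 4 * th4 t ^ 8 + t ^ 4 * \<psi> t ^ 8 + t ^ 4 * th2 t ^ 8) / 2) ^ 3
     - 720 / 256 * ((t ^ 4 * th4 t ^ 8) * (t ^ 4 * \<psi> t ^ 8) * (t ^ 4 * th2 t ^ 8))"
    using t by (subst eval) (simp_all only: th2_inv[OF t] th4_inv[OF t] inv[OF t] power_mult_distrib st zero_less_divide_1_iff)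
  also have "\<dots> = t ^ 12 * eval_fps comparison_form (exp (- pi * t))"
    unfolding eval[OF t] by (simp add: algebra_simps power3_eq_cube add_divide_distrib flip: power_add)
  finally show ?thesis by simp
qed

no_notation fps_nth (infixl "$" 75)
notation vec_nth (infixl "$" 90)

section \<open>Delone subdivisions and shortest vectors modulo 2L\<close>

lemma finite_int_vectors_ball: "finite {n \<in> int_vectors. norm (n :: real^'n) \<le> R}"
proof (rule finite_subset)
  show "{n \<in> int_vectors. norm (n :: real^'n) \<le> R} \<subseteq> vec_of_ints ` (PiE UNIV (\<lambda>_. {- \<lceil>R\<rceil>..\<lceil>R\<rceil>}))"
  proof
    fix n :: "real^'n" assume "n \<in> {n \<in> int_vectors. norm n \<le> R}"
    then have n: "n \<in> int_vectors" "norm n \<le> R" by auto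
    obtain f where f: "n = vec_of_ints f" using n(1) bij_vec_of_ints by (auto simp: bij_betw_def)
    have "f i \<in> {- \<lceil>R\<rceil>..\<lceil>R\<rceil>}" for i
    proof -
      have "\<bar>of_int (f i)\<bar> \<le> R" using component_le_norm_cart[of n i] n(2) by (simp add: f vec_of_ints_def)
      then show ?thesis by (simp add: abs_le_iff) linarith
    qed
    then show "n \<in> vec_of_ints ` (PiE UNIV (\<lambda>_. {- \<lceil>R\<rceil>..\<lceil>R\<rceil>}))" by (auto simp: f)
  qed
  show "finite (vec_of_ints ` (PiE (UNIV :: 'n set) (\<lambda>_. {- \<lceil>R\<rceil>..\<lceil>R\<rceil>})))"
    by (intro finite_imageI finite_PiE) auto
qed

lemma symmetric_form_commute:
  fixes Q :: "real^'n^'n"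
  assumes "transpose Q = Q"
  shows "x \<bullet> (Q *v y) = y \<bullet> (Q *v x)"
proof -
  have "x \<bullet> (Q *v y) = (transpose Q *v x) \<bullet> y" by (simp add: dot_lmul_matrix)
  then show ?thesis using assms by (simp add: inner_commute)
qed

lemma qform_diff:
  assumes "transpose Q = Q"
  shows "qform Q (x - y) = qform Q x - 2 * (x \<bullet> (Q *v y)) + qform Q y"
  unfolding qform_def using symmetric_form_commute[OF assms, of y x]
  by (simp add: matrix_vector_mult_diff_distrib inner_diff_left inner_diff_right)

lemma qform_scaleR: "qform Q (c *\<^sub>R x) = c\<^sup>2 * qform Q x"
  by (simp add: qform_def matrix_vector_mult_scaleR power2_eq_square)

lemma qform_nonneg: "is_PQF Q \<Longrightarrow> qform Q x \<ge> 0"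
  by (cases "x = 0") (auto simp: is_PQF_def qform_def less_imp_le)

lemma qform_convex_combination:
  assumes "transpose Q = Q"
  shows "qform Q (u *\<^sub>R a + (1 - u) *\<^sub>R b) =
    u * qform Q a + (1 - u) * qform Q b - u * (1 - u) * qform Q (a - b)"
proof -
  have "u *\<^sub>R a + (1 - u) *\<^sub>R b = u *\<^sub>R a - (u - 1) *\<^sub>R b" by (simp add: algebra_simps)
  then show ?thesis
    by (simp only: qform_diff[OF assms] qform_scaleR matrix_vector_mult_scaleR inner_scaleR_left inner_scaleR_right)
       (simp add: power2_eq_square algebra_simps)
qed

lemma convex_ellipsoid:
  assumes Q: "is_PQF Q"
  shows "convex {x. qform Q (x - c) \<le> s}"
proof (rule convexI)
  fix x y and u v :: real
  assume xy: "x \<in> {x. qform Q (x - c) \<le> s}" "y \<in> {x. qform Q (x - c) \<le> s}" and uv: "0 \<le> u" "0 \<le> v" "u + v = 1"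
  have t: "transpose Q = Q" using Q by (simp add: is_PQF_def)
  have v: "v = 1 - u" using uv by simp
  have "u *\<^sub>R x + v *\<^sub>R y - c = u *\<^sub>R (x - c) + (1 - u) *\<^sub>R (y - c)"
    unfolding v by (simp add: algebra_simps)
  then have "qform Q (u *\<^sub>R x + v *\<^sub>R y - c) = u * qform Q (x - c) + v * qform Q (y - c) - u * v * qform Q ((x - c) - (y - c))"
    by (simp only: qform_convex_combination[OF t] v)
  moreover have "0 \<le> u * v * qform Q ((x - c) - (y - c))" using uv qform_nonneg[OF Q] by simp
  moreover have "u * qform Q (x - c) \<le> u * s" "v * qform Q (y - c) \<le> v * s"
    using xy uv by (auto intro: mult_left_mono)
  moreover have "u * s + v * s = s" using uv(3) by (metis distrib_right mult_1)
  ultimately show "u *\<^sub>R x + v *\<^sub>R y \<in> {x. qform Q (x - c) \<le> s}" by simp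
qed

text \<open>
  The solid ellipsoid with \<open>V\<close> on its boundary is convex and contains no further integral vector.
  Hence a Delone polytope determines its vertex set, even if the ellipsoid is not unique.
\<close>

lemma Delone_vertices:
  assumes Q: "is_PQF Q" and V: "V \<subseteq> int_vectors" "\<forall>v\<in>V. qform Q (v - c) = r\<^sup>2"
    "\<forall>v\<in>int_vectors - V. qform Q (v - c) > r\<^sup>2"
  shows "int_vectors \<inter> convex hull V = V"
proof -
  have "convex hull V \<subseteq> {x. qform Q (x - c) \<le> r\<^sup>2}"
    using V(2) by (intro hull_minimal convex_ellipsoid[OF Q]) auto
  then show ?thesis using V(1,3) hull_subset[of V convex] by force
qed

text \<open>
  The vertices of the Delone polytope around \<open>z/2\<close> correspond to the shortest vectors \<open>z - 2v\<close> of the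
  class of \<open>z\<close>. The polytope is Delone for \<open>Q'\<close> as well, with an unknown centre; the centre cancels from
  the equations of the vertices \<open>0, z, w, z - w\<close>, which leaves \<open>Q'[w] + Q'[z - w] = Q'[z]\<close>.
\<close>

theorem same_Delone_minimal_vectors:
  fixes Q Q' :: "real^'n^'n"
  assumes Q: "is_PQF Q" and Q': "is_PQF Q'" and Del: "Del Q' = Del Q"
    and z: "z \<in> int_vectors" and w: "w \<in> int_vectors"
    and minimal: "\<And>v. v \<in> int_vectors \<Longrightarrow> qform Q (z - 2 *\<^sub>R v) \<ge> qform Q z"
    and fin: "finite {v \<in> int_vectors. qform Q (z - 2 *\<^sub>R v) = qform Q z}"
    and eq: "qform Q (z - 2 *\<^sub>R w) = qform Q z"
  shows "qform Q' (z - 2 *\<^sub>R w) = qform Q' z"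
proof -
  define V where "V = {v \<in> int_vectors. qform Q (z - 2 *\<^sub>R v) = qform Q z}"
  define c where "c = (1 / 2) *\<^sub>R z"
  define r where "r = sqrt (qform Q z / 4)"
  have r2: "r\<^sup>2 = qform Q z / 4" unfolding r_def using qform_nonneg[OF Q] by simp
  have qc: "qform Q (v - c) = qform Q (z - 2 *\<^sub>R v) / 4" for v
  proof -
    have "v - c = (- 1 / 2) *\<^sub>R (z - 2 *\<^sub>R v)" by (simp add: c_def algebra_simps)
    then show ?thesis by (simp only: qform_scaleR) (simp add: power2_eq_square)
  qed
  have V1: "V \<subseteq> int_vectors" "\<forall>v\<in>V. qform Q (v - c) = r\<^sup>2"
    by (auto simp: V_def qc r2)
  have V2: "\<forall>v\<in>int_vectors - V. qform Q (v - c) > r\<^sup>2"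
  proof
    fix v assume "v \<in> int_vectors - V"
    then have "qform Q z \<noteq> qform Q (z - 2 *\<^sub>R v)" "qform Q z \<le> qform Q (z - 2 *\<^sub>R v)"
      using minimal[of v] by (auto simp: V_def)
    then show "qform Q (v - c) > r\<^sup>2" unfolding qc r2 by simp
  qed
  have "z - 2 *\<^sub>R z = (- 1) *\<^sub>R z" by (simp add: vec_eq_iff)
  then have qz: "qform Q (z - 2 *\<^sub>R z) = qform Q z" by (simp only: qform_scaleR) simp
  have inV: "0 \<in> V" "z \<in> V" "w \<in> V"
    unfolding V_def using z w eq qz by simp_all
  have zw: "z - w \<in> V"
  proof -
    have "z - 2 *\<^sub>R (z - w) = (- 1) *\<^sub>R (z - 2 *\<^sub>R w)" by (simp add: vec_eq_iff)
    then have "qform Q (z - 2 *\<^sub>R (z - w)) = qform Q (z - 2 *\<^sub>R w)" by (simp only: qform_scaleR) simp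
    then show ?thesis unfolding V_def using int_vectors_diff[OF z w] eq by simp
  qed
  have "convex hull V \<in> Del Q"
    unfolding Del_def is_Delone_polytope_def mem_Collect_eq
  proof (intro exI[of _ V] exI[of _ c] exI[of _ r] conjI)
    show "finite V" using fin unfolding V_def .
    show "V \<noteq> {}" using inV(1) by blast
  qed (rule V1 V2 refl)+
  then have "convex hull V \<in> Del Q'" by (simp add: Del)
  then obtain V' c' r' where V': "V' \<subseteq> int_vectors" "convex hull V = convex hull V'"
    "\<forall>v\<in>V'. qform Q' (v - c') = r'\<^sup>2" "\<forall>v\<in>int_vectors - V'. qform Q' (v - c') > r'\<^sup>2"
    unfolding Del_def is_Delone_polytope_def by blast
  have "V = int_vectors \<inter> convex hull V'"
    using Delone_vertices[OF Q V1 V2] unfolding V'(2) by (rule sym)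
  also have "\<dots> = V'" by (rule Delone_vertices[OF Q' V'(1,3,4)])
  finally have "V = V'" .
  have t: "transpose Q' = Q'" using Q' by (simp add: is_PQF_def)
  have q: "qform Q' v - 2 * (v \<bullet> (Q' *v c')) + qform Q' c' = r'\<^sup>2" if "v \<in> V" for v
  proof -
    have "qform Q' (v - c') = r'\<^sup>2" using V'(3) that unfolding \<open>V = V'\<close> by (rule bspec)
    then show ?thesis unfolding qform_diff[OF t, of v c'] .
  qed
  have z0: "0 \<bullet> (Q' *v c') = 0" "qform Q' 0 = 0" by (simp_all add: qform_def)
  have "qform Q' w + qform Q' (z - w) = qform Q' z"
    using q[OF inV(1)] q[OF inV(2)] q[OF inV(3)] q[OF zw] unfolding inner_diff_left z0 by argo
  then have "qform Q' w = z \<bullet> (Q' *v w)" unfolding qform_diff[OF t, of z w] by argo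
  moreover have "qform Q' (z - 2 *\<^sub>R w) = qform Q' z - 4 * (z \<bullet> (Q' *v w)) + 4 * qform Q' w"
    unfolding qform_diff[OF t, of z "2 *\<^sub>R w"] qform_scaleR matrix_vector_mult_scaleR inner_scaleR_right
    by (simp only: power2_eq_square)
  ultimately show ?thesis by argo
qed

lemma qform_gram: "qform (transpose A ** A) x = (norm (A *v x))\<^sup>2" for A :: "real^'n^'n"
proof -
  have "x \<bullet> ((transpose A ** A) *v x) = (A *v x) \<bullet> (A *v x)"
    by (metis dot_lmul_matrix inner_commute matrix_vector_mul_assoc transpose_matrix_vector)
  then show ?thesis by (simp add: qform_def power2_norm_eq_inner)
qed

lemma is_PQF_gram: "invertible A \<Longrightarrow> is_PQF (transpose A ** A)" for A :: "real^'n^'n"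
proof -
  assume A: "invertible A"
  have "A *v x \<noteq> 0" if "x \<noteq> 0" for x using inj_matrix_vector_mult[OF A] that by (metis injD matrix_vector_mult_0_right)
  then show ?thesis
    unfolding is_PQF_def qform_gram by (auto simp: matrix_transpose_mul)
qed

locale lattice_with_basis =
  fixes A :: "real^'n^'n" and L :: "(real^'n) set"
  assumes invertible: "invertible A" and L_eq: "L = (*v) A ` int_vectors"
begin

lemma A_inv [simp]: "A *v (matrix_inv A *v x) = x" "matrix_inv A *v (A *v x) = x"
  using invertible by (simp_all add: matrix_vector_mul_assoc matrix_inv_left matrix_inv_right)

lemma coords: "x \<in> L \<longleftrightarrow> matrix_inv A *v x \<in> int_vectors"
  unfolding L_eq by (auto simp: image_iff) (metis A_inv(1))

lemma L_add [intro]: "x \<in> L \<Longrightarrow> y \<in> L \<Longrightarrow> x + y \<in> L"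
  and L_diff [intro]: "x \<in> L \<Longrightarrow> y \<in> L \<Longrightarrow> x - y \<in> L"
  and L_0 [simp]: "0 \<in> L"
  by (auto simp: coords matrix_vector_right_distrib matrix_vector_mult_diff_distrib)

lemma L_uminus [intro]: "x \<in> L \<Longrightarrow> - x \<in> L"
  using L_diff[of 0 x] by simp

lemma half_sum_in_L:
  assumes "(1 / 2) *\<^sub>R (x - y) \<in> L" "y \<in> L"
  shows "(1 / 2) *\<^sub>R (x + y) \<in> L"
proof -
  have "(1 / 2) *\<^sub>R (x - y) + y \<in> L" using assms by (rule L_add)
  moreover have "(1 / 2) *\<^sub>R (x - y) + y = (1 / 2) *\<^sub>R (x + y)" by (simp add: algebra_simps flip: scaleR_add_left)
  ultimately show ?thesis by simp
qed

text \<open>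
  Both \<open>(x - y)/2\<close> and \<open>(x + y)/2\<close> are nonzero lattice vectors; apply the parallelogram law.
\<close>

lemma norm_congruent_ge:
  assumes min: "\<And>x. x \<in> L \<Longrightarrow> x \<noteq> 0 \<Longrightarrow> (norm x)\<^sup>2 \<ge> m"
    and xy: "y \<in> L" "(1 / 2) *\<^sub>R (x - y) \<in> L" "x \<noteq> y" "x \<noteq> - y"
  shows "(norm x)\<^sup>2 + (norm y)\<^sup>2 \<ge> 4 * m"
    and "(norm x)\<^sup>2 + (norm y)\<^sup>2 = 4 * m \<Longrightarrow> (norm x)\<^sup>2 = (norm y)\<^sup>2 \<Longrightarrow> x \<bullet> y = 0"
proof -
  have a: "(norm ((1 / 2) *\<^sub>R (x - y)))\<^sup>2 \<ge> m" by (rule min[OF xy(2)]) (use xy in simp)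
  have b: "(norm ((1 / 2) *\<^sub>R (x + y)))\<^sup>2 \<ge> m"
    by (rule min[OF half_sum_in_L[OF xy(2,1)]]) (use xy in \<open>simp add: eq_neg_iff_add_eq_0\<close>)
  have a': "x \<bullet> x - 2 * (x \<bullet> y) + y \<bullet> y \<ge> 4 * m" and b': "x \<bullet> x + 2 * (x \<bullet> y) + y \<bullet> y \<ge> 4 * m"
    using a b unfolding power2_norm_eq_inner
    by (simp_all add: inner_add_left inner_add_right inner_diff_left inner_diff_right inner_commute[of y x])
      (simp_all add: field_simps)
  then show "(norm x)\<^sup>2 + (norm y)\<^sup>2 \<ge> 4 * m" unfolding power2_norm_eq_inner by linarith
  show "(norm x)\<^sup>2 + (norm y)\<^sup>2 = 4 * m \<Longrightarrow> (norm x)\<^sup>2 = (norm y)\<^sup>2 \<Longrightarrow> x \<bullet> y = 0"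
    using a' b' unfolding power2_norm_eq_inner by linarith
qed

lemma same_Delone_congruent_vectors:
  assumes Q': "is_PQF Q'" and Del: "Del Q' = Del (transpose A ** A)"
    and min: "\<And>x. x \<in> L \<Longrightarrow> x \<noteq> 0 \<Longrightarrow> (norm x)\<^sup>2 \<ge> m"
    and x: "x \<in> L" "(norm x)\<^sup>2 = 2 * m" and y: "y \<in> L" "(norm y)\<^sup>2 = 2 * m"
    and xy: "(1 / 2) *\<^sub>R (x - y) \<in> L"
  shows "qform Q' (matrix_inv A *v y) = qform Q' (matrix_inv A *v x)"
proof -
  let ?Q = "transpose A ** A"
  define z where "z = matrix_inv A *v x"
  define w where "w = matrix_inv A *v ((1 / 2) *\<^sub>R (x - y))"
  have zw: "z \<in> int_vectors" "w \<in> int_vectors" using x xy by (auto simp: z_def w_def coords)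
  have zw2: "z - 2 *\<^sub>R w = matrix_inv A *v y"
    by (simp add: z_def w_def matrix_vector_mult_scaleR matrix_vector_mult_diff_distrib)
  have Av: "A *v (z - 2 *\<^sub>R v) = x - 2 *\<^sub>R (A *v v)" for v
    by (simp add: z_def matrix_vector_mult_scaleR matrix_vector_mult_diff_distrib)
  have "qform Q' (z - 2 *\<^sub>R w) = qform Q' z"
  proof (rule same_Delone_minimal_vectors[OF is_PQF_gram[OF invertible] Q' Del zw])
    show "qform ?Q z \<le> qform ?Q (z - 2 *\<^sub>R v)" if "v \<in> int_vectors" for v
    proof -
      have v: "A *v v \<in> L" using that by (simp add: L_eq)
      define y' where "y' = x - 2 *\<^sub>R (A *v v)"
      have y'L: "y' \<in> L" using L_diff[OF L_diff[OF x(1) v] v] by (simp add: y'_def scaleR_2)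
      have "(norm x)\<^sup>2 \<le> (norm y')\<^sup>2"
      proof (cases "x = y' \<or> x = - y'")
        case False
        have "(norm x)\<^sup>2 + (norm y')\<^sup>2 \<ge> 4 * m"
          by (rule norm_congruent_ge(1)[OF min y'L]) (use False v in \<open>auto simp: y'_def\<close>)
        then show ?thesis using x(2) by simp
      qed (metis norm_minus_cancel order_refl)
      then show ?thesis unfolding qform_gram Av by (simp add: z_def y'_def)
    qed
    show "qform ?Q (z - 2 *\<^sub>R w) = qform ?Q z" unfolding qform_gram zw2 using x y by (simp add: z_def)
    obtain k where k: "k > 0" "\<And>y. k * norm y \<le> norm (A *v y)" using invertible_bounded_below[OF invertible] by blast
    have "{v \<in> int_vectors. qform ?Q (z - 2 *\<^sub>R v) = qform ?Q z} \<subseteq> {v \<in> int_vectors. norm v \<le> norm x / k}"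
    proof safe
      fix v assume "qform ?Q (z - 2 *\<^sub>R v) = qform ?Q z"
      then have "norm (x - 2 *\<^sub>R (A *v v)) = norm x" unfolding qform_gram Av by (simp add: z_def)
      then have "norm (2 *\<^sub>R (A *v v)) \<le> 2 * norm x"
        using norm_triangle_sub[of "2 *\<^sub>R (A *v v)" x] by (simp add: norm_minus_commute)
      then have "k * norm v \<le> norm x" using k(2)[of v] by simp
      then show "norm v \<le> norm x / k" using k(1) by (simp add: field_simps)
    qed
    then show "finite {v \<in> int_vectors. qform ?Q (z - 2 *\<^sub>R v) = qform ?Q z}"
      by (rule finite_subset) (rule finite_int_vectors_ball)
  qed
  then show ?thesis unfolding zw2 by (simp add: z_def)
qed

end

section \<open>Rigidity from an orthogonal frame\<close>

lemma obtain_two_more: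
  fixes i j :: "'n::finite"
  assumes "CARD('n) \<ge> 4" "i \<noteq> j"
  obtains k l where "k \<noteq> i" "k \<noteq> j" "l \<noteq> i" "l \<noteq> j" "k \<noteq> l"
proof -
  have "card {i, j} = 2" using assms(2) by simp
  then have "card (UNIV - {i, j}) \<ge> 2" using assms(1) by (simp add: card_Diff_subset)
  then obtain T where "T \<subseteq> UNIV - {i, j}" "card T = 2" by (rule obtain_subset_with_card_n)
  then obtain k l where "{k, l} \<subseteq> UNIV - {i, j}" "k \<noteq> l" by (auto simp: card_2_iff)
  then show thesis using that by auto
qed

lemma orthogonal_family_span:
  fixes e :: "'n \<Rightarrow> real^'n"
  assumes "\<And>i. e i \<noteq> 0" "\<And>i j. i \<noteq> j \<Longrightarrow> e i \<bullet> e j = 0"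
  shows "span (range e) = UNIV"
proof -
  have inj: "inj e" using assms by (metis injI inner_eq_zero_iff)
  have "pairwise orthogonal (range e)"
    using assms(2) by (auto simp: pairwise_def orthogonal_def) metis
  then have "independent (range e)"
    using assms(1) by (intro pairwise_orthogonal_independent) (auto simp: image_iff)
  moreover have "card (range e) = DIM(real^'n)" using inj by (simp add: card_image)
  ultimately have "UNIV \<subseteq> span (range e)"
    by (intro card_ge_dim_independent) auto
  then show ?thesis by auto
qed

lemma quadratic_form_combination:
  fixes b :: "'a::real_vector \<Rightarrow> 'a \<Rightarrow> real"
  assumes "bilinear b" and sym: "\<And>x y. b x y = b y x"
  shows "b ((1/2) *\<^sub>R (s *\<^sub>R x + t *\<^sub>R y + u *\<^sub>R z + v *\<^sub>R w)) ((1/2) *\<^sub>R (s *\<^sub>R x + t *\<^sub>R y + u *\<^sub>R z + v *\<^sub>R w))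
    = (s * s * b x x + t * t * b y y + u * u * b z z + v * v * b w w
       + 2 * (s * t * b x y + s * u * b x z + s * v * b x w + t * u * b y z + t * v * b y w + u * v * b z w)) / 4"
  using sym[of y x] sym[of z x] sym[of w x] sym[of z y] sym[of w y] sym[of w z]
  by (simp only: bilinear_ladd[OF assms(1)] bilinear_radd[OF assms(1)] bilinear_lmul[OF assms(1)] bilinear_rmul[OF assms(1)])
     (simp add: algebra_simps)

context lattice_with_basis
begin

text \<open>
  With \<open>b\<close> the bilinear form of \<open>Q'\<close> on the ambient space and \<open>i, j, k, l\<close> distinct, comparing
  \<open>(e\<^sub>i + e\<^sub>j + e\<^sub>k + e\<^sub>l)/2\<close> with the vectors obtained by two sign changes gives that the three pair sums
  \<open>b\<^sub>i\<^sub>j + b\<^sub>k\<^sub>l\<close>, \<open>b\<^sub>i\<^sub>k + b\<^sub>j\<^sub>l\<close>, \<open>b\<^sub>i\<^sub>l + b\<^sub>j\<^sub>k\<close> vanish. Starting from \<open>(e\<^sub>i + e\<^sub>j + e\<^sub>k - e\<^sub>l)/2\<close> gives the same for the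
  differences, hence \<open>b\<^sub>i\<^sub>j = 0\<close>.
\<close>

theorem rigid_of_frame:
  fixes e :: "'n \<Rightarrow> real^'n"
  assumes card: "CARD('n) \<ge> 4" and m: "m > 0"
    and min: "\<And>x. x \<in> L \<Longrightarrow> x \<noteq> 0 \<Longrightarrow> (norm x)\<^sup>2 \<ge> m"
    and frame: "\<And>i. e i \<in> L" "\<And>i. (norm (e i))\<^sup>2 = 2 * m"
    and orth: "\<And>i j. i \<noteq> j \<Longrightarrow> e i \<bullet> e j = 0"
    and congruent: "\<And>i j. (1/2) *\<^sub>R (e i - e j) \<in> L"
  shows "rigid_lattice L"
proof -
  let ?Q = "transpose A ** A"
  have "\<exists>c>0. Q' = c *\<^sub>R ?Q" if Q': "is_PQF Q'" and Del: "Del Q' = Del ?Q" for Q'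
  proof -
    define b where "b = (\<lambda>x y. (matrix_inv A *v x) \<bullet> (Q' *v (matrix_inv A *v y)))"
    have t: "transpose Q' = Q'" using Q' by (simp add: is_PQF_def)
    have bil: "bilinear b"
      unfolding b_def bilinear_def
      by (auto intro!: linearI simp: matrix_vector_right_distrib matrix_vector_mult_scaleR inner_add_left inner_add_right)
    have sym: "b x y = b y x" for x y unfolding b_def by (rule symmetric_form_commute[OF t])
    have const: "b x x = b y y" if "x \<in> L" "(norm x)\<^sup>2 = 2 * m" "y \<in> L" "(norm y)\<^sup>2 = 2 * m" "(1/2) *\<^sub>R (x - y) \<in> L" for x y
      using same_Delone_congruent_vectors[OF Q' Del min that] by (simp add: b_def qform_def)
    have ee: "e i \<bullet> e i = 2 * m" for i using frame(2)[of i] by (simp add: power2_norm_eq_inner)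
    have pm: "(1/2) *\<^sub>R (s *\<^sub>R e i + t *\<^sub>R e j) \<in> L" if "s \<in> {1, -1}" "t \<in> {1, -1}" for s t i j
    proof -
      have p: "(1/2) *\<^sub>R (e i + e j) \<in> L" by (rule half_sum_in_L[OF congruent frame(1)])
      have "- ((1/2) *\<^sub>R (e i + e j)) = (1/2) *\<^sub>R (- e i - e j)" by (simp add: vec_eq_iff field_simps)
      then have q: "(1/2) *\<^sub>R (- e i - e j) \<in> L" using L_uminus[OF p] by simp
      have "s *\<^sub>R e i + t *\<^sub>R e j \<in> {e i + e j, e i - e j, e j - e i, - e i - e j}" using that by auto
      then show ?thesis using p q congruent[of i j] congruent[of j i] by auto
    qed
    define u where "u = (\<lambda>i j k l s t p q. (1/2) *\<^sub>R (s *\<^sub>R e i + t *\<^sub>R e j + p *\<^sub>R e k + q *\<^sub>R e l))"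
    have u_eq: "b (u i j k l s t p q) (u i j k l s t p q) = b (u i j k l s' t' p' q') (u i j k l s' t' p' q')"
      if dist: "i \<noteq> j" "k \<noteq> i" "k \<noteq> j" "l \<noteq> i" "l \<noteq> j" "k \<noteq> l"
        and s: "s \<in> {1, -1}" "t \<in> {1, -1}" "p \<in> {1, -1}" "q \<in> {1, -1}" "s' \<in> {1, -1}" "t' \<in> {1, -1}" "p' \<in> {1, -1}" "q' \<in> {1, -1}"
        and prod: "s * t * p * q = s' * t' * p' * q'"
      for i j k l s t p q s' t' p' q'
    proof -
      have inL: "u i j k l s t p q \<in> L" if "s \<in> {1, -1}" "t \<in> {1, -1}" "p \<in> {1, -1}" "q \<in> {1, -1}" for s t p q
      proof -
        have "u i j k l s t p q = (1/2) *\<^sub>R (s *\<^sub>R e i + t *\<^sub>R e j) + (1/2) *\<^sub>R (p *\<^sub>R e k + q *\<^sub>R e l)"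
          by (simp add: u_def algebra_simps)
        then show ?thesis using L_add[OF pm[OF that(1,2)] pm[OF that(3,4)]] by (simp only:)
      qed
      have nu: "(norm (u i j k l s t p q))\<^sup>2 = 2 * m" if "s \<in> {1, -1}" "t \<in> {1, -1}" "p \<in> {1, -1}" "q \<in> {1, -1}" for s t p q
      proof -
        have "u i j k l s t p q \<bullet> u i j k l s t p q = (s * s * (2 * m) + t * t * (2 * m) + p * p * (2 * m) + q * q * (2 * m)) / 4"
          unfolding u_def using dist orth
          by (subst quadratic_form_combination[of inner]) (auto simp: ee inner_commute bilinear_conv_bounded_bilinear bounded_bilinear_inner)
        then show ?thesis using that by (auto simp: power2_norm_eq_inner)
      qed
      have half: "(1/2) *\<^sub>R (u i j k l s t p q - u i j k l s' t' p' q') \<in> L"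
      proof -
        define h where "h = (\<lambda>s s' :: real. (s - s') / 2)"
        have h0: "h x x = 0" for x by (simp add: h_def)
        have h: "h x y \<in> {1, -1}" if "x \<noteq> y" "x \<in> {1, -1}" "y \<in> {1, -1}" for x y
          using that by (auto simp: h_def)
        have eq: "(1/2) *\<^sub>R (u i j k l s t p q - u i j k l s' t' p' q') =
          (1/2) *\<^sub>R (h s s' *\<^sub>R e i + h t t' *\<^sub>R e j + h p p' *\<^sub>R e k + h q q' *\<^sub>R e l)"
          by (simp add: u_def h_def vec_eq_iff field_simps)
        \<comment> \<open>an even number of signs differ\<close>
        consider "s = s'" "t = t'" "p = p'" "q = q'" | "s \<noteq> s'" "t \<noteq> t'" "p = p'" "q = q'"
          | "s \<noteq> s'" "t = t'" "p \<noteq> p'" "q = q'" | "s \<noteq> s'" "t = t'" "p = p'" "q \<noteq> q'"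
          | "s = s'" "t \<noteq> t'" "p \<noteq> p'" "q = q'" | "s = s'" "t \<noteq> t'" "p = p'" "q \<noteq> q'"
          | "s = s'" "t = t'" "p \<noteq> p'" "q \<noteq> q'" | "s \<noteq> s'" "t \<noteq> t'" "p \<noteq> p'" "q \<noteq> q'"
          using s prod by (auto split: if_splits)
        then show ?thesis
        proof cases
          case 1
          then show ?thesis unfolding eq by (simp add: h0)
        next
          case 2
          have "(1/2) *\<^sub>R (h s s' *\<^sub>R e i + h t t' *\<^sub>R e j) \<in> L"
            by (rule pm[OF h[OF 2(1) s(1) s(5)] h[OF 2(2) s(2) s(6)]])
          then show ?thesis unfolding eq using 2 by (simp add: h0)
        next
          case 3
          have "(1/2) *\<^sub>R (h s s' *\<^sub>R e i + h p p' *\<^sub>R e k) \<in> L"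
            by (rule pm[OF h[OF 3(1) s(1) s(5)] h[OF 3(3) s(3) s(7)]])
          then show ?thesis unfolding eq using 3 by (simp add: h0)
        next
          case 4
          have "(1/2) *\<^sub>R (h s s' *\<^sub>R e i + h q q' *\<^sub>R e l) \<in> L"
            by (rule pm[OF h[OF 4(1) s(1) s(5)] h[OF 4(4) s(4) s(8)]])
          then show ?thesis unfolding eq using 4 by (simp add: h0)
        next
          case 5
          have "(1/2) *\<^sub>R (h t t' *\<^sub>R e j + h p p' *\<^sub>R e k) \<in> L"
            by (rule pm[OF h[OF 5(2) s(2) s(6)] h[OF 5(3) s(3) s(7)]])
          then show ?thesis unfolding eq using 5 by (simp add: h0)
        next
          case 6
          have "(1/2) *\<^sub>R (h t t' *\<^sub>R e j + h q q' *\<^sub>R e l) \<in> L"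
            by (rule pm[OF h[OF 6(2) s(2) s(6)] h[OF 6(4) s(4) s(8)]])
          then show ?thesis unfolding eq using 6 by (simp add: h0)
        next
          case 7
          have "(1/2) *\<^sub>R (h p p' *\<^sub>R e k + h q q' *\<^sub>R e l) \<in> L"
            by (rule pm[OF h[OF 7(3) s(3) s(7)] h[OF 7(4) s(4) s(8)]])
          then show ?thesis unfolding eq using 7 by (simp add: h0)
        next
          case 8
          have "(1/2) *\<^sub>R (h s s' *\<^sub>R e i + h t t' *\<^sub>R e j) + (1/2) *\<^sub>R (h p p' *\<^sub>R e k + h q q' *\<^sub>R e l) \<in> L"
            by (intro L_add pm h 8 s)
          then show ?thesis unfolding eq by (simp only: scaleR_add_right add.assoc)
        qed
      qed
      show ?thesis by (rule const) (use inL nu half s in auto)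
    qed
    have off: "b (e i) (e j) = 0" if ij: "i \<noteq> j" for i j
    proof -
      obtain k l where kl: "k \<noteq> i" "k \<noteq> j" "l \<noteq> i" "l \<noteq> j" "k \<noteq> l" using obtain_two_more[OF card ij] by blast
      note U = u_eq[OF ij kl, unfolded u_def quadratic_form_combination[OF bil sym]]
      show ?thesis
        using U[of 1 1 1 1 "-1" "-1" 1 1] U[of 1 1 1 1 "-1" 1 "-1" 1] U[of 1 1 1 1 "-1" 1 1 "-1"]
          U[of 1 1 1 "-1" "-1" "-1" 1 "-1"] U[of 1 1 1 "-1" "-1" 1 "-1" "-1"] U[of 1 1 1 "-1" "-1" 1 1 1]
        by simp
    qed
    obtain i0 :: 'n where True by simp
    define c where "c = b (e i0) (e i0) / (2 * m)"
    have diag: "b (e i) (e i) = b (e i0) (e i0)" for i by (rule const[OF frame(1,2) frame(1,2) congruent])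
    have be: "b (e i) (e j) = c * (e i \<bullet> e j)" for i j
      using diag[of i] off[of i j] orth[of i j] ee[of i] m by (cases "i = j") (auto simp: c_def)
    have span: "span (range e) = UNIV"
      using ee m orth by (intro orthogonal_family_span) (metis inner_zero_left mult_pos_pos less_irrefl zero_less_numeral, blast)
    have 1: "b x (e j) = c * (x \<bullet> e j)" for x j
    proof -
      have "x \<in> span (range e)" by (simp add: span)
      then show ?thesis
        by (induction rule: span_induct_alt)
           (auto simp: bilinear_lzero[OF bil] bilinear_ladd[OF bil] bilinear_lmul[OF bil] be inner_add_left algebra_simps)
    qed
    have 2: "b x y = c * (x \<bullet> y)" for x y
    proof -
      have "y \<in> span (range e)" by (simp add: span)
      then show ?thesis
        by (induction rule: span_induct_alt)
           (auto simp: bilinear_rzero[OF bil] bilinear_radd[OF bil] bilinear_rmul[OF bil] 1 inner_add_right algebra_simps)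
    qed
    have "x \<bullet> (Q' *v y) = x \<bullet> ((c *\<^sub>R ?Q) *v y)" for x y
    proof -
      have "x \<bullet> (Q' *v y) = b (A *v x) (A *v y)" by (simp add: b_def)
      also have "\<dots> = c * ((A *v x) \<bullet> (A *v y))" by (rule 2)
      also have "(A *v x) \<bullet> (A *v y) = x \<bullet> (?Q *v y)"
        by (metis dot_lmul_matrix inner_commute matrix_vector_mul_assoc transpose_matrix_vector)
      finally show ?thesis by (simp add: scaleR_matrix_vector_assoc[symmetric])
    qed
    then have "Q' = c *\<^sub>R ?Q"
      unfolding matrix_eq by (metis vector_eq_ldot)
    moreover have "c > 0"
    proof -
      have "matrix_inv A *v e i0 \<noteq> 0"
      proof
        assume "matrix_inv A *v e i0 = 0"
        then have "e i0 = 0" using arg_cong[of _ 0 "(*v) A"] A_inv(1)[of "e i0"] by (metis matrix_vector_mult_0_right)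
        then show False using ee[of i0] m by simp
      qed
      then have "b (e i0) (e i0) > 0" using Q' by (auto simp: is_PQF_def qform_def b_def)
      then show ?thesis using m by (simp add: c_def)
    qed
    ultimately show ?thesis by blast
  qed
  then have "rigid_PQF ?Q"
    using rigid_PQF_iff[OF is_PQF_gram[OF invertible]] by blast
  moreover have "associated_PQF ?Q L"
    unfolding associated_PQF_def is_lattice_basis_def using invertible L_eq by blast
  ultimately show ?thesis unfolding rigid_lattice_def by blast
qed

end

section \<open>The E8 lattice\<close>

lemma obtain_enumeration_8:
  obtains g :: "nat \<Rightarrow> 8" where "bij_betw g {0, 1, 2, 3, 4, 5, 6, 7} UNIV"
proof -
  obtain g :: "nat \<Rightarrow> 8" where "bij_betw g {0..<card (UNIV :: 8 set)} UNIV"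
    using ex_bij_betw_nat_finite[of "UNIV :: 8 set"] by auto
  moreover have "{0..<card (UNIV :: 8 set)} = {0, 1, 2, 3, 4, 5, 6, 7}" by auto
  ultimately show thesis using that by simp
qed

text \<open>
  The basis consists of \<open>2e\<^sub>0\<close>, the differences \<open>e\<^sub>k - e\<^sub>k\<^sub>-\<^sub>1\<close> for \<open>k = 1, \<dots>, 6\<close> and the vector with
  all coordinates \<open>1/2\<close>; \<open>U\<close> is the inverse of the coordinate map \<open>T\<close>. The coordinates
  are indexed by an arbitrary enumeration \<open>g\<close> of the index type, on which the lattice does not depend.
\<close>

lemma E8_lattice_basis: "\<exists>A :: real^8^8. invertible A \<and> E8_lattice = (*v) A ` int_vectors"
proof -
  note One_nat_def [simp del]
  obtain g :: "nat \<Rightarrow> 8" where g: "bij_betw g {0, 1, 2, 3, 4, 5, 6, 7} UNIV" using obtain_enumeration_8 by blast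
  define gi where "gi = inv_into {0, 1, 2, 3, 4, 5, 6, 7} g"
  have inj: "inj_on g {0, 1, 2, 3, 4, 5, 6, 7}" and UNIV_g: "UNIV = {g 0, g 1, g 2, g 3, g 4, g 5, g 6, g 7}"
    using g by (auto simp: bij_betw_def)
  have gi: "gi (g 0) = 0" "gi (g 1) = 1" "gi (g 2) = 2" "gi (g 3) = 3" "gi (g 4) = 4" "gi (g 5) = 5" "gi (g 6) = 6" "gi (g 7) = 7"
    unfolding gi_def by (rule inv_into_f_f[OF inj]; simp)+
  have all_g: "(\<forall>i. P i) \<longleftrightarrow> P (g 0) \<and> P (g 1) \<and> P (g 2) \<and> P (g 3) \<and> P (g 4) \<and> P (g 5) \<and> P (g 6) \<and> P (g 7)" for P
  proof -
    have "(\<forall>i\<in>UNIV. P i) \<longleftrightarrow> (\<forall>i\<in>{g 0, g 1, g 2, g 3, g 4, g 5, g 6, g 7}. P i)" using UNIV_g by metis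
    then show ?thesis by simp
  qed
  have sum_g: "sum F UNIV = F (g 0) + F (g 1) + F (g 2) + F (g 3) + F (g 4) + F (g 5) + F (g 6) + F (g 7)" for F :: "8 \<Rightarrow> real"
    using sum.reindex_bij_betw[OF g, of F] by simp
  define T :: "real^8 \<Rightarrow> real^8" where "T = (\<lambda>n. \<chi> i.
     if gi i = 0 then 2 * n $ g 0 - n $ g 1 + n $ g 7 / 2
     else if gi i = 7 then n $ g 7 / 2
     else if gi i = 6 then n $ g 6 + n $ g 7 / 2
     else n $ i - n $ g (gi i + 1) + n $ g 7 / 2)"
  define U :: "real^8 \<Rightarrow> real^8" where "U = (\<lambda>x. \<chi> i.
     if gi i = 0 then (x $ g 0 + x $ g 1 + x $ g 2 + x $ g 3 + x $ g 4 + x $ g 5 + x $ g 6 - 7 * x $ g 7) / 2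
     else if gi i = 7 then 2 * x $ g 7
     else (\<Sum>j=gi i..6. x $ g j - x $ g 7))"
  have T: "T n $ g 0 = 2 * n $ g 0 - n $ g 1 + n $ g 7 / 2" "T n $ g 1 = n $ g 1 - n $ g 2 + n $ g 7 / 2"
    "T n $ g 2 = n $ g 2 - n $ g 3 + n $ g 7 / 2" "T n $ g 3 = n $ g 3 - n $ g 4 + n $ g 7 / 2"
    "T n $ g 4 = n $ g 4 - n $ g 5 + n $ g 7 / 2" "T n $ g 5 = n $ g 5 - n $ g 6 + n $ g 7 / 2"
    "T n $ g 6 = n $ g 6 + n $ g 7 / 2" "T n $ g 7 = n $ g 7 / 2" for n
    by (simp_all add: T_def gi)
  have sets: "{1..6::nat} = {1, 2, 3, 4, 5, 6}" "{2..6::nat} = {2, 3, 4, 5, 6}" "{3..6::nat} = {3, 4, 5, 6}"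
    "{4..6::nat} = {4, 5, 6}" "{5..6::nat} = {5, 6}" by auto
  have U: "U x $ g 0 = (x $ g 0 + x $ g 1 + x $ g 2 + x $ g 3 + x $ g 4 + x $ g 5 + x $ g 6 - 7 * x $ g 7) / 2"
    "U x $ g 1 = x $ g 1 + x $ g 2 + x $ g 3 + x $ g 4 + x $ g 5 + x $ g 6 - 6 * x $ g 7"
    "U x $ g 2 = x $ g 2 + x $ g 3 + x $ g 4 + x $ g 5 + x $ g 6 - 5 * x $ g 7"
    "U x $ g 3 = x $ g 3 + x $ g 4 + x $ g 5 + x $ g 6 - 4 * x $ g 7"
    "U x $ g 4 = x $ g 4 + x $ g 5 + x $ g 6 - 3 * x $ g 7"
    "U x $ g 5 = x $ g 5 + x $ g 6 - 2 * x $ g 7" "U x $ g 6 = x $ g 6 - x $ g 7" "U x $ g 7 = 2 * x $ g 7" for x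
    by (simp_all add: U_def gi sets)
  have TU: "T (U x) = x" "U (T x) = x" for x
    by (simp_all add: vec_eq_iff all_g T U field_simps)
  have lin: "linear T" "linear U"
    by (auto intro!: linearI simp: vec_eq_iff all_g T U algebra_simps add_divide_distrib diff_divide_distrib)
  have A: "(*v) (matrix T) = T" using matrix_vector_mul(2)[OF lin(1)] by simp
  have "invertible (matrix T)"
    using lin TU by (subst matrix_invertible) (auto intro!: exI[of _ U] simp: fun_eq_iff)
  moreover have "T n \<in> E8_lattice" if "n \<in> int_vectors" for n
  proof -
    define z where "z i = \<lfloor>n $ i\<rfloor>" for i
    have z: "n $ i = of_int (z i)" for i
    proof -
      have "n $ i \<in> \<int>" using that by (simp add: int_vectors_def)
      then show ?thesis by (auto simp: z_def elim!: Ints_cases)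
    qed
    have sum: "(\<Sum>i\<in>UNIV. T n $ i) = 2 * of_int (z (g 0) + 2 * z (g 7))"
      unfolding sum_g T z by simp
    have cases: "(\<forall>i. T n $ i \<in> \<int>) \<or> (\<forall>i. T n $ i - 1/2 \<in> \<int>)"
    proof (cases "even (z (g 7))")
      case True
      then obtain y where "z (g 7) = 2 * y" by blast
      then have "of_int (z (g 7)) / 2 = (of_int y :: real)" by simp
      then show ?thesis unfolding all_g T z by auto
    next
      case False
      then obtain y where "z (g 7) = 2 * y + 1" by (rule oddE)
      then have y: "of_int (z (g 7)) / 2 = (of_int y + 1/2 :: real)" by simp
      have "a + (of_int y + 1/2) - 1/2 \<in> \<int>" if "a \<in> \<int>" for a :: real using that by simp
      then show ?thesis unfolding all_g T z y using Ints_of_int[of y] by (auto simp del: add_diff_cancel_right')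
    qed
    show ?thesis unfolding E8_lattice_def using sum cases by blast
  qed
  moreover have "\<exists>n\<in>int_vectors. x = T n" if x: "x \<in> E8_lattice" for x
  proof
    show "x = T (U x)" by (simp add: TU)
    obtain k :: int where k: "(\<Sum>i\<in>UNIV. x $ i) = 2 * of_int k" using x by (auto simp: E8_lattice_def)
    have diff: "x $ i - x $ j \<in> \<int>" for i j
    proof (cases "\<forall>i. x $ i \<in> \<int>")
      case False
      then have "x $ i - 1/2 \<in> \<int>" "x $ j - 1/2 \<in> \<int>" using x by (auto simp: E8_lattice_def)
      then have "(x $ i - 1/2) - (x $ j - 1/2) \<in> \<int>" by (rule Ints_diff)
      then show ?thesis by simp
    qed auto
    have dbl: "2 * x $ i \<in> \<int>" for i
    proof (cases "\<forall>i. x $ i \<in> \<int>")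
      case False
      then have "x $ i - 1/2 \<in> \<int>" using x by (auto simp: E8_lattice_def)
      then have "2 * (x $ i - 1/2) + 1 \<in> \<int>" by (intro Ints_add Ints_mult) auto
      then show ?thesis by simp
    qed auto
    define d where "d = (\<lambda>j. x $ g j - x $ g 7)"
    have d: "d j \<in> \<int>" for j unfolding d_def by (rule diff)
    have "U x $ g 0 = of_int k - 2 * (2 * x $ g 7)" using k unfolding U sum_g by (simp add: field_simps)
    then have "U x $ g 0 \<in> \<int>" using Ints_diff[OF Ints_of_int Ints_mult[OF Ints_numeral dbl]] by metis
    moreover have "U x $ g 1 = d 1 + d 2 + d 3 + d 4 + d 5 + d 6" "U x $ g 2 = d 2 + d 3 + d 4 + d 5 + d 6"
      "U x $ g 3 = d 3 + d 4 + d 5 + d 6" "U x $ g 4 = d 4 + d 5 + d 6" "U x $ g 5 = d 5 + d 6" "U x $ g 6 = d 6"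
      unfolding U d_def by simp_all
    ultimately show "U x \<in> int_vectors"
      unfolding int_vectors_def mem_Collect_eq all_g using d dbl[of "g 7"] U(8)[of x] by (auto intro!: Ints_add)
  qed
  ultimately show ?thesis by (intro exI[of _ "matrix T"]) (auto simp: A)
qed

lemma E8_norm_ge_2:
  assumes x: "x \<in> E8_lattice" "x \<noteq> 0"
  shows "(norm x)\<^sup>2 \<ge> 2"
proof -
  have n: "(norm x)\<^sup>2 = (\<Sum>i\<in>UNIV. (x $ i)\<^sup>2)" by (simp add: norm_vec_def L2_set_def sum_nonneg)
  show ?thesis
  proof (cases "\<forall>i. x $ i \<in> \<int>")
    case True
    define z where "z i = \<lfloor>x $ i\<rfloor>" for i
    have z: "x $ i = of_int (z i)" for i
    proof -
      have "x $ i \<in> \<int>" using True by blast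
      then show ?thesis by (auto simp: z_def elim!: Ints_cases)
    qed
    obtain k :: int where "(\<Sum>i\<in>UNIV. x $ i) = 2 * of_int k" using x by (auto simp: E8_lattice_def)
    then have k: "(\<Sum>i\<in>UNIV. z i) = 2 * k"
      unfolding z of_int_sum[symmetric] by linarith
    have "even (\<Sum>i\<in>UNIV. (z i)\<^sup>2 - z i)" by (intro dvd_sum) (simp add: power2_eq_square)
    then have "even (\<Sum>i\<in>UNIV. (z i)\<^sup>2)" using k by (simp add: sum_subtractf)
    moreover have "(\<Sum>i\<in>UNIV. (z i)\<^sup>2) > 0"
    proof -
      have nx: "(norm x)\<^sup>2 = of_int (\<Sum>i\<in>UNIV. (z i)\<^sup>2)" unfolding n z by simp
      have "(norm x)\<^sup>2 > 0" using x(2) by simp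
      then show ?thesis unfolding nx by (simp only: of_int_0_less_iff)
    qed
    ultimately have "(\<Sum>i\<in>UNIV. (z i)\<^sup>2) \<ge> 2" by presburger
    then have "real_of_int (\<Sum>i\<in>UNIV. (z i)\<^sup>2) \<ge> 2" by linarith
    then show ?thesis unfolding n z by simp
  next
    case False
    then have h: "x $ i - 1/2 \<in> \<int>" for i using x by (auto simp: E8_lattice_def)
    have "(x $ i)\<^sup>2 \<ge> 1/4" for i
    proof -
      obtain y where "x $ i - 1/2 = of_int y" using h by (metis Ints_cases)
      then have y: "x $ i = of_int y + 1/2" by simp
      have "y * (y + 1) \<ge> 0" by (simp add: zero_le_mult_iff) linarith
      then have "real_of_int (y * (y + 1)) \<ge> 0" by (simp only: of_int_0_le_iff)
      then show ?thesis unfolding y by (simp add: power2_eq_square algebra_simps)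
    qed
    then have "(\<Sum>i\<in>(UNIV::8 set). 1/4) \<le> (\<Sum>i\<in>UNIV. (x $ i)\<^sup>2)" by (intro sum_mono)
    then show ?thesis unfolding n by simp
  qed
qed

theorem rigid_E8: "rigid_lattice E8_lattice"
proof -
  obtain A :: "real^8^8" where A: "invertible A" "E8_lattice = (*v) A ` int_vectors" using E8_lattice_basis by blast
  interpret lattice_with_basis A E8_lattice by unfold_locales (rule A)+
  have axis_sum: "(\<Sum>j\<in>UNIV. axis i (c::real) $ j) = c" for i :: 8 and c
    by (simp add: axis_def)
  have mem: "v \<in> E8_lattice" if "\<And>i. v $ i \<in> \<int>" "(\<Sum>j\<in>UNIV. v $ j) = 2 * of_int k" for v and k :: int
    using that unfolding E8_lattice_def by blast
  show ?thesis
  proof (rule rigid_of_frame[where m = 2 and e = "\<lambda>i. axis i 2"])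
    show "axis i 2 \<in> E8_lattice" for i
    proof (rule mem[of _ 1])
      show "axis i 2 $ k \<in> \<int>" for k :: 8 by (simp add: axis_def)
    qed (simp add: axis_sum)
    show "(1/2) *\<^sub>R (axis i 2 - axis j 2) \<in> E8_lattice" for i j
    proof -
      have eq: "(1/2) *\<^sub>R (axis i 2 - axis j 2) = axis i 1 - (axis j 1 :: real^8)"
        by (simp add: vec_eq_iff axis_def)
      show ?thesis unfolding eq
      proof (rule mem[of _ 0])
        show "(axis i 1 - axis j 1 :: real^8) $ k \<in> \<int>" for k by (simp add: axis_def)
      qed (simp add: sum_subtractf axis_sum)
    qed
    show "(norm (axis i (2::real)))\<^sup>2 = 2 * 2" for i :: 8
      by (simp add: power2_norm_eq_inner inner_axis_axis)
    show "axis i (2::real) \<bullet> axis j 2 = 0" if "i \<noteq> j" for i j :: 8 using that by (simp add: inner_axis_axis)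
  qed (use E8_norm_ge_2 in auto)
qed

section \<open>The Leech lattice\<close>

lemma det_Ints:
  fixes A :: "real^'n^'n"
  assumes "\<And>i j. A $ i $ j \<in> \<int>"
  shows "det A \<in> \<int>"
  unfolding det_def using assms by (intro Ints_sum Ints_mult Ints_prod) auto

lemma card_le_card_image_times:
  assumes "finite S" "\<And>y. y \<in> f ` S \<Longrightarrow> card {x \<in> S. f x = y} \<le> k"
  shows "card S \<le> k * card (f ` S)"
proof -
  have "S = (\<Union>y\<in>f ` S. {x \<in> S. f x = y})" by auto
  then have "card S \<le> (\<Sum>y\<in>f ` S. card {x \<in> S. f x = y})"
    using card_UN_le[of "f ` S" "\<lambda>y. {x \<in> S. f x = y}"] assms(1) by simp
  also have "\<dots> \<le> (\<Sum>y\<in>f ` S. k)" using assms(2) by (intro sum_mono)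
  finally show ?thesis by (simp add: mult.commute)
qed

text \<open>
  Choosing one vector from each pair \<open>{x, -x}\<close> leaves an orthogonal, hence independent set of more than
  \<open>n - 1\<close> vectors.
\<close>

lemma obtain_frame_of_signed_orthogonal:
  fixes K :: "(real^'n) set"
  assumes fin: "finite K" and card: "card K > 2 * (CARD('n) - 1)" and nz: "0 \<notin> K"
    and orth: "\<And>x y. x \<in> K \<Longrightarrow> y \<in> K \<Longrightarrow> x \<noteq> y \<Longrightarrow> x \<noteq> - y \<Longrightarrow> x \<bullet> y = 0"
  obtains e :: "'n \<Rightarrow> real^'n"
  where "\<And>i. e i \<in> K" "\<And>i j. i \<noteq> j \<Longrightarrow> e i \<bullet> e j = 0"
proof -
  define rep where "rep = (\<lambda>x. SOME y. y \<in> K \<and> (y = x \<or> y = - x))"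
  have rep: "rep x \<in> K \<and> (rep x = x \<or> rep x = - x)" if "x \<in> K" for x
    unfolding rep_def by (rule someI[of _ x]) (use that in auto)
  have rep_minus: "rep (- x) = rep x" for x
    unfolding rep_def by (rule arg_cong[of _ _ Eps]) (auto simp: fun_eq_iff)
  define T where "T = rep ` K"
  have TK: "T \<subseteq> K" using rep by (auto simp: T_def)
  have orthT: "x \<bullet> y = 0" if xT: "x \<in> T" and yT: "y \<in> T" and ne: "x \<noteq> y" for x y
  proof (rule orth)
    show "x \<in> K" "y \<in> K" using xT yT TK by auto
    show "x \<noteq> - y"
    proof
      assume xy: "x = - y"
      obtain a b where ab: "a \<in> K" "x = rep a" "b \<in> K" "y = rep b"
        using xT yT by (auto simp: T_def)
      have "rep x = rep y" unfolding xy by (rule rep_minus)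
      moreover have "rep x = x" using ab rep[OF ab(1)] rep_minus[of a] by auto
      moreover have "rep y = y" using ab rep[OF ab(3)] rep_minus[of b] by auto
      ultimately show False using ne by simp
    qed
  qed (rule ne)
  have "pairwise orthogonal T" using orthT by (auto simp: pairwise_def orthogonal_def)
  then have "independent T" using TK nz by (intro pairwise_orthogonal_independent) auto
  then have le: "card T \<le> CARD('n)" using independent_bound[of T] by simp
  have finT: "finite T" using fin by (simp add: T_def)
  have "K \<subseteq> T \<union> uminus ` T"
  proof
    fix x assume "x \<in> K"
    then have "rep x \<in> T" "rep x = x \<or> rep x = - x" using rep by (auto simp: T_def)
    then show "x \<in> T \<union> uminus ` T" by (auto simp: image_iff) (metis minus_minus)
  qed
  then have "card K \<le> card (T \<union> uminus ` T)" using finT by (intro card_mono) auto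
  also have "\<dots> \<le> card T + card (uminus ` T)" by (rule card_Un_le)
  also have "\<dots> \<le> 2 * card T" using card_image_le[OF finT, of uminus] by simp
  finally have "card T = CARD('n)" using card le by linarith
  then obtain e where e: "bij_betw e (UNIV :: 'n set) T"
    using finite_same_card_bij[of "UNIV :: 'n set" T] finT by auto
  show thesis
  proof (rule that[of e])
    show "e i \<in> K" for i using e TK by (auto simp: bij_betw_def)
    show "e i \<bullet> e j = 0" if "i \<noteq> j" for i j
      by (rule orthT) (use e that in \<open>auto simp: bij_betw_def inj_def\<close>)
  qed
qed

context lattice_with_basis
begin

definition shell :: "nat \<Rightarrow> (real^'n) set" where
  "shell n = {x \<in> L. (norm x)\<^sup>2 = 2 * real n}"

lemma finite_shell: "finite (shell n)"
proof -
  obtain k where k: "k > 0" "\<And>y. k * norm y \<le> norm (A *v y)" using invertible_bounded_below[OF invertible] by blast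
  have "shell n \<subseteq> (*v) A ` {v \<in> int_vectors. norm v \<le> sqrt (2 * real n) / k}"
  proof
    fix x assume x: "x \<in> shell n"
    then have "x \<in> L" by (simp add: shell_def)
    then obtain v where v: "v \<in> int_vectors" "x = A *v v" unfolding L_eq by blast
    have "norm x = sqrt (2 * real n)" using x by (metis (mono_tags, lifting) mem_Collect_eq norm_ge_zero real_sqrt_unique shell_def)
    then have "k * norm v \<le> sqrt (2 * real n)" using k(2)[of v] v by simp
    then have "norm v \<le> sqrt (2 * real n) / k" using k(1) by (simp add: field_simps)
    then show "x \<in> (*v) A ` {v \<in> int_vectors. norm v \<le> sqrt (2 * real n) / k}" using v by blast
  qed
  then show ?thesis by (rule finite_subset) (intro finite_imageI finite_int_vectors_ball)
qed

lemma lattice_theta_shells: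
  assumes even: "\<And>x. x \<in> L \<Longrightarrow> \<exists>n::nat. (norm x)\<^sup>2 = 2 * real n" and t: "t > 0"
  shows "(\<lambda>n. real (card (shell n)) * exp (- 2 * pi * t) ^ n) sums lattice_theta L t"
proof -
  let ?f = "\<lambda>x. exp (- pi * t * (norm x)\<^sup>2)"
  have bij: "bij_betw snd (Sigma UNIV shell) L"
  proof (rule bij_betwI')
    show "\<exists>p\<in>Sigma UNIV shell. y = snd p" if "y \<in> L" for y
      using even[OF that] that by (auto simp: shell_def)
  qed (auto simp: shell_def)
  have "(?f has_sum lattice_theta L t) L"
    unfolding lattice_theta_def by (rule has_sum_infsum[OF lattice_theta_summable[OF invertible L_eq t]])
  then have "((\<lambda>p. ?f (snd p)) has_sum lattice_theta L t) (Sigma UNIV shell)"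
    using has_sum_reindex_bij_betw[OF bij, of ?f] by simp
  then have "((\<lambda>n. real (card (shell n)) * exp (- 2 * pi * t) ^ n) has_sum lattice_theta L t) UNIV"
  proof (rule has_sum_SigmaD)
    fix n :: nat
    have "((\<lambda>x. ?f x) has_sum (\<Sum>x\<in>shell n. ?f x)) (shell n)"
      by (rule has_sum_finite[OF finite_shell])
    also have "(\<Sum>x\<in>shell n. ?f x) = (\<Sum>x\<in>shell n. exp (- 2 * pi * t) ^ n)"
      by (rule sum.cong) (auto simp: shell_def simp flip: exp_of_nat_mult)
    finally show "((\<lambda>x. ?f (snd (n, x))) has_sum (real (card (shell n)) * exp (- 2 * pi * t) ^ n)) (shell n)" by simp
  qed
  then show ?thesis by (rule has_sum_imp_sums)
qed

text \<open>
  By Cramer's rule the Gram matrix, integral of determinant 1, has an integral inverse.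
\<close>

lemma self_dual_of_unimodular:
  assumes det: "\<bar>det A\<bar> = 1" and int: "\<And>x y. x \<in> L \<Longrightarrow> y \<in> L \<Longrightarrow> x \<bullet> y \<in> \<int>"
  shows "L = (*v) (transpose (matrix_inv A)) ` int_vectors"
proof -
  let ?B = "transpose (matrix_inv A)"
  define G where "G = transpose A ** A"
  have BA: "?B *v (transpose A *v x) = x" for x
  proof -
    have "?B ** transpose A = mat 1"
      by (metis invertible matrix_inv_right matrix_transpose_mul transpose_mat)
    then show ?thesis by (metis matrix_vector_mul_assoc matrix_vector_mul_lid)
  qed
  have AB: "transpose A *v (?B *v x) = x" for x
  proof -
    have "transpose A ** ?B = mat 1"
      by (metis invertible matrix_inv_left matrix_transpose_mul transpose_mat)
    then show ?thesis by (metis matrix_vector_mul_assoc matrix_vector_mul_lid)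
  qed
  have col: "A *v axis i 1 \<in> L" for i by (simp add: L_eq)
  have comp: "(transpose A *v x) $ i = x \<bullet> (A *v axis i 1)" for x i
  proof -
    have "x \<bullet> (A *v axis i 1) = (transpose A *v x) \<bullet> axis i 1" by (simp add: dot_lmul_matrix)
    then show ?thesis by (simp only: inner_axis) simp
  qed
  have G: "G $ i $ j \<in> \<int>" for i j
  proof -
    have "G $ i $ j = (G *v axis j 1) $ i" by (simp add: matrix_vector_mult_basis column_def)
    also have "\<dots> = (A *v axis j 1) \<bullet> (A *v axis i 1)"
      unfolding G_def matrix_vector_mul_assoc[symmetric] by (rule comp)
    finally show ?thesis using int[OF col col] by simp
  qed
  have detG: "det G = 1"
    using det by (simp add: G_def det_mul) (metis abs_mult_self_eq mult_1)
  have "x \<in> (*v) ?B ` int_vectors" if "x \<in> L" for x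
  proof
    show "x = ?B *v (transpose A *v x)" by (simp only: BA)
    show "transpose A *v x \<in> int_vectors"
      unfolding int_vectors_def mem_Collect_eq comp using int[OF that col] by blast
  qed
  moreover have "?B *v n \<in> L" if n: "n \<in> int_vectors" for n
  proof -
    define z where "z = matrix_inv A *v (?B *v n)"
    have "G *v z = n"
      unfolding z_def G_def matrix_vector_mul_assoc[symmetric] A_inv(1) by (rule AB)
    then have z: "z = (\<chi> k. det (\<chi> i j. if j = k then n $ i else G $ i $ j) / det G)"
      using cramer[of G z n] detG by simp
    have "z \<in> int_vectors"
      unfolding int_vectors_def
    proof safe
      fix k
      have "det (\<chi> i j. if j = k then n $ i else G $ i $ j) \<in> \<int>"
        by (rule det_Ints) (use n G in \<open>auto simp: int_vectors_def\<close>)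
      then show "z $ k \<in> \<int>" unfolding z detG by simp
    qed
    then show ?thesis unfolding coords z_def .
  qed
  ultimately show ?thesis by auto
qed

text \<open>
  A label for the class modulo \<open>2L\<close>: there are as many labels as subsets of the index type, \<open>2\<^sup>n\<close>.
\<close>

definition parity_class :: "real^'n \<Rightarrow> 'n set" where
  "parity_class x = {i. odd \<lfloor>(matrix_inv A *v x) $ i\<rfloor>}"

lemma parity_class_eq:
  assumes "x \<in> L" "y \<in> L" "parity_class x = parity_class y"
  shows "(1/2) *\<^sub>R (x - y) \<in> L"
  unfolding coords int_vectors_def
proof safe
  fix i
  let ?u = "matrix_inv A *v x" and ?v = "matrix_inv A *v y"
  have "?u $ i \<in> \<int>" "?v $ i \<in> \<int>" using assms(1,2) by (auto simp: coords int_vectors_def)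
  then obtain a b where ab: "?u $ i = of_int a" "?v $ i = of_int b" by (auto elim!: Ints_cases)
  have "odd \<lfloor>?u $ i\<rfloor> \<longleftrightarrow> odd \<lfloor>?v $ i\<rfloor>" using assms(3) unfolding parity_class_def by blast
  then have "even (a - b)" unfolding ab by simp
  then obtain c where c: "a - b = 2 * c" by blast
  have "(matrix_inv A *v ((1/2) *\<^sub>R (x - y))) $ i = (of_int a - of_int b) / 2"
    by (simp add: matrix_vector_mult_scaleR matrix_vector_mult_diff_distrib ab)
  also have "\<dots> = of_int c" using c by (simp flip: of_int_diff)
  finally show "(matrix_inv A *v ((1/2) *\<^sub>R (x - y))) $ i \<in> \<int>" by simp
qed

text \<open>
  Congruent vectors of shells \<open>n\<close> and \<open>n'\<close> with \<open>n + n' < 8\<close> are equal or opposite. A class containing more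
  than \<open>2(d - 1)\<close> vectors of norm 8 contains a frame; otherwise the four shells 0, 2, 3, 4 occupy
  more than \<open>2\<^sup>d\<close> classes.
\<close>

lemma exists_frame:
  assumes min: "\<And>x. x \<in> L \<Longrightarrow> x \<noteq> 0 \<Longrightarrow> (norm x)\<^sup>2 \<ge> 4"
    and many: "real (card (shell 2)) / 2 + real (card (shell 3)) / 2 + real (card (shell 4)) / (2 * (real CARD('n) - 1)) \<ge> 2 ^ CARD('n)"
    and dim: "CARD('n) \<ge> 2"
  shows "\<exists>e :: 'n \<Rightarrow> real^'n. (\<forall>i. e i \<in> L \<and> (norm (e i))\<^sup>2 = 8) \<and>
     (\<forall>i j. i \<noteq> j \<longrightarrow> e i \<bullet> e j = 0) \<and> (\<forall>i j. (1/2) *\<^sub>R (e i - e j) \<in> L)"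
proof (rule ccontr)
  assume no_frame: "\<not> ?thesis"
  let ?k = "2 * (CARD('n) - 1)"
  have close: "(norm x)\<^sup>2 + (norm y)\<^sup>2 \<ge> 16"
    "(norm x)\<^sup>2 + (norm y)\<^sup>2 = 16 \<Longrightarrow> (norm x)\<^sup>2 = (norm y)\<^sup>2 \<Longrightarrow> x \<bullet> y = 0"
    if "x \<in> L" "y \<in> L" "parity_class x = parity_class y" "x \<noteq> y" "x \<noteq> - y" for x y
    using norm_congruent_ge[OF min that(2) parity_class_eq[OF that(1-3)] that(4,5)] by simp_all
  have small: "card (shell n) \<le> 2 * card (parity_class ` shell n)" if "n < 4" for n
  proof (rule card_le_card_image_times[OF finite_shell])
    fix c assume "c \<in> parity_class ` shell n"
    then obtain x where x: "x \<in> shell n" "c = parity_class x" by auto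
    have "{y \<in> shell n. parity_class y = c} \<subseteq> {x, - x}"
    proof
      fix y assume y: "y \<in> {y \<in> shell n. parity_class y = c}"
      have yx: "y \<in> L" "x \<in> L" "(norm y)\<^sup>2 = 2 * real n" "(norm x)\<^sup>2 = 2 * real n"
        "parity_class y = parity_class x" using x y by (simp_all add: shell_def)
      have "real n < 4" using that by simp
      then have "\<not> (norm y)\<^sup>2 + (norm x)\<^sup>2 \<ge> 16" unfolding yx by linarith
      then have "y = x \<or> y = - x" using close(1)[OF yx(1,2,5)] by blast
      then show "y \<in> {x, - x}" by blast
    qed
    then have "card {y \<in> shell n. parity_class y = c} \<le> card {x, - x}" by (intro card_mono) auto
    also have "\<dots> \<le> 2" by (simp add: card_insert_if)
    finally show "card {y \<in> shell n. parity_class y = c} \<le> 2" .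
  qed
  have big: "card (shell 4) \<le> ?k * card (parity_class ` shell 4)"
  proof (rule card_le_card_image_times[OF finite_shell], rule ccontr)
    fix c
    define K where "K = {y \<in> shell 4. parity_class y = c}"
    assume "\<not> card {y \<in> shell 4. parity_class y = c} \<le> ?k"
    then have card: "card K > ?k" by (simp add: K_def)
    have fin: "finite K" using finite_shell[of 4] by (simp add: K_def)
    have K: "x \<in> L" "(norm x)\<^sup>2 = 8" "parity_class x = c" if "x \<in> K" for x
      using that by (auto simp: K_def shell_def)
    have nz: "0 \<notin> K"
    proof
      assume "0 \<in> K"
      from K(2)[OF this] show False by simp
    qed
    have orth: "x \<bullet> y = 0" if "x \<in> K" "y \<in> K" "x \<noteq> y" "x \<noteq> - y" for x y
    proof (rule close(2))
      show "x \<in> L" "y \<in> L" using K(1) that by blast+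
      show "parity_class x = parity_class y" "(norm x)\<^sup>2 = (norm y)\<^sup>2" "(norm x)\<^sup>2 + (norm y)\<^sup>2 = 16"
        using K(2,3)[OF that(1)] K(2,3)[OF that(2)] by simp_all
    qed (rule that)+
    obtain e :: "'n \<Rightarrow> real^'n" where e: "\<And>i. e i \<in> K" "\<And>i j. i \<noteq> j \<Longrightarrow> e i \<bullet> e j = 0"
    proof (rule obtain_frame_of_signed_orthogonal[OF fin card nz])
      show "x \<bullet> y = 0" if "x \<in> K" "y \<in> K" "x \<noteq> y" "x \<noteq> - y" for x y using that by (rule orth)
    qed (rule that)
    have half: "(1/2) *\<^sub>R (e i - e j) \<in> L" for i j
      by (rule parity_class_eq[OF K(1)[OF e(1)] K(1)[OF e(1)]])
         (simp only: K(3)[OF e(1)])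
    show False
      by (rule notE[OF no_frame], intro exI[of _ e] conjI allI impI K(1,2)[OF e(1)] e(2) half)
  qed
  have disj: "parity_class x \<noteq> parity_class y"
    if "x \<in> shell i" "y \<in> shell j" "i < j" "i + j < 8" for x y i j
  proof
    assume eq: "parity_class x = parity_class y"
    have xy: "x \<in> L" "y \<in> L" "(norm x)\<^sup>2 = 2 * real i" "(norm y)\<^sup>2 = 2 * real j"
      using that by (simp_all add: shell_def)
    have ij: "real i < real j" "real i + real j < 8" using that(3,4) by linarith+
    have "x \<noteq> y" "x \<noteq> - y" using xy(3,4) ij(1) by (metis less_irrefl mult_left_cancel zero_neq_numeral, metis less_irrefl mult_left_cancel norm_minus_cancel zero_neq_numeral)
    then have "(norm x)\<^sup>2 + (norm y)\<^sup>2 \<ge> 16" by (rule close(1)[OF xy(1,2) eq])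
    then show False using ij(2) unfolding xy by linarith
  qed
  define P where "P n = parity_class ` shell n" for n
  have finP: "finite (P n)" for n using finite_shell by (simp add: P_def)
  have D: "P i \<inter> P j = {}" if "i < j" "i + j < 8" for i j
    unfolding P_def using disj that by blast
  have "card (P 0 \<union> P 2) = card (P 0) + card (P 2)"
    by (rule card_Un_disjoint[OF finP finP D]) simp_all
  moreover have "card (P 0 \<union> P 2 \<union> P 3) = card (P 0 \<union> P 2) + card (P 3)"
    using D[of 0 3] D[of 2 3] finP by (intro card_Un_disjoint) (simp_all add: Int_Un_distrib2)
  moreover have "card (P 0 \<union> P 2 \<union> P 3 \<union> P 4) = card (P 0 \<union> P 2 \<union> P 3) + card (P 4)"
    using D[of 0 4] D[of 2 4] D[of 3 4] finP by (intro card_Un_disjoint) (simp_all add: Int_Un_distrib2)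
  moreover have "card (P 0 \<union> P 2 \<union> P 3 \<union> P 4) \<le> card (UNIV :: 'n set set)" by (intro card_mono) auto
  moreover have "card (UNIV :: 'n set set) = 2 ^ CARD('n)" using card_Pow[of "UNIV :: 'n set"] by simp
  moreover have "card (P 0) = 1"
  proof -
    have "shell 0 = {0}" by (auto simp: shell_def)
    then show ?thesis by (simp add: P_def)
  qed
  ultimately have "1 + card (P 2) + card (P 3) + card (P 4) \<le> 2 ^ CARD('n)" by linarith
  then have "real (1 + card (P 2) + card (P 3) + card (P 4)) \<le> real (2 ^ CARD('n))"
    by (rule of_nat_mono)
  then have le: "1 + real (card (P 2)) + real (card (P 3)) + real (card (P 4)) \<le> 2 ^ CARD('n)"
    by (simp only: of_nat_add of_nat_power of_nat_1 of_nat_numeral)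
  have small': "real (card (shell n)) / 2 \<le> real (card (P n))" if "n < 4" for n
    using small[OF that] by (simp add: P_def)
  have "real (card (shell 4)) / (2 * (real CARD('n) - 1)) \<le> real (card (P 4))"
  proof -
    have k: "real ?k = 2 * (real CARD('n) - 1)" "real ?k > 0" using dim by (auto simp: of_nat_diff)
    have "real (card (shell 4)) \<le> real ?k * real (card (P 4))"
      using big by (simp only: P_def of_nat_le_iff flip: of_nat_mult)
    then show ?thesis using k(2) unfolding k(1)[symmetric] by (simp add: field_simps)
  qed
  then show False using le many small'[of 2] small'[of 3] by linarith
qed

end

text \<open>
  The differences of the coefficients of the two theta series satisfy the hypotheses of
  \<open>weight_12_vanishing\<close>.
\<close>

lemma Leech_shell_sizes:
  fixes A :: "real^24^24"
  assumes "lattice_with_basis A L" and det: "\<bar>det A\<bar> = 1"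
    and int: "\<And>x y. x \<in> L \<Longrightarrow> y \<in> L \<Longrightarrow> x \<bullet> y \<in> \<int>"
    and even: "\<And>x. x \<in> L \<Longrightarrow> \<exists>n::nat. (norm x)\<^sup>2 = 2 * real n"
    and no_roots: "\<And>x. x \<in> L \<Longrightarrow> (norm x)\<^sup>2 \<noteq> 2"
  shows "real (card (lattice_with_basis.shell L n)) = fps_nth comparison_form (2 * n)"
proof -
  interpret lattice_with_basis A L by fact
  define c where "c = (\<lambda>n. real (card (shell n)) - fps_nth comparison_form (2 * n))"
  have sums: "(\<lambda>n. c n * exp (- 2 * pi * t) ^ n) sums (lattice_theta L t - eval_fps comparison_form (exp (- pi * t)))"
    if "t > 0" for t
    unfolding c_def left_diff_distrib
    by (intro sums_diff lattice_theta_shells even comparison_form_sums that)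
  have "c n = 0"
  proof (rule weight_12_vanishing)
    have "shell 0 = {0}" by (auto simp: shell_def)
    then show "c 0 = 0" using starts_comparison_form by (simp add: c_def starts_def)
    have "shell 1 = {}" using no_roots by (auto simp: shell_def)
    then show "c 1 = 0" using starts_comparison_form by (simp add: c_def starts_def)
    show "summable (\<lambda>n. c n * r ^ n)" if r: "0 < r" "r < 1" for r
    proof -
      define t where "t = - ln r / (2 * pi)"
      have "ln r < 0" using r by simp
      then have "t > 0" by (simp add: t_def divide_neg_pos)
      moreover have "exp (- 2 * pi * t) = r" using r by (simp add: t_def)
      ultimately show ?thesis using sums[of t] by (simp add: sums_iff)
    qed
    fix t :: real assume t: "t > 0"
    have "(\<Sum>n. c n * exp (- 2 * pi / t) ^ n) = lattice_theta L (1 / t) - eval_fps comparison_form (exp (- pi / t))"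
      using sums[of "1 / t"] t by (simp add: sums_iff)
    also have "lattice_theta L (1 / t) = sqrt t ^ 24 * lattice_theta L t"
      using lattice_theta_inversion[OF invertible L_eq self_dual_of_unimodular[OF det int] t] by simp
    also have "sqrt t ^ 24 = (sqrt t ^ 2) ^ 12" by (simp flip: power_mult)
    also have "(sqrt t ^ 2) ^ 12 = t ^ 12" using t by simp
    also have "eval_fps comparison_form (exp (- pi / t)) = t ^ 12 * eval_fps comparison_form (exp (- pi * t))"
      by (rule comparison_form_inversion[OF t])
    finally show "(\<Sum>n. c n * exp (- 2 * pi / t) ^ n) = t ^ 12 * (\<Sum>n. c n * exp (- 2 * pi * t) ^ n)"
      using sums[OF t] by (simp add: sums_iff right_diff_distrib)
  qed
  then show ?thesis by (simp add: c_def)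
qed

theorem rigid_Leech:
  assumes "is_Leech_lattice \<Lambda>"
  shows "rigid_lattice \<Lambda>"
proof -
  have even: "\<exists>n::nat. (norm x)\<^sup>2 = 2 * real n" if x: "x \<in> \<Lambda>" for x
  proof -
    obtain k :: int where k: "x \<bullet> x = 2 * of_int k"
      using assms x by (auto simp: is_Leech_lattice_def even_lattice_def)
    moreover have "k \<ge> 0" using k inner_ge_zero[of x] by simp
    ultimately show ?thesis by (intro exI[of _ "nat k"]) (simp add: power2_norm_eq_inner)
  qed
  have no_roots: "(norm x)\<^sup>2 \<noteq> 2" if "x \<in> \<Lambda>" for x
    using assms that by (simp add: is_Leech_lattice_def power2_norm_eq_inner)
  have min: "(norm x)\<^sup>2 \<ge> 4" if "x \<in> \<Lambda>" "x \<noteq> 0" for x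
  proof -
    obtain n where n: "(norm x)\<^sup>2 = 2 * real n" using even[OF \<open>x \<in> \<Lambda>\<close>] by blast
    have "n \<noteq> 0" using n that(2) by (intro notI) simp
    moreover have "n \<noteq> 1" using n no_roots[OF \<open>x \<in> \<Lambda>\<close>] by auto
    ultimately have "n \<ge> 2" by linarith
    then show ?thesis unfolding n by simp
  qed
  obtain A where A: "is_lattice_basis A \<Lambda>" "\<bar>det A\<bar> = 1" and int: "\<And>x y. x \<in> \<Lambda> \<Longrightarrow> y \<in> \<Lambda> \<Longrightarrow> x \<bullet> y \<in> \<int>"
    using assms by (auto simp: is_Leech_lattice_def unimodular_lattice_def)
  interpret lattice_with_basis A \<Lambda> using A(1) by unfold_locales (auto simp: is_lattice_basis_def)
  note sizes = Leech_shell_sizes[OF lattice_with_basis_axioms A(2) int even no_roots]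
  have "real (card (shell 2)) = 196560" "real (card (shell 3)) = 16773120" "real (card (shell 4)) = 398034000"
    using sizes[of 2] sizes[of 3] sizes[of 4] starts_comparison_form by (simp_all add: starts_def)
  then have "\<exists>e :: 24 \<Rightarrow> real^24. (\<forall>i. e i \<in> \<Lambda> \<and> (norm (e i))\<^sup>2 = 8) \<and>
     (\<forall>i j. i \<noteq> j \<longrightarrow> e i \<bullet> e j = 0) \<and> (\<forall>i j. (1/2) *\<^sub>R (e i - e j) \<in> \<Lambda>)"
    by (intro exists_frame min) simp_all
  then obtain e :: "24 \<Rightarrow> real^24" where e: "\<forall>i. e i \<in> \<Lambda> \<and> (norm (e i))\<^sup>2 = 8"
    "\<forall>i j. i \<noteq> j \<longrightarrow> e i \<bullet> e j = 0" "\<forall>i j. (1/2) *\<^sub>R (e i - e j) \<in> \<Lambda>" by blast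
  show ?thesis by (rule rigid_of_frame[where m = 4 and e = e]) (use e min in auto)
qed

theorem theorem1p4:
  shows "(\<forall>\<Lambda> :: (real^24) set. is_Leech_lattice \<Lambda> \<longrightarrow> rigid_lattice \<Lambda>) \<and>
         rigid_lattice E8_lattice"
  using rigid_Leech rigid_E8 by blast

end
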